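(* Let $A$ be a nonempty compact subset of a reduced complex space $X$ on which a strictly plurisubharmonic function $\rho$ is defined. Let $\Psi_1(A)$ be the set of points at which $A$ is set-theoretically $1$-pseudoconvex. Then $\Psi_1(A)\ne\emptyset$ and $$\max_A|u|=\sup_{p\in\Psi_1(A)}|u(p)|\qquad\text{for all } u\in\tilde{\mathscr{O}}_A\big(A\setminus\overline{\Psi_1(A)}\big)\cap\mathcal{C}^0(A).$$
   Context: Complex spaces are Hausdorff, and $X$ is a reduced complex space of pure dimension. A strictly plurisubharmonic function on $X$ is a real valued function which, locally in embeddings of open pieces of $X$ as analytic subvarieties of open sets of $\mathbb{C}^N$, is the restriction of a $\mathcal{C}^2$ strictly plurisubharmonic function. The notation $u\in\tilde{\mathscr{O}}_A(V)\cap\mathcal{C}^0(A)$ means that $u$ is continuous on $A$ and its restriction to $V$ belongs to $\tilde{\mathscr{O}}_A(V)$. Pseudoconvexity. Let $q$ be an integer, $p\in A$. $A$ is set-theoretically $q$-pseudoconvex at $p$ if there are an open neighbourhood $\omega_p$ of $p$ in $X$, an isomorphism $z$ of $\omega_p$ onto a local model $Z$ (a closed analytic subvariety of an open set $U\subset\mathbb{C}^N$, with its reduced structure), a function $\rho\in\mathcal{C}^\infty(U,\mathbb{R})$ and an open set $\omega'_p$ with $p\in\omega'_p\subseteq\omega_p$ such that $z(A\cap\omega'_p)\subseteq\{\rho\le\rho(z(p))\}$ and the complex Hessian $(\partial^2\rho/\partial z_i\partial\bar z_j)$ at $z(p)$ has at least $N-q+1$ positive eigenvalues. (This does not depend on the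 choice of the local model.) LACR functions. $\mathcal{C}_A$ is the sheaf of germs of continuous complex valued functions on $A$. $\mathscr{O}_A\subseteq\mathcal{C}_A$ is the subsheaf of germs of functions that are, near each point, restrictions to $A$ of holomorphic functions on open subsets of $X$. For a set $\mathcal{H}$ of germs of continuous functions on $A$ and $U$ open in $A$, $\mathcal{H}(U)$ is the set of continuous functions on $U$ all of whose germs belong to $\mathcal{H}$; $\mathcal{H}^c$ is the set of germs $f_{(x)}$ having, on some open neighbourhood $U_x$ of $x$ in $A$, a representative which is the limit, uniformly on compact subsets of $U_x$, of a sequence in $\mathcal{H}(U_x)$. $\mathcal{H}^{(c)}$ is the smallest set of germs that contains $\mathcal{H}$ and is stable under $\mathcal{H}\mapsto\mathcal{H}^c$. The sheaf of LACR functions is $\tilde{\mathscr{O}}_A=\mathscr{O}_A^{(c)}$. *)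

theory Defs
  imports "HOL-Analysis.Analysis" "Jordan_Normal_Form.Char_Poly"
begin

section \<open>Functions of several complex variables\<close>

text \<open>Complex spaces have local models in \<open>\<complex>\<^sup>N\<close> with \<open>N\<close> depending on the chart (and possibly
  unbounded), so the dimension has to be a term: \<open>\<complex>\<^sup>N\<close> consists of the sequences that vanish
  from index \<open>N\<close> on, as for \<^const>\<open>Euclidean_space\<close>. Functions on a subset are
  total functions of which only the values on that subset matter.\<close>

definition Cspace :: "nat \<Rightarrow> (nat \<Rightarrow> complex) topology" where
  "Cspace N = subtopology euclidean {z. \<forall>i\<ge>N. z i = 0}"

definition holomorphic_Cn :: "nat \<Rightarrow> (nat \<Rightarrow> complex) set \<Rightarrow> ((nat \<Rightarrow> complex) \<Rightarrow> complex) \<Rightarrow> bool" where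
  "holomorphic_Cn N U f \<longleftrightarrow>
     continuous_map (subtopology (Cspace N) U) euclidean f \<and>
     (\<forall>z\<in>U. \<forall>j<N. (\<lambda>w. f (z(j := w))) field_differentiable at (z j))"

text \<open>The line through \<open>z\<close> in direction \<open>c\<close> of the \<open>j\<close>-th coordinate; \<open>c = 1\<close> and \<open>c = \<i>\<close> give the
  real coordinate directions \<open>x\<^sub>j\<close> and \<open>y\<^sub>j\<close>.\<close>

definition coord_line :: "complex \<Rightarrow> nat \<Rightarrow> (nat \<Rightarrow> complex) \<Rightarrow> real \<Rightarrow> nat \<Rightarrow> complex" where
  "coord_line c j z t = z(j := z j + of_real t * c)"

definition partial_deriv ::
    "complex \<Rightarrow> nat \<Rightarrow> ((nat \<Rightarrow> complex) \<Rightarrow> 'b::real_normed_vector) \<Rightarrow> (nat \<Rightarrow> complex) \<Rightarrow> 'b" where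
  "partial_deriv c j f z = vector_derivative (\<lambda>t. f (coord_line c j z t)) (at 0)"

primrec Ck_on :: "nat \<Rightarrow> nat \<Rightarrow> (nat \<Rightarrow> complex) set \<Rightarrow> ((nat \<Rightarrow> complex) \<Rightarrow> real) \<Rightarrow> bool" where
  "Ck_on N 0 U f \<longleftrightarrow> continuous_map (subtopology (Cspace N) U) euclidean f"
| "Ck_on N (Suc k) U f \<longleftrightarrow>
     continuous_map (subtopology (Cspace N) U) euclidean f \<and>
     (\<forall>j<N. \<forall>c\<in>{1, \<i>}.
        (\<forall>z\<in>U. (\<lambda>t. f (coord_line c j z t)) differentiable at 0) \<and>
        Ck_on N k U (partial_deriv c j f))"

definition smooth_on_Cn :: "nat \<Rightarrow> (nat \<Rightarrow> complex) set \<Rightarrow> ((nat \<Rightarrow> complex) \<Rightarrow> real) \<Rightarrow> bool" where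
  "smooth_on_Cn N U f \<longleftrightarrow> (\<forall>k. Ck_on N k U f)"

definition dz :: "nat \<Rightarrow> ((nat \<Rightarrow> complex) \<Rightarrow> complex) \<Rightarrow> (nat \<Rightarrow> complex) \<Rightarrow> complex" where
  "dz j f z = (partial_deriv 1 j f z - \<i> * partial_deriv \<i> j f z) / 2"

definition dzbar :: "nat \<Rightarrow> ((nat \<Rightarrow> complex) \<Rightarrow> complex) \<Rightarrow> (nat \<Rightarrow> complex) \<Rightarrow> complex" where
  "dzbar j f z = (partial_deriv 1 j f z + \<i> * partial_deriv \<i> j f z) / 2"

definition levi_coeff ::
    "((nat \<Rightarrow> complex) \<Rightarrow> real) \<Rightarrow> (nat \<Rightarrow> complex) \<Rightarrow> nat \<Rightarrow> nat \<Rightarrow> complex" where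
  "levi_coeff \<rho> z i j = dz i (dzbar j (\<lambda>w. complex_of_real (\<rho> w))) z"

definition complex_hessian ::
    "nat \<Rightarrow> ((nat \<Rightarrow> complex) \<Rightarrow> real) \<Rightarrow> (nat \<Rightarrow> complex) \<Rightarrow> complex mat" where
  "complex_hessian N \<rho> z = Matrix.mat N N (\<lambda>(i, j). levi_coeff \<rho> z i j)"

text \<open>Eigenvalues are counted with multiplicity; for the Hermitian matrices at hand all of them are
  real, and algebraic and geometric multiplicities agree.\<close>

definition num_positive_eigenvalues :: "complex mat \<Rightarrow> nat" where
  "num_positive_eigenvalues M =
     (\<Sum>a | eigenvalue M a \<and> a \<in> \<real> \<and> Re a > 0. Polynomial.order a (char_poly M))"

text \<open>For \<open>\<sigma>\<close> of class \<open>C\<^sup>2\<close> the Levi form below is real, and \<^const>\<open>Re\<close> is only a coercion.\<close>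

definition strictly_psh_Cn :: "nat \<Rightarrow> (nat \<Rightarrow> complex) set \<Rightarrow> ((nat \<Rightarrow> complex) \<Rightarrow> real) \<Rightarrow> bool" where
  "strictly_psh_Cn N U \<sigma> \<longleftrightarrow>
     Ck_on N 2 U \<sigma> \<and>
     (\<forall>z\<in>U. \<forall>v. (\<exists>j<N. v j \<noteq> 0) \<longrightarrow>
        Re (\<Sum>i<N. \<Sum>j<N. levi_coeff \<sigma> z i j * v i * cnj (v j)) > 0)"

section \<open>Reduced complex spaces\<close>

text \<open>The condition ranges over all points of \<open>U\<close>, so \<open>Z\<close> is closed in \<open>U\<close>.\<close>

definition analytic_subvariety :: "nat \<Rightarrow> (nat \<Rightarrow> complex) set \<Rightarrow> (nat \<Rightarrow> complex) set \<Rightarrow> bool" where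
  "analytic_subvariety N U Z \<longleftrightarrow>
     Z \<subseteq> U \<and>
     (\<forall>p\<in>U. \<exists>W F. openin (Cspace N) W \<and> p \<in> W \<and> W \<subseteq> U \<and>
        finite F \<and> (\<forall>f\<in>F. holomorphic_Cn N W f) \<and>
        Z \<inter> W = {z \<in> W. \<forall>f\<in>F. f z = 0})"

text \<open>Sections, over the set \<open>S\<close>, of the structure sheaf of a local model of which \<open>S\<close> is an open
  subset. With the reduced structure, these are functions.\<close>

definition local_holomorphic ::
    "nat \<Rightarrow> (nat \<Rightarrow> complex) set \<Rightarrow> ((nat \<Rightarrow> complex) \<Rightarrow> complex) \<Rightarrow> bool" where
  "local_holomorphic N S g \<longleftrightarrow>
     (\<forall>p\<in>S. \<exists>W F. openin (Cspace N) W \<and> p \<in> W \<and> holomorphic_Cn N W F \<and>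
        (\<forall>z\<in>S \<inter> W. g z = F z))"

text \<open>The structure sheaf of a reduced complex space is a sheaf of functions: \<open>\<O> W\<close> are the sections
  over the open set \<open>W\<close>. The next predicate says that \<open>z\<close> is an isomorphism of ringed spaces
  of the open subspace \<open>\<omega>\<close> of \<open>X\<close> onto the local model \<open>Z\<close>, a closed analytic subvariety
  of the open set \<open>U\<close> in \<open>\<complex>\<^sup>N\<close>.\<close>

definition local_model_iso ::
    "'a topology \<Rightarrow> ('a set \<Rightarrow> ('a \<Rightarrow> complex) set) \<Rightarrow> 'a set \<Rightarrow> nat \<Rightarrow>
     (nat \<Rightarrow> complex) set \<Rightarrow> (nat \<Rightarrow> complex) set \<Rightarrow> ('a \<Rightarrow> nat \<Rightarrow> complex) \<Rightarrow> bool" where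
  "local_model_iso X \<O> \<omega> N U Z z \<longleftrightarrow>
     openin X \<omega> \<and> openin (Cspace N) U \<and> analytic_subvariety N U Z \<and>
     homeomorphic_map (subtopology X \<omega>) (subtopology (Cspace N) Z) z \<and>
     (\<forall>W g. openin X W \<and> W \<subseteq> \<omega> \<longrightarrow> (local_holomorphic N (z ` W) g \<longleftrightarrow> g \<circ> z \<in> \<O> W))"

text \<open>Sections are total functions, so the gluing condition also says that membership in \<open>\<O> W\<close>
  depends on the values on \<open>W\<close> only.\<close>

definition function_sheaf :: "'a topology \<Rightarrow> ('a set \<Rightarrow> ('a \<Rightarrow> complex) set) \<Rightarrow> bool" where
  "function_sheaf X \<O> \<longleftrightarrow>
     (\<forall>V W. openin X V \<and> openin X W \<and> V \<subseteq> W \<longrightarrow> \<O> W \<subseteq> \<O> V) \<and>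
     (\<forall>W f. openin X W \<and>
        (\<forall>x\<in>W. \<exists>V g. openin X V \<and> x \<in> V \<and> V \<subseteq> W \<and> g \<in> \<O> V \<and> (\<forall>y\<in>V. f y = g y))
        \<longrightarrow> f \<in> \<O> W)"

text \<open>That sections are continuous and form algebras follows from the existence of local models.\<close>

definition reduced_complex_space :: "'a topology \<Rightarrow> ('a set \<Rightarrow> ('a \<Rightarrow> complex) set) \<Rightarrow> bool" where
  "reduced_complex_space X \<O> \<longleftrightarrow>
     Hausdorff_space X \<and> function_sheaf X \<O> \<and>
     (\<forall>p\<in>topspace X. \<exists>\<omega> N U Z z. p \<in> \<omega> \<and> local_model_iso X \<O> \<omega> N U Z z)"

definition regular_points ::
    "'a topology \<Rightarrow> ('a set \<Rightarrow> ('a \<Rightarrow> complex) set) \<Rightarrow> nat \<Rightarrow> 'a set" where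
  "regular_points X \<O> d = {p. \<exists>\<omega> U z. p \<in> \<omega> \<and> local_model_iso X \<O> \<omega> d U U z}"

text \<open>The dimension at \<open>p\<close> is the largest dimension of regular points that occurs arbitrarily close
  to \<open>p\<close>.\<close>

definition has_dimension_at ::
    "'a topology \<Rightarrow> ('a set \<Rightarrow> ('a \<Rightarrow> complex) set) \<Rightarrow> 'a \<Rightarrow> nat \<Rightarrow> bool" where
  "has_dimension_at X \<O> p d \<longleftrightarrow>
     p \<in> X closure_of regular_points X \<O> d \<and>
     (\<forall>m>d. p \<notin> X closure_of regular_points X \<O> m)"

definition pure_dimensional :: "'a topology \<Rightarrow> ('a set \<Rightarrow> ('a \<Rightarrow> complex) set) \<Rightarrow> bool" where
  "pure_dimensional X \<O> \<longleftrightarrow> (\<exists>d. \<forall>p\<in>topspace X. has_dimension_at X \<O> p d)"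

definition strictly_psh_on_space ::
    "'a topology \<Rightarrow> ('a set \<Rightarrow> ('a \<Rightarrow> complex) set) \<Rightarrow> ('a \<Rightarrow> real) \<Rightarrow> bool" where
  "strictly_psh_on_space X \<O> \<rho> \<longleftrightarrow>
     (\<forall>p\<in>topspace X. \<exists>\<omega> N U Z z \<sigma>. p \<in> \<omega> \<and> local_model_iso X \<O> \<omega> N U Z z \<and>
        strictly_psh_Cn N U \<sigma> \<and> (\<forall>x\<in>\<omega>. \<rho> x = \<sigma> (z x)))"

section \<open>Set-theoretic pseudoconvexity\<close>

definition set_pseudoconvex_at ::
    "'a topology \<Rightarrow> ('a set \<Rightarrow> ('a \<Rightarrow> complex) set) \<Rightarrow> int \<Rightarrow> 'a set \<Rightarrow> 'a \<Rightarrow> bool" where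
  "set_pseudoconvex_at X \<O> q A p \<longleftrightarrow>
     (\<exists>\<omega> N U Z z \<rho> \<omega>'.
        p \<in> \<omega> \<and> local_model_iso X \<O> \<omega> N U Z z \<and> smooth_on_Cn N U \<rho> \<and>
        openin X \<omega>' \<and> p \<in> \<omega>' \<and> \<omega>' \<subseteq> \<omega> \<and>
        z ` (A \<inter> \<omega>') \<subseteq> {w. \<rho> w \<le> \<rho> (z p)} \<and>
        int (num_positive_eigenvalues (complex_hessian N \<rho> (z p))) \<ge> int N - q + 1)"

definition pseudoconvex_points ::
    "'a topology \<Rightarrow> ('a set \<Rightarrow> ('a \<Rightarrow> complex) set) \<Rightarrow> int \<Rightarrow> 'a set \<Rightarrow> 'a set" where
  "pseudoconvex_points X \<O> q A = {p \<in> A. set_pseudoconvex_at X \<O> q A p}"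

section \<open>LACR functions\<close>

text \<open>A germ at \<open>x\<close> of a function on \<open>A\<close> is \<open>x\<close> together with an equivalence class of total functions
  under agreement on a neighbourhood of \<open>x\<close> in \<open>A\<close>. Every local representative extends to a total
  function, so no germs are lost.\<close>

type_synonym 'a germ = "'a \<times> ('a \<Rightarrow> complex) set"

definition germ_at :: "'a topology \<Rightarrow> 'a set \<Rightarrow> 'a \<Rightarrow> ('a \<Rightarrow> complex) \<Rightarrow> 'a germ" where
  "germ_at X A x f =
     (x, {g. \<exists>V. openin (subtopology X A) V \<and> x \<in> V \<and> (\<forall>y\<in>V. g y = f y)})"

definition continuous_germs :: "'a topology \<Rightarrow> 'a set \<Rightarrow> 'a germ set" where
  "continuous_germs X A =
     {germ_at X A x f | x f. \<exists>V. openin (subtopology X A) V \<and> x \<in> V \<and>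
        continuous_map (subtopology X V) euclidean f}"

definition holomorphic_germs ::
    "'a topology \<Rightarrow> ('a set \<Rightarrow> ('a \<Rightarrow> complex) set) \<Rightarrow> 'a set \<Rightarrow> 'a germ set" where
  "holomorphic_germs X \<O> A =
     {germ_at X A x h | x h. x \<in> A \<and> (\<exists>W. openin X W \<and> x \<in> W \<and> h \<in> \<O> W)}"

definition sections :: "'a topology \<Rightarrow> 'a set \<Rightarrow> 'a germ set \<Rightarrow> 'a set \<Rightarrow> ('a \<Rightarrow> complex) set" where
  "sections X A \<H> U =
     {f. continuous_map (subtopology X U) euclidean f \<and> (\<forall>x\<in>U. germ_at X A x f \<in> \<H>)}"

definition germ_closure :: "'a topology \<Rightarrow> 'a set \<Rightarrow> 'a germ set \<Rightarrow> 'a germ set" where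
  "germ_closure X A \<H> =
     {germ_at X A x f | x f. \<exists>U F. openin (subtopology X A) U \<and> x \<in> U \<and>
        continuous_map (subtopology X U) euclidean f \<and>
        (\<forall>n. F n \<in> sections X A \<H> U) \<and>
        (\<forall>K. compactin X K \<and> K \<subseteq> U \<longrightarrow> uniform_limit K F f sequentially)}"

definition iterated_germ_closure :: "'a topology \<Rightarrow> 'a set \<Rightarrow> 'a germ set \<Rightarrow> 'a germ set" where
  "iterated_germ_closure X A \<H> =
     \<Inter>{\<K>. \<K> \<subseteq> continuous_germs X A \<and> \<H> \<subseteq> \<K> \<and> germ_closure X A \<K> \<subseteq> \<K>}"

definition LACR_germs ::
    "'a topology \<Rightarrow> ('a set \<Rightarrow> ('a \<Rightarrow> complex) set) \<Rightarrow> 'a set \<Rightarrow> 'a germ set" where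
  "LACR_germs X \<O> A = iterated_germ_closure X A (holomorphic_germs X \<O> A)"

end

theory Submission
  imports Defs "HOL-Complex_Analysis.Complex_Analysis"
begin

text \<open>Put \<open>\<Psi> = \<Psi>\<^sub>1(A)\<close> and say that \<open>f\<close> is touched at \<open>x\<close> if, in a chart, \<open>|f|\<^sup>2 + \<phi>\<close> restricted to \<open>A\<close>
  has a local maximum at \<open>x\<close> for some smooth \<open>\<phi>\<close> with uniformly positive Levi form. A holomorphic
  \<open>h\<close> is touched only at points of \<open>\<Psi>\<close>: replacing \<open>|h|\<^sup>2\<close> by its pluriharmonic tangent at \<open>x\<close>
  turns the local maximum into the defining condition of 1-pseudoconvexity. Subtracting a small
  multiple of \<open>|w - z(x)|\<^sup>2\<close> from \<open>\<phi>\<close> makes the maximum strict, so it persists, at a nearby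
  point, for locally uniform approximations of \<open>f\<close>; hence no LACR function is touched outside the
  closure of \<open>\<Psi>\<close>. On the other hand, a maximum point of \<open>|u|\<^sup>2 + \<epsilon>\<rho>\<close> over \<open>A\<close> is a point at which
  \<open>u\<close> is touched, by the second order Taylor expansion of \<open>\<rho>\<close>. With \<open>u = 0\<close> this gives
  \<open>\<Psi> \<noteq> {}\<close>, and if \<open>|u|\<close> exceeded its supremum over \<open>\<Psi>\<close>, then for small \<open>\<epsilon>\<close> such a point would
  lie outside the closure of \<open>\<Psi>\<close>.\<close>

section \<open>Calculus in \<open>\<complex>\<^sup>N\<close>\<close>

text \<open>Two mismatches shape the proof. First, \<open>\<rho>\<close> is only C^2, while
  pseudoconvexity asks for a smooth defining function. Quadratic polynomials close this gap, and
  since their Levi coefficients are constant, test functions can live on all of \<open>Cn N\<close>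
  with one lower bound. Second, an LACR germ may need arbitrarily many limit steps and carries no
  derivatives. Being touched refers to values only, so it makes sense for such germs, and only a
  single limit step has to be controlled. That step moves the point, which is why the closure of
  \<Psi> appears. The value \<open>q = 1\<close> asks for \<open>N\<close> positive eigenvalues,
  that is, for a positive definite complex Hessian; a pluriharmonic summand leaves the Hessian
  unchanged, so the Hessian of \<phi> decides. As the dimension is a term, the points are sequences
  under the product topology, which is not normed. Calculus is therefore built from derivatives
  along real coordinate lines.\<close>

definition Cn :: "nat \<Rightarrow> (nat \<Rightarrow> complex) set" where
  "Cn N = {z. \<forall>i\<ge>N. z i = 0}"

lemma Cspace_Cn: "Cspace N = top_of_set (Cn N)"
  by (simp add: Cspace_def Cn_def)

lemma topspace_Cspace [simp]: "topspace (Cspace N) = Cn N"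
  by (simp add: Cspace_Cn)

lemma openin_Cspace_subset: "openin (Cspace N) U \<Longrightarrow> U \<subseteq> Cn N"
  using openin_subset by fastforce

lemma openin_Cspace_Cn [simp]: "openin (Cspace N) (Cn N)"
  by (metis openin_topspace topspace_Cspace)

lemma Cn_upd: "z \<in> Cn N \<Longrightarrow> j < N \<Longrightarrow> z(j := w) \<in> Cn N"
  by (auto simp: Cn_def)

lemma continuous_map_Cspace_iff:
  assumes "openin (Cspace N) U"
  shows "continuous_map (subtopology (Cspace N) U) euclidean f \<longleftrightarrow> continuous_on U f"
proof -
  have "subtopology (Cspace N) U = top_of_set U"
    using openin_Cspace_subset[OF assms]
    by (simp add: Cspace_Cn subtopology_subtopology inf.absorb2)
  then show ?thesis by simp
qed

text \<open>Polydiscs form a neighbourhood basis: from index \<open>N\<close> on both points vanish,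
  so only the first \<open>N\<close> radii count.\<close>

lemma openin_Cspace_box:
  assumes U: "openin (Cspace N) U" and p: "p \<in> U"
  obtains e where "e > 0" "\<And>w. w \<in> Cn N \<Longrightarrow> (\<forall>i<N. cmod (w i - p i) < e) \<Longrightarrow> w \<in> U"
proof -
  obtain T where T: "open T" "U = Cn N \<inter> T"
    using U by (auto simp: Cspace_Cn openin_open)
  have "openin (product_topology (\<lambda>i. euclidean) UNIV) T"
    using T by (simp add: open_fun_def)
  from product_topology_open_contains_basis[OF this] p T
  obtain X where X: "p \<in> Pi\<^sub>E UNIV X" "\<And>i. open (X i)" "finite {i. X i \<noteq> UNIV}" "Pi\<^sub>E UNIV X \<subseteq> T"
    by (auto, metis IntD2)
  have "\<forall>i. \<exists>e>0. ball (p i) e \<subseteq> X i"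
    using X by (metis PiE_mem UNIV_I open_contains_ball)
  then obtain d where d: "\<And>i. d i > 0" "\<And>i. ball (p i) (d i) \<subseteq> X i" by metis
  \<comment> \<open>The extra element 1 keeps the minimum defined for \<open>N = 0\<close>.\<close>
  define e where "e = Min (insert 1 (d ` {..<N}))"
  have e: "e > 0" "\<And>i. i < N \<Longrightarrow> e \<le> d i"
    using d by (auto simp: e_def)
  show thesis
  proof (rule that[OF e(1)])
    fix w assume w: "w \<in> Cn N" "\<forall>i<N. cmod (w i - p i) < e"
    have "w i \<in> X i" for i
    proof (cases "i < N")
      case True
      then show ?thesis using w(2) e(2)[of i] d(2)[of i] 
        by (auto simp: subset_iff dist_norm norm_minus_commute)
    next
      case False
      have "p \<in> Cn N" using p T by auto
      then have "w i = p i" using w False by (auto simp: Cn_def)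
      then show ?thesis using d[of i] by auto
    qed
    then show "w \<in> U" using X(4) T(2) w by auto
  qed
qed

section \<open>Partial derivatives along real coordinate lines\<close>

lemma coord_line_Cn: "z \<in> Cn N \<Longrightarrow> j < N \<Longrightarrow> coord_line c j z t \<in> Cn N"
  by (simp add: coord_line_def Cn_upd)

lemma coord_line_0 [simp]: "coord_line c j z 0 = z"
  by (simp add: coord_line_def)

lemma coord_line_coord_line: "coord_line c j (coord_line c j z s) t = coord_line c j z (s + t)"
  by (simp add: coord_line_def algebra_simps)

lemma continuous_coord_line: "continuous_on UNIV (coord_line c j z)"
proof (rule continuous_on_coordinatewise_then_product)
  fix i
  show "continuous_on UNIV (\<lambda>t. coord_line c j z t i)"
    by (cases "i = j") (auto simp: coord_line_def intro!: continuous_intros)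
qed

lemma eventually_coord_line:
  assumes U: "openin (Cspace N) U" and "z \<in> U" "j < N"
  shows "\<forall>\<^sub>F t in nhds 0. coord_line c j z t \<in> U"
proof -
  obtain T where T: "open T" "U = Cn N \<inter> T"
    using U by (auto simp: Cspace_Cn openin_open)
  have "open (coord_line c j z -` T)"
    using continuous_coord_line T(1) open_vimage by blast
  moreover have "0 \<in> coord_line c j z -` T" using assms T by auto
  ultimately have "\<forall>\<^sub>F t in nhds 0. t \<in> coord_line c j z -` T"
    by (rule eventually_nhds_in_open)
  then show ?thesis
    by eventually_elim (use assms T coord_line_Cn in auto)
qed

text \<open>Unlike \<open>partial_deriv\<close>, which has a value even where no derivative exists,
  this relation carries existence and value together, so the calculus rules compose without side
  conditions.\<close>

definition has_pd :: "complex \<Rightarrow> nat \<Rightarrow> ((nat \<Rightarrow> complex) \<Rightarrow> 'b::real_normed_vector) \<Rightarrow> 'b \<Rightarrow> (nat \<Rightarrow> complex) \<Rightarrow> bool" where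
  "has_pd c j f d z \<longleftrightarrow> ((\<lambda>t. f (coord_line c j z t)) has_vector_derivative d) (at 0)"

lemma has_pd_imp: "has_pd c j f d z \<Longrightarrow> partial_deriv c j f z = d"
  by (simp add: has_pd_def partial_deriv_def vector_derivative_at)

lemma has_pd_differentiable:
  "(\<lambda>t. f (coord_line c j z t)) differentiable at 0 \<longleftrightarrow> has_pd c j f (partial_deriv c j f z) z"
  unfolding has_pd_def partial_deriv_def
  by (metis differentiableI_vector vector_derivative_works)

lemma has_pd_cong:
  assumes "openin (Cspace N) U" "z \<in> U" "j < N" "\<And>w. w \<in> U \<Longrightarrow> f w = g w"
  shows "has_pd c j f d z \<longleftrightarrow> has_pd c j g d z"
proof -
  have "\<forall>\<^sub>F t in nhds 0. f (coord_line c j z t) = g (coord_line c j z t)"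
    using eventually_coord_line[OF assms(1-3)] by eventually_elim (use assms in auto)
  then show ?thesis unfolding has_pd_def
    by (intro has_vector_derivative_cong_ev) (auto dest: eventually_nhds_x_imp_x elim: eventually_mono)
qed

lemma has_pd_add: "has_pd c j f d z \<Longrightarrow> has_pd c j g e z \<Longrightarrow> has_pd c j (\<lambda>w. f w + g w) (d + e) z"
  unfolding has_pd_def by (rule has_vector_derivative_add)

lemma has_pd_diff: "has_pd c j f d z \<Longrightarrow> has_pd c j g e z \<Longrightarrow> has_pd c j (\<lambda>w. f w - g w) (d - e) z"
  unfolding has_pd_def by (rule has_vector_derivative_diff)

lemma has_pd_const: "has_pd c j (\<lambda>w. k) 0 z"
  unfolding has_pd_def by (rule has_vector_derivative_const)

lemma has_pd_cmult: "has_pd c j f d z \<Longrightarrow> has_pd c j (\<lambda>w. k * f w) (k * d) z"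
  for f :: "_ \<Rightarrow> real"
  using DERIV_cmult[of "\<lambda>t. f (coord_line c j z t)" d 0 UNIV k]
  by (simp add: has_pd_def has_real_derivative_iff_has_vector_derivative)

lemma has_pd_sum: "(\<And>i. i \<in> I \<Longrightarrow> has_pd c j (f i) (d i) z) \<Longrightarrow>
    has_pd c j (\<lambda>w. \<Sum>i\<in>I. f i w) (\<Sum>i\<in>I. d i) z"
  unfolding has_pd_def by (rule has_vector_derivative_sum)

lemma has_pd_mult: "has_pd c j f d z \<Longrightarrow> has_pd c j g e z \<Longrightarrow>
    has_pd c j (\<lambda>w. f w * g w) (f z * e + d * g z) z"
  for f :: "_ \<Rightarrow> real"
  unfolding has_pd_def
  using has_vector_derivative_mult[of "\<lambda>t. f (coord_line c j z t)" d 0 UNIV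
      "\<lambda>t. g (coord_line c j z t)" e] by simp

lemma has_pd_of_real: "has_pd c j f d z \<Longrightarrow> has_pd c j (\<lambda>w. complex_of_real (f w)) (of_real d) z"
  unfolding has_pd_def
  by (rule bounded_linear.has_vector_derivative[OF bounded_linear_of_real])

lemma has_pd_cmult_complex: "has_pd c j f d z \<Longrightarrow> has_pd c j (\<lambda>w. k * f w) (k * d) z"
  for f :: "_ \<Rightarrow> complex"
  unfolding has_pd_def by (rule has_vector_derivative_mult_right)

text \<open>Turns partial derivatives at all points of a coordinate line into the derivative of one
  function of a real variable, to which mean value estimates apply.\<close>

lemma has_pd_shift:
  "has_pd c j f d (coord_line c j z s) \<longleftrightarrow>
     ((\<lambda>t. f (coord_line c j z t)) has_vector_derivative d) (at s)"
proof -
  have "has_pd c j f d (coord_line c j z s) \<longleftrightarrow>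
     ((\<lambda>t. f (coord_line c j z t)) \<circ> (\<lambda>t. s + t) has_vector_derivative d) (at 0)"
    by (simp add: has_pd_def coord_line_coord_line o_def)
  also have "\<dots> \<longleftrightarrow> ((\<lambda>t. f (coord_line c j z t)) has_vector_derivative d) (at s)"
    by (simp add: has_vector_derivative_def has_derivative_at o_def)
  finally show ?thesis .
qed

section \<open>The classes C^k\<close>

lemma Ck_on_0: "openin (Cspace N) U \<Longrightarrow> Ck_on N 0 U f \<longleftrightarrow> continuous_on U f"
  by (simp add: continuous_map_Cspace_iff)

lemma Ck_on_Suc: "openin (Cspace N) U \<Longrightarrow> Ck_on N (Suc k) U f \<longleftrightarrow> continuous_on U f \<and>
     (\<forall>j<N. \<forall>c\<in>{1, \<i>}. (\<forall>z\<in>U. has_pd c j f (partial_deriv c j f z) z) \<and>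
        Ck_on N k U (partial_deriv c j f))"
  by (simp only: Ck_on.simps has_pd_differentiable continuous_map_Cspace_iff)

declare Ck_on.simps [simp del]

lemma Ck_on_continuous: "openin (Cspace N) U \<Longrightarrow> Ck_on N k U f \<Longrightarrow> continuous_on U f"
  by (cases k) (auto simp: Ck_on_0 Ck_on_Suc)

text \<open>A formula computed for a partial derivative agrees with \<open>partial_deriv\<close> on
  \<open>U\<close> only. This suffices because a coordinate line through a point of \<open>U\<close>
  stays in \<open>U\<close> for small parameters.\<close>

lemma Ck_on_cong:
  assumes U: "openin (Cspace N) U"
  shows "(\<And>w. w \<in> U \<Longrightarrow> f w = g w) \<Longrightarrow> Ck_on N k U f \<longleftrightarrow> Ck_on N k U g"
proof (induction k arbitrary: f g)
  case 0
  then show ?case using U by (simp add: Ck_on_0 cong: continuous_on_cong)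
next
  case (Suc k)
  have pd: "partial_deriv c j f z = partial_deriv c j g z"
    if "z \<in> U" "j < N" for c j z
    unfolding partial_deriv_def
    by (rule vector_derivative_cong_eq)
       (use eventually_coord_line[OF U that, of c] Suc.prems in
         \<open>auto elim: eventually_mono\<close>)
  have "has_pd c j f d z \<longleftrightarrow> has_pd c j g d z" if "z \<in> U" "j < N" for c j z d
    using has_pd_cong[OF U that, of f g] Suc.prems by blast
  moreover have "Ck_on N k U (partial_deriv c j f) \<longleftrightarrow> Ck_on N k U (partial_deriv c j g)" if "j < N" for c j
    using Suc.IH pd that by blast
  moreover have "continuous_on U f \<longleftrightarrow> continuous_on U g"
    using Suc.prems by (simp cong: continuous_on_cong)
  ultimately show ?case using pd U by (simp add: Ck_on_Suc)
qed

lemma Ck_on_SucI: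
  assumes U: "openin (Cspace N) U" and "continuous_on U f"
    and pd: "\<And>j c z. j < N \<Longrightarrow> c \<in> {1, \<i>} \<Longrightarrow> z \<in> U \<Longrightarrow> has_pd c j f (g c j z) z"
    and Ck: "\<And>j c. j < N \<Longrightarrow> c \<in> {1, \<i>} \<Longrightarrow> Ck_on N k U (g c j)"
  shows "Ck_on N (Suc k) U f"
  unfolding Ck_on_Suc[OF U]
proof (intro conjI allI impI ballI)
  fix j c assume jc: "j < N" "c \<in> {1, \<i>}"
  have eq: "partial_deriv c j f z = g c j z" if "z \<in> U" for z
    using pd[OF jc that] by (rule has_pd_imp)
  show "has_pd c j f (partial_deriv c j f z) z" if "z \<in> U" for z
    unfolding eq[OF that] by (rule pd[OF jc that])
  show "Ck_on N k U (partial_deriv c j f)"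
    using Ck_on_cong[OF U, of "partial_deriv c j f" "g c j" k] eq Ck[OF jc] by simp
qed fact

lemma Ck_on_SucD:
  assumes "openin (Cspace N) U" "Ck_on N (Suc k) U f" "j < N" "c \<in> {1, \<i>}"
  shows "z \<in> U \<Longrightarrow> has_pd c j f (partial_deriv c j f z) z" "Ck_on N k U (partial_deriv c j f)"
  using assms(2-4) unfolding Ck_on_Suc[OF assms(1)] by blast+

lemma Ck_on_const: assumes U: "openin (Cspace N) U" shows "Ck_on N k U (\<lambda>w. a)"
proof (induction k arbitrary: a)
  case 0
  then show ?case by (simp add: Ck_on_0 U)
next
  case (Suc k)
  show ?case by (rule Ck_on_SucI[OF U continuous_on_const has_pd_const Suc])
qed

lemma Ck_on_add:
  assumes U: "openin (Cspace N) U"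
  shows "Ck_on N k U f \<Longrightarrow> Ck_on N k U g \<Longrightarrow> Ck_on N k U (\<lambda>w. f w + g w)"
proof (induction k arbitrary: f g)
  case 0
  then show ?case using U by (simp add: Ck_on_0 continuous_on_add)
next
  case (Suc k)
  show ?case
  proof (rule Ck_on_SucI[OF U])
    show "continuous_on U (\<lambda>w. f w + g w)"
      by (intro continuous_on_add Ck_on_continuous[OF U Suc.prems(1)] Ck_on_continuous[OF U Suc.prems(2)])
    show "has_pd c j (\<lambda>w. f w + g w) (partial_deriv c j f z + partial_deriv c j g z) z"
      if "j < N" "c \<in> {1, \<i>}" "z \<in> U" for c j z
      by (intro has_pd_add Ck_on_SucD(1)[OF U Suc.prems(1)] Ck_on_SucD(1)[OF U Suc.prems(2)] that)
    show "Ck_on N k U (\<lambda>z. partial_deriv c j f z + partial_deriv c j g z)"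
      if "j < N" "c \<in> {1, \<i>}" for c j
      by (intro Suc.IH Ck_on_SucD(2)[OF U Suc.prems(1)] Ck_on_SucD(2)[OF U Suc.prems(2)] that)
  qed
qed

lemma Ck_on_sum:
  assumes U: "openin (Cspace N) U"
  shows "(\<And>i. i \<in> I \<Longrightarrow> Ck_on N k U (f i)) \<Longrightarrow> Ck_on N k U (\<lambda>w. \<Sum>i\<in>I. f i w)"
  by (induction I rule: infinite_finite_induct) (auto simp: Ck_on_const Ck_on_add U)

text \<open>Used for products, where the product rule leaves one factor undifferentiated while the
  order drops from \<open>Suc k\<close> to \<open>k\<close>.\<close>

lemma Ck_on_mono:
  assumes U: "openin (Cspace N) U"
  shows "Ck_on N (Suc k) U f \<Longrightarrow> Ck_on N k U f"
proof (induction k arbitrary: f)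
  case 0
  then show ?case using U Ck_on_continuous[OF U] by (simp add: Ck_on_0)
next
  case (Suc k)
  show ?case
    by (rule Ck_on_SucI[OF U Ck_on_continuous[OF U Suc.prems] Ck_on_SucD(1)[OF U Suc.prems]])
       (rule Suc.IH Ck_on_SucD(2)[OF U Suc.prems] | assumption)+
qed

lemma Ck_on_mult:
  assumes U: "openin (Cspace N) U"
  shows "Ck_on N k U f \<Longrightarrow> Ck_on N k U g \<Longrightarrow> Ck_on N k U (\<lambda>w. f w * g w)"
proof (induction k arbitrary: f g)
  case 0
  then show ?case using U by (simp add: Ck_on_0 continuous_on_mult)
next
  case (Suc k)
  show ?case
  proof (rule Ck_on_SucI[OF U])
    show "continuous_on U (\<lambda>w. f w * g w)"
      by (intro continuous_on_mult Ck_on_continuous[OF U Suc.prems(1)] Ck_on_continuous[OF U Suc.prems(2)])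
    show "has_pd c j (\<lambda>w. f w * g w) (f z * partial_deriv c j g z + partial_deriv c j f z * g z) z"
      if "j < N" "c \<in> {1, \<i>}" "z \<in> U" for c j z
      by (intro has_pd_mult Ck_on_SucD(1)[OF U Suc.prems(1)] Ck_on_SucD(1)[OF U Suc.prems(2)] that)
    show "Ck_on N k U (\<lambda>z. f z * partial_deriv c j g z + partial_deriv c j f z * g z)"
      if "j < N" "c \<in> {1, \<i>}" for c j
      by (intro Ck_on_add[OF U] Suc.IH Ck_on_SucD(2)[OF U Suc.prems(1)] Ck_on_SucD(2)[OF U Suc.prems(2)]
          Ck_on_mono[OF U Suc.prems(1)] Ck_on_mono[OF U Suc.prems(2)] that)
  qed
qed

lemma Ck_on_cmult:
  assumes U: "openin (Cspace N) U"
  shows "Ck_on N k U f \<Longrightarrow> Ck_on N k U (\<lambda>w. a * f w)"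
  by (intro Ck_on_mult[OF U] Ck_on_const[OF U])

lemma Ck_on_subset:
  assumes U: "openin (Cspace N) U" and V: "openin (Cspace N) V" "V \<subseteq> U"
  shows "Ck_on N k U f \<Longrightarrow> Ck_on N k V f"
proof (induction k arbitrary: f)
  case 0
  then show ?case using assms by (auto simp: Ck_on_0 intro: continuous_on_subset)
next
  case (Suc k)
  then show ?case using V unfolding Ck_on_Suc[OF U] Ck_on_Suc[OF V(1)]
    by (blast intro: continuous_on_subset)
qed

text \<open>The coordinate \<open>(1, j)\<close> is the real part \<open>x\<^sub>j\<close> and \<open>(\<i>, j)\<close> the imaginary part \<open>y\<^sub>j\<close>.\<close>

definition coord :: "complex \<times> nat \<Rightarrow> (nat \<Rightarrow> complex) \<Rightarrow> real" where
  "coord a w = Re (w (snd a) * cnj (fst a))"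

lemma has_pd_coord:
  assumes "c \<in> {1, \<i>}" "fst a \<in> {1, \<i>}"
  shows "has_pd c j (coord a) (if a = (c, j) then 1 else 0) z"
proof (cases "snd a = j")
  case True
  have "((\<lambda>t. Re ((z j + of_real t * c) * cnj (fst a))) has_vector_derivative Re (c * cnj (fst a))) (at 0)"
    by (auto intro!: derivative_eq_intros simp: has_vector_derivative_def algebra_simps)
  moreover have "Re (c * cnj (fst a)) = (if a = (c, j) then 1 else 0)"
    using assms True by (cases a) auto
  ultimately show ?thesis using True by (simp add: has_pd_def coord_def coord_line_def)
next
  case False
  then show ?thesis
    by (cases a) (auto simp: has_pd_def coord_def coord_line_def)
qed

lemma continuous_on_coord: "continuous_on S (coord a)"
  unfolding coord_def
  by (intro continuous_intros continuous_on_subset[OF continuous_on_product_coordinates]) auto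

lemma Ck_on_coord:
  assumes U: "openin (Cspace N) U" and "fst a \<in> {1, \<i>}"
  shows "Ck_on N k U (coord a)"
proof (cases k)
  case 0
  then show ?thesis using U by (simp add: Ck_on_0 continuous_on_coord)
next
  case (Suc m)
  show ?thesis unfolding Suc
  proof (rule Ck_on_SucI[OF U continuous_on_coord])
    show "has_pd c j (coord a) (if a = (c, j) then 1 else 0) z" if "c \<in> {1, \<i>}" for c j z
      using that assms(2) by (rule has_pd_coord)
  qed (rule Ck_on_const[OF U])
qed


text \<open>Expansion of (D_x - i D_y)(D_x + i D_y) / 4, the first factor in the variable
  \<open>i\<close> and the second in \<open>j\<close>. The order matters: \<open>h c d\<close>
  differentiates first in direction \<open>d\<close>, then in direction \<open>c\<close>. The outer
  derivative is taken at \<open>z\<close> alone, but the inner one has to be known on a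
  neighbourhood.\<close>

lemma levi_coeffI:
  assumes U: "openin (Cspace N) U" "z \<in> U" "i < N"
    and g: "\<And>d w. d \<in> {1, \<i>} \<Longrightarrow> w \<in> U \<Longrightarrow> has_pd d j f (g d w) w"
    and h: "\<And>c d. c \<in> {1, \<i>} \<Longrightarrow> d \<in> {1, \<i>} \<Longrightarrow> has_pd c i (g d) (h c d) z"
  shows "levi_coeff f z i j =
    (of_real (h 1 1 + h \<i> \<i>) + \<i> * of_real (h 1 \<i> - h \<i> 1)) / 4"
proof -
  let ?G = "\<lambda>w. (1/2) * (complex_of_real (g 1 w) + \<i> * of_real (g \<i> w))"
  have G: "dzbar j (\<lambda>w. complex_of_real (f w)) w = ?G w" if "w \<in> U" for w
  proof -
    have "partial_deriv d j (\<lambda>w. complex_of_real (f w)) w = of_real (g d w)" if "d \<in> {1, \<i>}" for d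
      using g[OF that \<open>w \<in> U\<close>] by (intro has_pd_imp has_pd_of_real)
    then show ?thesis by (simp add: dzbar_def)
  qed
  have D: "partial_deriv c i (dzbar j (\<lambda>w. complex_of_real (f w))) z
      = (1/2) * (of_real (h c 1) + \<i> * of_real (h c \<i>))" if c: "c \<in> {1, \<i>}" for c
  proof (rule has_pd_imp)
    have "has_pd c i ?G ((1/2) * (of_real (h c 1) + \<i> * of_real (h c \<i>))) z"
      by (intro has_pd_cmult_complex has_pd_add has_pd_of_real h c) auto
    then show "has_pd c i (dzbar j (\<lambda>w. complex_of_real (f w)))
        ((1/2) * (of_real (h c 1) + \<i> * of_real (h c \<i>))) z"
      using has_pd_cong[OF U, of "dzbar j (\<lambda>w. complex_of_real (f w))" ?G] G by simp
  qed
  show ?thesis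
    by (simp add: levi_coeff_def dz_def D algebra_simps add_divide_distrib diff_divide_distrib)
qed

lemma levi_coeff_Ck:
  assumes U: "openin (Cspace N) U" and f: "Ck_on N 2 U f" and "z \<in> U" "i < N" "j < N"
  shows "levi_coeff f z i j =
    (of_real (partial_deriv 1 i (partial_deriv 1 j f) z + partial_deriv \<i> i (partial_deriv \<i> j f) z)
     + \<i> * of_real (partial_deriv 1 i (partial_deriv \<i> j f) z - partial_deriv \<i> i (partial_deriv 1 j f) z)) / 4"
proof (rule levi_coeffI[OF U \<open>z \<in> U\<close> \<open>i < N\<close>])
  note f' = f[unfolded numeral_2_eq_2]
  show "has_pd d j f (partial_deriv d j f w) w" if "d \<in> {1, \<i>}" "w \<in> U" for d w
    using Ck_on_SucD(1)[OF U f'] that assms by blast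
  show "has_pd c i (partial_deriv d j f) (partial_deriv c i (partial_deriv d j f) z) z"
    if "c \<in> {1, \<i>}" "d \<in> {1, \<i>}" for c d
    using Ck_on_SucD(1)[OF U Ck_on_SucD(2)[OF U f']] that assms by blast
qed

lemma levi_coeff_add:
  assumes U: "openin (Cspace N) U" and f: "Ck_on N 2 U f" and g: "Ck_on N 2 U g"
    and z: "z \<in> U" "i < N" "j < N"
  shows "levi_coeff (\<lambda>w. f w + g w) z i j = levi_coeff f z i j + levi_coeff g z i j"
proof -
  note f' = f[unfolded numeral_2_eq_2] and g' = g[unfolded numeral_2_eq_2]
  let ?g = "\<lambda>d w. partial_deriv d j f w + partial_deriv d j g w"
  let ?h = "\<lambda>c d. partial_deriv c i (partial_deriv d j f) z + partial_deriv c i (partial_deriv d j g) z"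
  have "levi_coeff (\<lambda>w. f w + g w) z i j =
    (of_real (?h 1 1 + ?h \<i> \<i>) + \<i> * of_real (?h 1 \<i> - ?h \<i> 1)) / 4"
  proof (rule levi_coeffI[OF U z(1,2)])
    show "has_pd d j (\<lambda>w. f w + g w) (?g d w) w" if "d \<in> {1, \<i>}" "w \<in> U" for d w
      by (intro has_pd_add Ck_on_SucD(1)[OF U f'] Ck_on_SucD(1)[OF U g'] that z)
    show "has_pd c i (?g d) (?h c d) z" if "c \<in> {1, \<i>}" "d \<in> {1, \<i>}" for c d
      by (intro has_pd_add Ck_on_SucD(1)[OF U Ck_on_SucD(2)[OF U f']]
        Ck_on_SucD(1)[OF U Ck_on_SucD(2)[OF U g']] that z)
  qed
  then show ?thesis
    unfolding levi_coeff_Ck[OF U f z] levi_coeff_Ck[OF U g z]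
    by (simp add: algebra_simps add_divide_distrib diff_divide_distrib)
qed

lemma levi_coeff_cmult:
  assumes U: "openin (Cspace N) U" and f: "Ck_on N 2 U f"
    and z: "z \<in> U" "i < N" "j < N"
  shows "levi_coeff (\<lambda>w. a * f w) z i j = of_real a * levi_coeff f z i j"
proof -
  note f' = f[unfolded numeral_2_eq_2]
  let ?g = "\<lambda>d w. a * partial_deriv d j f w"
  let ?h = "\<lambda>c d. a * partial_deriv c i (partial_deriv d j f) z"
  have "levi_coeff (\<lambda>w. a * f w) z i j =
    (of_real (?h 1 1 + ?h \<i> \<i>) + \<i> * of_real (?h 1 \<i> - ?h \<i> 1)) / 4"
  proof (rule levi_coeffI[OF U z(1,2)])
    show "has_pd d j (\<lambda>w. a * f w) (?g d w) w" if "d \<in> {1, \<i>}" "w \<in> U" for d w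
      by (intro has_pd_cmult Ck_on_SucD(1)[OF U f'] that z)
    show "has_pd c i (?g d) (?h c d) z" if "c \<in> {1, \<i>}" "d \<in> {1, \<i>}" for c d
      by (intro has_pd_cmult Ck_on_SucD(1)[OF U Ck_on_SucD(2)[OF U f']] that z)
  qed
  then show ?thesis
    unfolding levi_coeff_Ck[OF U f z]
    by (simp add: algebra_simps add_divide_distrib diff_divide_distrib)
qed

section \<open>Quadratic polynomials in the real coordinates\<close>

definition coords :: "nat \<Rightarrow> (complex \<times> nat) set" where
  "coords N = {1, \<i>} \<times> {..<N}"

lemma finite_coords [simp]: "finite (coords N)"
  by (simp add: coords_def)

lemma coords_mem [simp]: "(c, j) \<in> coords N \<longleftrightarrow> c \<in> {1, \<i>} \<and> j < N"
  by (auto simp: coords_def)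

text \<open>A second order Taylor polynomial at \<open>p\<close>, with value \<open>k\<close>,
  gradient \<open>l\<close> and, for symmetric \<open>h\<close>, real Hessian
  \<open>h\<close>.\<close>

definition quad :: "nat \<Rightarrow> (nat \<Rightarrow> complex) \<Rightarrow> real \<Rightarrow> (complex \<times> nat \<Rightarrow> real) \<Rightarrow>
    (complex \<times> nat \<Rightarrow> complex \<times> nat \<Rightarrow> real) \<Rightarrow> (nat \<Rightarrow> complex) \<Rightarrow> real" where
  "quad N p k l h w = k + (\<Sum>a\<in>coords N. l a * (coord a w - coord a p)) +
     (1/2) * (\<Sum>a\<in>coords N. \<Sum>b\<in>coords N. h a b * ((coord a w - coord a p) * (coord b w - coord b p)))"

lemma Ck_on_coord_diff:
  assumes "openin (Cspace N) U" "a \<in> coords M"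
  shows "Ck_on N k U (\<lambda>w. coord a w - coord a p)"
  using Ck_on_add[OF assms(1) Ck_on_coord[OF assms(1)] Ck_on_const[OF assms(1)], of a k "- coord a p"] assms(2)
  by (auto simp: coords_def)

lemma Ck_on_quad: "openin (Cspace N) U \<Longrightarrow> Ck_on N k U (quad M p c l h)"
  unfolding quad_def
  by (intro Ck_on_add Ck_on_const Ck_on_sum Ck_on_mult Ck_on_cmult Ck_on_coord_diff)

lemma has_pd_coord_diff:
  assumes "c \<in> {1, \<i>}" "a \<in> coords N"
  shows "has_pd c j (\<lambda>w. coord a w - coord a p) (if a = (c, j) then 1 else 0) z"
proof -
  have "fst a \<in> {1, \<i>}" using assms(2) by (auto simp: coords_def)
  from has_pd_diff[OF has_pd_coord[OF assms(1) this] has_pd_const]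
  show ?thesis by (simp only: diff_0_right)
qed

text \<open>The product rule yields one sum from each of the two linear factors; symmetry of
  \<open>h\<close> identifies these sums, and the factor 1/2 in \<open>quad\<close> cancels.\<close>

lemma has_pd_quad:
  assumes sym: "\<And>a b. h a b = h b a" and cj: "c \<in> {1, \<i>}" "j < N"
  shows "has_pd c j (quad N p k l h)
    (l (c, j) + (\<Sum>b\<in>coords N. h (c, j) b * (coord b w - coord b p))) w"
proof -
  let ?X = "\<lambda>a w. coord a w - coord a p"
  let ?d = "\<lambda>a. if a = (c, j) then 1 else 0 :: real"
  have cj': "(c, j) \<in> coords N" using cj by simp
  have "has_pd c j (quad N p k l h) (0 + (\<Sum>a\<in>coords N. l a * ?d a) +
      (1/2) * (\<Sum>a\<in>coords N. \<Sum>b\<in>coords N. h a b * (?X a w * ?d b + ?d a * ?X b w))) w"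
    unfolding quad_def
    by (intro has_pd_add has_pd_const has_pd_sum has_pd_mult has_pd_cmult has_pd_coord_diff cj)
  moreover have "(\<Sum>a\<in>coords N. l a * ?d a) = l (c, j)"
    using cj' by (simp add: if_distrib[of "\<lambda>x. _ * x"] cong: if_cong)
  moreover have "(\<Sum>a\<in>coords N. \<Sum>b\<in>coords N. h a b * (?X a w * ?d b + ?d a * ?X b w))
      = 2 * (\<Sum>b\<in>coords N. h (c, j) b * ?X b w)"
  proof -
    have eq: "h a b * (?X a w * ?d b + ?d a * ?X b w) =
        (if b = (c, j) then h a b * ?X a w else 0) + (if a = (c, j) then h a b * ?X b w else 0)" for a b
      by (auto simp: algebra_simps)
    have "(\<Sum>a\<in>coords N. \<Sum>b\<in>coords N. h a b * (?X a w * ?d b + ?d a * ?X b w))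
      = (\<Sum>a\<in>coords N. \<Sum>b\<in>coords N. (if b = (c, j) then h a b * ?X a w else 0)
          + (if a = (c, j) then h a b * ?X b w else 0))"
      by (intro sum.cong refl eq)
    also have "\<dots> = (\<Sum>a\<in>coords N. \<Sum>b\<in>coords N. if b = (c, j) then h a b * ?X a w else 0)
        + (\<Sum>a\<in>coords N. \<Sum>b\<in>coords N. if a = (c, j) then h a b * ?X b w else 0)"
      by (simp only: sum.distrib)
    also have "(\<Sum>a\<in>coords N. \<Sum>b\<in>coords N. if a = (c, j) then h a b * ?X b w else 0)
        = (\<Sum>b\<in>coords N. \<Sum>a\<in>coords N. if a = (c, j) then h a b * ?X b w else 0)"
      by (rule sum.swap)
    also have "(\<Sum>a\<in>coords N. \<Sum>b\<in>coords N. if b = (c, j) then h a b * ?X a w else 0)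
        + (\<Sum>b\<in>coords N. \<Sum>a\<in>coords N. if a = (c, j) then h a b * ?X b w else 0)
        = (\<Sum>a\<in>coords N. h a (c, j) * ?X a w) + (\<Sum>b\<in>coords N. h (c, j) b * ?X b w)"
      using cj' by (simp only: sum.delta[OF finite_coords] if_True)
    finally show ?thesis by (simp add: sym[of _ "(c, j)"])
  qed
  ultimately show ?thesis by simp
qed

lemma levi_coeff_quad:
  assumes sym: "\<And>a b. h a b = h b a" and z: "z \<in> Cn N" "i < N" "j < N"
  shows "levi_coeff (quad N p k l h) z i j =
    (of_real (h (1, i) (1, j) + h (\<i>, i) (\<i>, j)) + \<i> * of_real (h (1, i) (\<i>, j) - h (\<i>, i) (1, j))) / 4"
proof (rule levi_coeffI[OF openin_Cspace_Cn z(1,2)])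
  let ?g = "\<lambda>d w. l (d, j) + (\<Sum>b\<in>coords N. h (d, j) b * (coord b w - coord b p))"
  show "has_pd d j (quad N p k l h) (?g d w) w" if "d \<in> {1, \<i>}" for d w
    by (rule has_pd_quad[OF sym that z(3)])
  show "has_pd c i (?g d) (h (c, i) (d, j)) z" if "c \<in> {1, \<i>}" for c d
  proof -
    have "has_pd c i (?g d) (0 + (\<Sum>b\<in>coords N. h (d, j) b * (if b = (c, i) then 1 else 0))) z"
      by (intro has_pd_add has_pd_const has_pd_sum has_pd_cmult has_pd_coord_diff that)
    moreover have "(\<Sum>b\<in>coords N. h (d, j) b * (if b = (c, i) then 1 else 0)) = h (d, j) (c, i)"
      using that z by (simp add: if_distrib[of "\<lambda>x. _ * x"] cong: if_cong)
    ultimately show ?thesis by (simp only: sym[of "(c, i)" "(d, j)"] add_0)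
  qed
qed

definition dist_sq :: "nat \<Rightarrow> (nat \<Rightarrow> complex) \<Rightarrow> (nat \<Rightarrow> complex) \<Rightarrow> real" where
  "dist_sq N p w = (\<Sum>i<N. (cmod (w i - p i))\<^sup>2)"

lemma sum_coords: "(\<Sum>a\<in>coords N. f a) = (\<Sum>i<N. f (1, i) + f (\<i>, i))"
  unfolding coords_def
  by (simp add: sum.cartesian_product' sum.distrib)

text \<open>The real Hessian is twice the identity; by \<open>levi_coeff_quad\<close> the complex
  Hessian is then the identity, as (2 + 2) / 4 = 1.\<close>

lemma dist_sq_quad: "dist_sq N p = quad N p 0 (\<lambda>_. 0) (\<lambda>a b. if a = b then 2 else 0)"
proof
  fix w
  have cm: "(coord (1, i) w - coord (1, i) p)\<^sup>2 + (coord (\<i>, i) w - coord (\<i>, i) p)\<^sup>2 = (cmod (w i - p i))\<^sup>2" for i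
    by (simp add: cmod_power2 coord_def)
  have "(\<Sum>b\<in>coords N. (if a = b then 2 else 0) * ((coord a w - coord a p) * (coord b w - coord b p)))
      = 2 * (coord a w - coord a p)\<^sup>2" if "a \<in> coords N" for a
  proof -
    have "(\<Sum>b\<in>coords N. (if a = b then 2 else 0) * ((coord a w - coord a p) * (coord b w - coord b p)))
      = (\<Sum>b\<in>coords N. if a = b then 2 * ((coord a w - coord a p) * (coord b w - coord b p)) else 0)"
      by (rule sum.cong) auto
    also have "\<dots> = 2 * (coord a w - coord a p)\<^sup>2"
      using that by (simp only: sum.delta'[OF finite_coords] if_True power2_eq_square)
    finally show ?thesis .
  qed
  then have "(\<Sum>a\<in>coords N. \<Sum>b\<in>coords N. (if a = b then 2 else 0) * ((coord a w - coord a p) * (coord b w - coord b p)))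
      = 2 * (\<Sum>a\<in>coords N. (coord a w - coord a p)\<^sup>2)"
    unfolding sum_distrib_left by (rule sum.cong[OF refl])
  also have "\<dots> = 2 * dist_sq N p w"
    by (simp only: sum_coords cm dist_sq_def)
  finally have E: "(\<Sum>a\<in>coords N. \<Sum>b\<in>coords N. (if a = b then 2 else 0) *
      ((coord a w - coord a p) * (coord b w - coord b p))) = 2 * dist_sq N p w" .
  show "dist_sq N p w = quad N p 0 (\<lambda>_. 0) (\<lambda>a b. if a = b then 2 else 0) w"
    unfolding quad_def E by simp
qed

lemma Ck_on_dist_sq: "openin (Cspace N) U \<Longrightarrow> Ck_on N k U (dist_sq N p)"
  by (simp add: dist_sq_quad Ck_on_quad)

lemma levi_coeff_dist_sq:
  assumes "z \<in> Cn N" "i < N" "j < N"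
  shows "levi_coeff (dist_sq N p) z i j = (if i = j then 1 else 0)"
  by (simp add: dist_sq_quad levi_coeff_quad[OF _ assms])

lemma continuous_on_dist_sq: "continuous_on S (dist_sq N p)"
  unfolding dist_sq_def
  by (intro continuous_intros continuous_on_subset[OF continuous_on_product_coordinates]) auto

section \<open>Holomorphic functions\<close>

definition box_Cn :: "nat \<Rightarrow> (nat \<Rightarrow> complex) \<Rightarrow> real \<Rightarrow> (nat \<Rightarrow> complex) set" where
  "box_Cn N p r = {z \<in> Cn N. \<forall>i<N. cmod (z i - p i) \<le> r}"

text \<open>Tychonoff: the polydisc is a product of closed discs and, from index \<open>N\<close>
  on, of the singleton of 0.\<close>

lemma compact_box_Cn: assumes "p \<in> Cn N" shows "compact (box_Cn N p r)"
proof -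
  have "box_Cn N p r = Pi\<^sub>E UNIV (\<lambda>i. if i < N then cball (p i) r else {0})"
  proof (intro equalityI subsetI)
    fix z assume "z \<in> box_Cn N p r"
    then show "z \<in> Pi\<^sub>E UNIV (\<lambda>i. if i < N then cball (p i) r else {0})"
      by (auto simp: box_Cn_def Cn_def dist_norm norm_minus_commute)
  next
    fix z assume z: "z \<in> Pi\<^sub>E UNIV (\<lambda>i. if i < N then cball (p i) r else {0})"
    have zi: "z i \<in> (if i < N then cball (p i) r else {0})" for i
      using PiE_mem[OF z UNIV_I] .
    have "z i = 0" if "i \<ge> N" for i using zi[of i] that by simp
    moreover have "cmod (z i - p i) \<le> r" if "i < N" for i
      using zi[of i] that by (simp add: dist_norm norm_minus_commute)
    ultimately show "z \<in> box_Cn N p r" by (simp add: box_Cn_def Cn_def)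
  qed
  moreover have "compactin (product_topology (\<lambda>i. euclidean) UNIV)
      (Pi\<^sub>E UNIV (\<lambda>i. if i < N then cball (p i) r else {0 :: complex}))"
    by (auto simp: compactin_PiE)
  ultimately show ?thesis
    by (simp add: euclidean_product_topology)
qed

text \<open>A polydisc is a neighbourhood of its centre relative to \<open>U\<close>. This carries
  continuity from the polydisc, where uniform limits are available, over to
  \<open>U\<close>.\<close>

lemma at_within_box_Cn:
  assumes "openin (Cspace N) U" "p \<in> U" "r > 0" "box_Cn N p r \<subseteq> U"
  shows "at p within U = at p within box_Cn N p r"
proof -
  let ?S = "\<Inter>i\<in>{..<N}. {z. cmod (z i - p i) < r}"
  have "open {z :: nat \<Rightarrow> complex. cmod (z i - p i) < r}" for i
    by (intro open_Collect_less continuous_intros continuous_on_product_coordinates)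
  then have "open ?S" by (intro open_INT) auto
  moreover have "U \<inter> ?S - {p} = box_Cn N p r \<inter> ?S - {p}"
  proof -
    have "z \<in> box_Cn N p r" if "z \<in> U" "z \<in> ?S" for z
      unfolding box_Cn_def using that openin_Cspace_subset[OF assms(1)] by (auto intro: less_imp_le)
    then show ?thesis using assms(4) by blast
  qed
  moreover have "p \<in> ?S" using assms(3) by simp
  ultimately show ?thesis using at_within_nhd by blast
qed

lemma box_Cn_subset_openin:
  assumes "openin (Cspace N) U" "p \<in> U"
  obtains r where "r > 0" "box_Cn N p r \<subseteq> U"
proof -
  obtain e where "e > 0" "\<And>w. w \<in> Cn N \<Longrightarrow> (\<forall>i<N. cmod (w i - p i) < e) \<Longrightarrow> w \<in> U"
    using openin_Cspace_box[OF assms] by blast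
  then show thesis
    by (intro that[of "e/2"]) (fastforce simp: box_Cn_def)+
qed

lemma holomorphic_Cn_continuous:
  "openin (Cspace N) U \<Longrightarrow> holomorphic_Cn N U f \<Longrightarrow> continuous_on U f"
  by (simp add: holomorphic_Cn_def continuous_map_Cspace_iff)

lemma holomorphic_Cn_slice:
  assumes "holomorphic_Cn N U f" "z(j := w) \<in> U" "j < N"
  shows "(\<lambda>w. f (z(j := w))) field_differentiable at w"
  using assms by (auto simp: holomorphic_Cn_def dest!: bspec[of _ _ "z(j := w)"])

section \<open>Complex partial derivatives as uniform limits of difference quotients\<close>

definition cpd :: "nat \<Rightarrow> ((nat \<Rightarrow> complex) \<Rightarrow> complex) \<Rightarrow> (nat \<Rightarrow> complex) \<Rightarrow> complex" where
  "cpd j f z = deriv (\<lambda>w. f (z(j := w))) (z j)"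

lemma box_Cn_upd:
  assumes "z \<in> box_Cn N p r" "cmod (w - z j) \<le> s" "j < N" "s \<ge> 0"
  shows "z(j := w) \<in> box_Cn N p (r + s)"
proof -
  have "cmod (w - p j) \<le> r + s"
    using norm_triangle_mono[of "z j - p j" r "w - z j" s] assms by (auto simp: box_Cn_def)
  then show ?thesis using assms by (auto simp: box_Cn_def Cn_upd intro: order_trans)
qed

text \<open>First order Taylor expansion on the disc of radius \<open>r / 2\<close>, with the second
  derivative bounded by Cauchy's estimate on discs of radius \<open>r / 2\<close> inside
  \<open>cball a r\<close>. The bound depends on \<open>g\<close> only through \<open>M\<close>, so
  it is uniform over all slices of a bounded function.\<close>

lemma difference_quotient_bound:
  assumes hol: "g holomorphic_on ball a R" and R: "0 < r" "r < R"
    and M: "\<And>w. w \<in> cball a r \<Longrightarrow> cmod (g w) \<le> M" and t: "cmod t < r / 2" "t \<noteq> 0"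
  shows "cmod ((g (a + t) - g a) / t - deriv g a) \<le> 8 * (M + 1) / r\<^sup>2 * cmod t"
proof -
  let ?S = "ball a (r / 2)"
  \<comment> \<open>This is \<open>fact 2 * (M + 1) / (r / 2)^2\<close>, with \<open>M + 1\<close>
    because Cauchy's estimate wants the values in an open ball.\<close>
  let ?B = "2 * (M + 1) / (r / 2)\<^sup>2"
  have sub: "?S \<subseteq> ball a R" using R by auto
  have "cmod (g (a + t) - (\<Sum>i\<le>1. (deriv ^^ i) g a * (a + t - a) ^ i / fact i))
      \<le> ?B * cmod (a + t - a) ^ Suc 1 / fact 1"
  proof (rule complex_Taylor[where S = ?S and f = "\<lambda>i. (deriv ^^ i) g", unfolded funpow_0])
    show "((deriv ^^ i) g has_field_derivative (deriv ^^ Suc i) g x) (at x within ?S)" if "x \<in> ?S" for i x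
    proof -
      have "(deriv ^^ i) g holomorphic_on ball a R"
        by (rule holomorphic_higher_deriv[OF hol open_ball])
      then have "((deriv ^^ i) g has_field_derivative deriv ((deriv ^^ i) g) x) (at x)"
        using sub that by (blast intro: holomorphic_derivI[OF _ open_ball])
      then show ?thesis
        by (simp add: has_field_derivative_at_within)
    qed
    show "cmod ((deriv ^^ Suc 1) g x) \<le> ?B" if "x \<in> ?S" for x
    proof -
      have xs: "cball x (r / 2) \<subseteq> cball a r"
      proof
        fix w assume "w \<in> cball x (r / 2)"
        then show "w \<in> cball a r" using that dist_triangle[of a w x] by simp
      qed
      have "cball a r \<subseteq> ball a R" using R by auto
      then have h: "g holomorphic_on cball x (r / 2)"
        using hol xs by (meson holomorphic_on_subset order_trans)
      have "cmod ((deriv ^^ 2) g x) \<le> fact 2 * (M + 1) / (r / 2) ^ 2"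
      proof (rule Cauchy_higher_deriv_bound[where y = 0])
        show "g w \<in> ball 0 (M + 1)" if "w \<in> ball x (r / 2)" for w
        proof -
          have "w \<in> cball a r" using xs that by (meson ball_subset_cball subsetD)
          then show ?thesis using M[of w] by simp
        qed
      qed (use h R in \<open>auto intro: holomorphic_on_subset holomorphic_on_imp_continuous_on\<close>)
      then show ?thesis by (simp add: numeral_2_eq_2)
    qed
  qed (use t R in \<open>auto simp: dist_norm\<close>)
  then have "cmod (g (a + t) - g a - deriv g a * t) \<le> 8 * (M + 1) / r\<^sup>2 * cmod t * cmod t"
    by (simp add: power2_eq_square algebra_simps)
  moreover have "(g (a + t) - g a) / t - deriv g a = (g (a + t) - g a - deriv g a * t) / t"
    using t by (simp add: field_simps)
  ultimately show ?thesis
    using t by (simp add: norm_divide divide_le_eq)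
qed

lemma holomorphic_Cn_difference_quotient:
  assumes U: "openin (Cspace N) U" and f: "holomorphic_Cn N U f" and p: "p \<in> U" and j: "j < N"
  obtains r t where "r > 0" "box_Cn N p (2 * r) \<subseteq> U" "\<And>m. t m \<noteq> 0" "\<And>m::nat. cmod (t m) \<le> r"
    "uniform_limit (box_Cn N p r) (\<lambda>m z. (f (z(j := z j + t m)) - f z) / t m) (cpd j f) sequentially"
proof -
  obtain s where s: "s > 0" "box_Cn N p s \<subseteq> U" using box_Cn_subset_openin[OF U p] by blast
  \<comment> \<open>A slice through a point of \<open>box_Cn N p r\<close> is used on a disc of
    radius \<open>2 * r\<close>, so it stays within \<open>3 * r < s\<close> of
    \<open>p\<close>.\<close>
  define r where "r = s / 4"
  have r: "r > 0" and r4: "box_Cn N p (4 * r) \<subseteq> U" using s by (auto simp: r_def)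
  have pC: "p \<in> Cn N" using p openin_Cspace_subset[OF U] by auto
  have "compact (f ` box_Cn N p (4 * r))"
    using holomorphic_Cn_continuous[OF U f] r4 compact_box_Cn[OF pC]
    by (meson compact_continuous_image continuous_on_subset)
  then obtain M where M: "\<And>z. z \<in> box_Cn N p (4 * r) \<Longrightarrow> cmod (f z) \<le> M"
    by (meson compact_imp_bounded bounded_iff imageI)
  \<comment> \<open>A null sequence of nonzero increments, at most \<open>r / 3\<close> and thus
    below the \<open>r / 2\<close> of \<open>difference_quotient_bound\<close>.\<close>
  define t where "t m = complex_of_real (r / 3 / real (Suc m))" for m
  have tr: "cmod (t m) \<le> r / 3" for m
  proof -
    have "r / 3 / real (Suc m) \<le> r / 3 / 1" using r by (intro divide_left_mono) auto
    then show ?thesis unfolding t_def norm_of_real using r by simp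
  qed
  have t0: "t m \<noteq> 0" for m using r by (simp add: t_def del: of_nat_Suc)
  have mono: "box_Cn N p (2 * r) \<subseteq> box_Cn N p (4 * r)" using r by (force simp: box_Cn_def)
  have bd: "cmod ((f (z(j := z j + t m)) - f z) / t m - cpd j f z) \<le> 8 * (M + 1) / r\<^sup>2 * cmod (t m)"
    if z: "z \<in> box_Cn N p r" for z m
  proof -
    let ?g = "\<lambda>w. f (z(j := w))"
    have "cmod ((?g (z j + t m) - ?g (z j)) / t m - deriv ?g (z j)) \<le> 8 * (M + 1) / r\<^sup>2 * cmod (t m)"
    proof (rule difference_quotient_bound)
      show "?g holomorphic_on ball (z j) (2 * r)"
      proof -
        have "?g field_differentiable at w" if "w \<in> ball (z j) (2 * r)" for w
        proof (rule holomorphic_Cn_slice[OF f _ j])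
          have "z(j := w) \<in> box_Cn N p (r + 2 * r)"
            using that r by (intro box_Cn_upd z j) (auto simp: dist_norm norm_minus_commute)
          then show "z(j := w) \<in> U" using r4 r by (force simp: box_Cn_def)
        qed
        then show ?thesis by (simp add: holomorphic_on_def field_differentiable_at_within)
      qed
      show "cmod (?g w) \<le> M" if "w \<in> cball (z j) r" for w
      proof -
        have "z(j := w) \<in> box_Cn N p (r + r)"
          using that r by (intro box_Cn_upd z j) (auto simp: dist_norm norm_minus_commute)
        then show ?thesis using M mono by auto
      qed
    qed (use r tr[of m] t0 in auto)
    then show ?thesis by (simp add: cpd_def)
  qed
  have "(\<lambda>m. 8 * (M + 1) / r\<^sup>2 * cmod (t m)) \<longlonglongrightarrow> 8 * (M + 1) / r\<^sup>2 * cmod 0"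
    unfolding t_def
    by (intro tendsto_intros tendsto_norm tendsto_of_real[of _ "0::real", simplified] LIMSEQ_Suc
        lim_const_over_n)
  then have lim: "(\<lambda>m. 8 * (M + 1) / r\<^sup>2 * cmod (t m)) \<longlonglongrightarrow> 0" by simp
  show thesis
  proof (rule that[OF r _ t0])
    show "box_Cn N p (2 * r) \<subseteq> U" using mono r4 by blast
    show "cmod (t m) \<le> r" for m using tr[of m] r by linarith
    show "uniform_limit (box_Cn N p r) (\<lambda>m z. (f (z(j := z j + t m)) - f z) / t m) (cpd j f) sequentially"
    proof (rule uniform_limitI)
      fix e :: real assume "e > 0"
      then have "\<forall>\<^sub>F m in sequentially. 8 * (M + 1) / r\<^sup>2 * cmod (t m) < e"
        using lim order_tendstoD(2) by blast
      then show "\<forall>\<^sub>F m in sequentially. \<forall>z\<in>box_Cn N p r.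
          dist ((f (z(j := z j + t m)) - f z) / t m) (cpd j f z) < e"
        by eventually_elim (use bd in \<open>auto simp: dist_norm intro: le_less_trans\<close>)
    qed
  qed
qed

lemma continuous_on_upd: "continuous_on S (\<lambda>z :: nat \<Rightarrow> complex. z(j := z j + t))"
proof (rule continuous_on_coordinatewise_then_product)
  fix i
  have "continuous_on S (\<lambda>z :: nat \<Rightarrow> complex. z i)" for i
    by (rule continuous_on_subset[OF continuous_on_product_coordinates]) auto
  then show "continuous_on S (\<lambda>z. (z(j := z j + t)) i)"
    by (cases "i = j") (auto intro: continuous_intros)
qed

text \<open>Holomorphy is continuity together with holomorphy in each variable. The difference
  quotients in the variable \<open>j\<close> have both properties and converge uniformly near each
  point, so the limit is continuous and, by Weierstrass' theorem applied to the slices in the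
  variable \<open>k\<close>, separately holomorphic.\<close>

lemma holomorphic_Cn_cpd:
  assumes U: "openin (Cspace N) U" and f: "holomorphic_Cn N U f" and j: "j < N"
  shows "holomorphic_Cn N U (cpd j f)"
  unfolding holomorphic_Cn_def continuous_map_Cspace_iff[OF U]
proof (intro conjI ballI allI impI)
  show "continuous_on U (cpd j f)"
    unfolding continuous_on_eq_continuous_within
  proof
    fix p assume p: "p \<in> U"
    obtain r t where r: "r > 0" "box_Cn N p (2 * r) \<subseteq> U" "\<And>m. t m \<noteq> 0" "\<And>m::nat. cmod (t m) \<le> r"
      and lim: "uniform_limit (box_Cn N p r) (\<lambda>m z. (f (z(j := z j + t m)) - f z) / t m) (cpd j f) sequentially"
      using holomorphic_Cn_difference_quotient[OF U f p j] by blast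
    have sub: "box_Cn N p r \<subseteq> U" using r by (force simp: box_Cn_def)
    have "continuous_on (box_Cn N p r) (\<lambda>z. (f (z(j := z j + t m)) - f z) / t m)" for m
    proof (intro continuous_intros ballI r)
      show "continuous_on (box_Cn N p r) f"
        using holomorphic_Cn_continuous[OF U f] sub continuous_on_subset by blast
      show "continuous_on (box_Cn N p r) (\<lambda>z. f (z(j := z j + t m)))"
      proof (rule continuous_on_compose2[OF holomorphic_Cn_continuous[OF U f] continuous_on_upd])
        have "z(j := z j + t m) \<in> box_Cn N p (r + r)" if "z \<in> box_Cn N p r" for z
          using r by (intro box_Cn_upd that j) auto
        then show "(\<lambda>z. z(j := z j + t m)) ` box_Cn N p r \<subseteq> U" using r(2) by auto
      qed
    qed
    then have "continuous_on (box_Cn N p r) (cpd j f)"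
      using uniform_limit_theorem[OF _ lim] by simp
    moreover have "p \<in> box_Cn N p r" using p openin_Cspace_subset[OF U] r by (auto simp: box_Cn_def)
    ultimately show "continuous (at p within U) (cpd j f)"
      unfolding at_within_box_Cn[OF U p r(1) sub] by (simp add: continuous_on_eq_continuous_within)
  qed
next
  fix p k assume p: "p \<in> U" and k: "k < N"
  obtain r t where r: "r > 0" "box_Cn N p (2 * r) \<subseteq> U" "\<And>m. t m \<noteq> 0" "\<And>m::nat. cmod (t m) \<le> r"
    and lim: "uniform_limit (box_Cn N p r) (\<lambda>m z. (f (z(j := z j + t m)) - f z) / t m) (cpd j f) sequentially"
    using holomorphic_Cn_difference_quotient[OF U f p j] by blast
  have pbox: "p \<in> box_Cn N p 0" using p openin_Cspace_subset[OF U] by (auto simp: box_Cn_def)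
  let ?S = "ball (p k) r"
  have box: "p(k := w) \<in> box_Cn N p r" if "w \<in> ?S" for w
    using box_Cn_upd[OF pbox, of w k r] that k r by (auto simp: dist_norm norm_minus_commute)
  have sub: "box_Cn N p r \<subseteq> U" using r by (force simp: box_Cn_def)
  have "(\<lambda>w. cpd j f (p(k := w))) holomorphic_on ?S"
  proof (rule holomorphic_uniform_sequence[OF open_ball])
    let ?F = "\<lambda>m w. (f ((p(k := w))(j := (p(k := w)) j + t m)) - f (p(k := w))) / t m"
    show "?F m holomorphic_on ?S" for m
    proof (intro holomorphic_intros r)
      have fd: "(\<lambda>w. f (p(k := w))) field_differentiable at w" if "w \<in> ?S" for w
        using holomorphic_Cn_slice[OF f _ k, of p w] box[OF that] sub by auto
      then show "(\<lambda>w. f (p(k := w))) holomorphic_on ?S"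
        by (simp add: holomorphic_on_def field_differentiable_at_within)
      have inU: "(p(k := w))(j := (p(k := w)) j + t m) \<in> U" if "w \<in> ?S" for w
        using box_Cn_upd[OF box[OF that], of "(p(k := w)) j + t m" j r] r j by auto
      have "(\<lambda>w. f ((p(k := w))(j := (p(k := w)) j + t m))) field_differentiable at w" if w: "w \<in> ?S" for w
      \<comment> \<open>For \<open>j = k\<close> the increment translates the slice variable itself;
        otherwise the two updates commute and another slice appears.\<close>
      proof (cases "j = k")
        case True
        have "((\<lambda>w. f (p(k := w))) \<circ> (\<lambda>w. w + t m)) field_differentiable at w"
        proof (rule field_differentiable_compose)
          show "(\<lambda>w. f (p(k := w))) field_differentiable at (w + t m)"
            using holomorphic_Cn_slice[OF f _ k, of p "w + t m"] inU[OF w] True by simp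
        qed (intro derivative_intros)
        then show ?thesis using True by (simp add: o_def)
      next
        case False
        then have "(p(k := w))(j := (p(k := w)) j + t m) = (p(j := p j + t m))(k := w)" for w
          by (simp add: fun_upd_twist)
        then show ?thesis
          using holomorphic_Cn_slice[OF f _ k, of "p(j := p j + t m)" w] inU[OF w] by simp
      qed
      then show "(\<lambda>w. f ((p(k := w))(j := (p(k := w)) j + t m))) holomorphic_on ?S"
        by (simp add: holomorphic_on_def field_differentiable_at_within)
    qed
    fix x assume "x \<in> ?S"
    then obtain d where d: "d > 0" "cball x d \<subseteq> ?S" by (meson open_ball open_contains_cball)
    have "uniform_limit (cball x d) ?F (\<lambda>w. cpd j f (p(k := w))) sequentially"
      unfolding uniform_limit_iff
    proof (intro allI impI)
      fix e :: real assume "e > 0"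
      with lim have "\<forall>\<^sub>F m in sequentially. \<forall>z\<in>box_Cn N p r.
          dist ((f (z(j := z j + t m)) - f z) / t m) (cpd j f z) < e"
        by (simp add: uniform_limit_iff)
      then show "\<forall>\<^sub>F m in sequentially. \<forall>w\<in>cball x d. dist (?F m w) (cpd j f (p(k := w))) < e"
        by eventually_elim (use d box in blast)
    qed
    then show "\<exists>d>0. cball x d \<subseteq> ?S \<and> uniform_limit (cball x d) ?F (\<lambda>w. cpd j f (p(k := w))) sequentially"
      using d by blast
  qed
  then show "(\<lambda>w. cpd j f (p(k := w))) field_differentiable at (p k)"
    using r by (auto intro: holomorphic_on_imp_differentiable_at)
qed

lemma has_pd_Re_holomorphic:
  assumes f: "holomorphic_Cn N U f" and z: "z \<in> U" and j: "j < N"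
  shows "has_pd d j (\<lambda>w. Re (c * f w)) (Re (c * d * cpd j f z)) z"
proof -
  have "((\<lambda>w. f (z(j := w))) has_field_derivative cpd j f z) (at (z j))"
    using f z j by (simp add: cpd_def holomorphic_Cn_def field_differentiable_derivI)
  moreover have "((\<lambda>t. z j + of_real t * d) has_vector_derivative d) (at 0)"
    by (auto intro!: derivative_eq_intros simp: has_vector_derivative_def scaleR_conv_of_real)
  ultimately have "((\<lambda>w. f (z(j := w))) \<circ> (\<lambda>t. z j + of_real t * d) has_vector_derivative d * cpd j f z) (at 0)"
    by (intro field_vector_diff_chain_at) auto
  then have "((\<lambda>t. Re (c * f (z(j := z j + of_real t * d)))) has_vector_derivative Re (c * (d * cpd j f z))) (at 0)"
    unfolding o_def
    by (intro bounded_linear.has_vector_derivative[OF bounded_linear_Re]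
        bounded_linear.has_vector_derivative[OF bounded_linear_mult_right])
  then show ?thesis by (simp add: has_pd_def coord_line_def mult.assoc)
qed

text \<open>The factor \<open>c\<close> makes the induction close: the derivative in direction
  \<open>d\<close> is \<open>Re (c * d * cpd j f)\<close>, again the real part of a constant times a
  holomorphic function.\<close>

lemma Ck_on_Re_holomorphic:
  assumes U: "openin (Cspace N) U"
  shows "holomorphic_Cn N U f \<Longrightarrow> Ck_on N k U (\<lambda>w. Re (c * f w))"
proof (induction k arbitrary: f c)
  case (0 f c)
  then show ?case
    by (simp add: Ck_on_0[OF U]) (intro continuous_intros holomorphic_Cn_continuous[OF U])
next
  case (Suc k f c)
  show ?case
  proof (rule Ck_on_SucI[OF U])
    show "continuous_on U (\<lambda>w. Re (c * f w))"
      by (intro continuous_intros holomorphic_Cn_continuous[OF U] Suc.prems)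
    show "has_pd d j (\<lambda>w. Re (c * f w)) (Re (c * d * cpd j f z)) z" if "j < N" "z \<in> U" for j d z
      using has_pd_Re_holomorphic[OF Suc.prems] that by blast
    show "Ck_on N k U (\<lambda>z. Re (c * d * cpd j f z))" if "j < N" for j d
      by (intro Suc.IH holomorphic_Cn_cpd[OF U Suc.prems that])
  qed
qed

text \<open>Pluriharmonicity: both directions enter as factors, so the diagonal terms cancel by i *
  i = -1 and the mixed terms by commutativity.\<close>

lemma levi_coeff_Re_holomorphic:
  assumes U: "openin (Cspace N) U" and f: "holomorphic_Cn N U f" and z: "z \<in> U" "i < N" "j < N"
  shows "levi_coeff (\<lambda>w. Re (c * f w)) z i j = 0"
proof -
  let ?h = "\<lambda>a d. Re (c * d * a * cpd i (cpd j f) z)"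
  have "levi_coeff (\<lambda>w. Re (c * f w)) z i j =
    (of_real (?h 1 1 + ?h \<i> \<i>) + \<i> * of_real (?h 1 \<i> - ?h \<i> 1)) / 4"
  proof (rule levi_coeffI[OF U z(1,2)])
    show "has_pd d j (\<lambda>w. Re (c * f w)) (Re (c * d * cpd j f w)) w" if "w \<in> U" for d w
      using has_pd_Re_holomorphic[OF f that z(3)] .
    show "has_pd a i (\<lambda>w. Re (c * d * cpd j f w)) (?h a d) z" for a d
      using has_pd_Re_holomorphic[OF holomorphic_Cn_cpd[OF U f z(3)] z(1,2)] .
  qed
  then show ?thesis by simp
qed

section \<open>Positive definite matrices\<close>

lemma sum_order_char_poly:
  fixes M :: "complex mat"
  assumes M: "M \<in> carrier_mat n n"
  shows "(\<Sum>a | eigenvalue M a. Polynomial.order a (char_poly M)) = n"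
proof -
  let ?p = "char_poly M"
  have nz: "?p \<noteq> 0" using degree_monic_char_poly[OF M] by auto
  have "n = degree ?p" using degree_monic_char_poly[OF M] by simp
  also have "\<dots> = size (proots ?p)"
    using size_proots_complex[of ?p] by simp
  also have "\<dots> = (\<Sum>a\<in>set_mset (proots ?p). Polynomial.order a ?p)"
    using nz by (simp add: size_multiset_overloaded_eq)
  also have "set_mset (proots ?p) = {a. eigenvalue M a}"
    using nz M by (simp add: eigenvalue_root_char_poly)
  finally show ?thesis ..
qed

lemma positive_eigenvalue:
  fixes M :: "complex mat"
  assumes M: "M \<in> carrier_mat n n"
    and herm: "\<And>i j. i < n \<Longrightarrow> j < n \<Longrightarrow> M $$ (j, i) = cnj (M $$ (i, j))"
    and pos: "\<And>v. \<exists>j<n. v j \<noteq> 0 \<Longrightarrow> Re (\<Sum>i<n. \<Sum>j<n. M $$ (i, j) * v i * cnj (v j)) > 0"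
    and ev: "eigenvalue M a"
  shows "a \<in> \<real>" "Re a > 0"
proof -
  obtain v where v: "v \<in> carrier_vec n" "v \<noteq> 0\<^sub>v n" "M *\<^sub>v v = a \<cdot>\<^sub>v v"
    using ev M by (auto simp: eigenvalue_def eigenvector_def)
  define x where "x = vec_index v"
  obtain k where k: "k < n" "x k \<noteq> 0"
    using v(1,2) unfolding x_def by (metis carrier_vecD eq_vecI index_zero_vec(1,2))
  define S where "S = (\<Sum>i<n. (cmod (x i))\<^sup>2)"
  have "S > 0" unfolding S_def
    by (rule sum_pos2[of _ k]) (use k in auto)
  have row: "(\<Sum>j<n. M $$ (i, j) * x j) = a * x i" if "i < n" for i
  proof -
    have "vec_index (M *\<^sub>v v) i = (\<Sum>j<n. M $$ (i, j) * x j)"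
      using M v(1) that by (auto simp: scalar_prod_def lessThan_atLeast0 x_def intro!: sum.cong)
    then show ?thesis using v that by (simp add: x_def)
  qed
  \<comment> \<open>The form conjugates the vector at the second index, so inserting the conjugated
    eigenvector turns the inner sums into the rows of \<open>M *\<^sub>v v\<close>.\<close>
  let ?w = "\<lambda>i. cnj (x i)"
  have Q: "(\<Sum>i<n. \<Sum>j<n. M $$ (i, j) * ?w i * cnj (?w j)) = a * of_real S"
  proof -
    have "(\<Sum>i<n. \<Sum>j<n. M $$ (i, j) * ?w i * cnj (?w j))
        = (\<Sum>i<n. ?w i * (\<Sum>j<n. M $$ (i, j) * x j))"
      by (simp add: sum_distrib_left mult_ac)
    also have "\<dots> = (\<Sum>i<n. a * of_real ((cmod (x i))\<^sup>2))"
      by (intro sum.cong refl) (subst row, simp, simp add: complex_norm_square mult_ac del: of_real_power)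
    finally show ?thesis by (simp add: S_def sum_distrib_left)
  qed
  have "cnj (\<Sum>i<n. \<Sum>j<n. M $$ (i, j) * ?w i * cnj (?w j)) = (\<Sum>i<n. \<Sum>j<n. M $$ (j, i) * ?w j * cnj (?w i))"
    unfolding cnj_sum by (intro sum.cong refl) (simp add: herm[symmetric])
  also have "\<dots> = (\<Sum>i<n. \<Sum>j<n. M $$ (i, j) * ?w i * cnj (?w j))"
    by (rule sum.swap)
  finally have "cnj (a * of_real S) = a * of_real S" unfolding Q .
  then have "cnj a = a" using \<open>S > 0\<close> by simp
  then show "a \<in> \<real>" by (simp add: Reals_cnj_iff)
  have "Re (a * of_real S) > 0"
    unfolding Q[symmetric] by (rule pos) (use k in auto)
  then show "Re a > 0" using \<open>S > 0\<close> by (simp add: zero_less_mult_iff)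
qed

lemma num_positive_eigenvalues_positive_definite:
  fixes M :: "complex mat"
  assumes "M \<in> carrier_mat n n"
    and "\<And>i j. i < n \<Longrightarrow> j < n \<Longrightarrow> M $$ (j, i) = cnj (M $$ (i, j))"
    and "\<And>v. \<exists>j<n. v j \<noteq> 0 \<Longrightarrow> Re (\<Sum>i<n. \<Sum>j<n. M $$ (i, j) * v i * cnj (v j)) > 0"
  shows "num_positive_eigenvalues M = n"
proof -
  have "{a. eigenvalue M a \<and> a \<in> \<real> \<and> Re a > 0} = {a. eigenvalue M a}"
    using positive_eigenvalue[OF assms] by blast
  then show ?thesis
    by (simp add: num_positive_eigenvalues_def sum_order_char_poly[OF assms(1)])
qed

section \<open>Second order Taylor expansion\<close>

text \<open>A box in the real coordinates, so that segments, and paths that change one real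
  coordinate at a time, stay inside.\<close>

definition coord_box :: "nat \<Rightarrow> (nat \<Rightarrow> complex) \<Rightarrow> real \<Rightarrow> (nat \<Rightarrow> complex) set" where
  "coord_box N p r = {w \<in> Cn N. \<forall>a\<in>coords N. \<bar>coord a w - coord a p\<bar> < r}"

lemma coord_simps [simp]: "coord (1, i) w = Re (w i)" "coord (\<i>, i) w = Im (w i)"
  by (simp_all add: coord_def)

lemma coordsE:
  assumes "a \<in> coords N"
  obtains i where "a = (1, i)" "i < N" | i where "a = (\<i>, i)" "i < N"
proof (cases a)
  case (Pair c i)
  then have "c = 1 \<or> c = \<i>" "i < N" using assms by simp_all
  then show thesis using that Pair by metis
qed

lemma coord_box_mono: "r \<le> s \<Longrightarrow> coord_box N p r \<subseteq> coord_box N p s"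
  by (fastforce simp: coord_box_def)

lemma coord_box_cmod:
  assumes "w \<in> coord_box N p r" "i < N"
  shows "cmod (w i - p i) < 2 * r"
proof -
  have "\<bar>coord (1, i) w - coord (1, i) p\<bar> < r" "\<bar>coord (\<i>, i) w - coord (\<i>, i) p\<bar> < r"
    using assms unfolding coord_box_def by (auto simp del: coord_simps)
  then show ?thesis using cmod_le[of "w i - p i"] by simp
qed

lemma coord_box_subset_openin:
  assumes "openin (Cspace N) U" "p \<in> U"
  obtains r where "r > 0" "coord_box N p r \<subseteq> U"
proof -
  obtain e where e: "e > 0" "\<And>w. w \<in> Cn N \<Longrightarrow> (\<forall>i<N. cmod (w i - p i) < e) \<Longrightarrow> w \<in> U"
    using openin_Cspace_box[OF assms] by blast
  show thesis
  proof (rule that[of "e/2"])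
    show "coord_box N p (e/2) \<subseteq> U"
    proof
      fix w assume w: "w \<in> coord_box N p (e/2)"
      show "w \<in> U" using coord_box_cmod[OF w] w by (intro e(2)) (auto simp: coord_box_def)
    qed
  qed (use e in auto)
qed

lemma continuous_coord_box:
  assumes U: "openin (Cspace N) U" and g: "continuous_on U g" and p: "p \<in> U" and e: "e > 0"
  obtains r where "r > 0" "coord_box N p r \<subseteq> U" "\<And>w. w \<in> coord_box N p r \<Longrightarrow> dist (g w) (g p) < e"
proof -
  have "openin (top_of_set U) (U \<inter> g -` ball (g p) e)"
    using g continuous_openin_preimage_gen open_ball by blast
  then have V: "openin (Cspace N) (U \<inter> g -` ball (g p) e)"
    using U unfolding Cspace_Cn by (rule openin_trans)
  have "p \<in> U \<inter> g -` ball (g p) e" using p e by simp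
  from coord_box_subset_openin[OF V this]
  obtain r where r: "r > 0" "coord_box N p r \<subseteq> U \<inter> g -` ball (g p) e" .
  show thesis
  proof (rule that[OF r(1)])
    show "coord_box N p r \<subseteq> U" using r(2) by blast
    show "dist (g w) (g p) < e" if "w \<in> coord_box N p r" for w
    proof -
      have "g w \<in> ball (g p) e" using r(2) that by blast
      then show ?thesis by (simp add: dist_commute)
    qed
  qed
qed

lemma coord_coord_line:
  assumes "fst b \<in> {1, \<i>}" "c \<in> {1, \<i>}"
  shows "coord b (coord_line c j z t) = coord b z + (if b = (c, j) then t else 0)"
  using assms by (cases b) (auto simp: coord_line_def)

text \<open>Replaces the real coordinates in \<open>S\<close> of \<open>q\<close> by those of \<open>w\<close>.\<close>

definition mix :: "(complex \<times> nat) set \<Rightarrow> (nat \<Rightarrow> complex) \<Rightarrow> (nat \<Rightarrow> complex) \<Rightarrow> nat \<Rightarrow> complex" where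
  "mix S q w i = Complex (if (1, i) \<in> S then Re (w i) else Re (q i)) (if (\<i>, i) \<in> S then Im (w i) else Im (q i))"

lemma coord_mix: "fst a \<in> {1, \<i>} \<Longrightarrow> coord a (mix S q w) = (if a \<in> S then coord a w else coord a q)"
  by (cases a) (auto simp: mix_def)

lemma mix_empty: "mix {} q w = q"
  by (rule ext) (simp add: mix_def)

lemma mix_coords:
  assumes "q \<in> Cn N" "w \<in> Cn N"
  shows "mix (coords N) q w = w"
proof
  fix i
  show "mix (coords N) q w i = w i"
    using assms by (cases "i < N") (auto simp: mix_def Cn_def complex_eq_iff)
qed

lemma mix_insert:
  assumes "fst a \<in> {1, \<i>}" "a \<notin> S"
  shows "mix (insert a S) q w = coord_line (fst a) (snd a) (mix S q w) (coord a w - coord a q)"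
proof
  fix i
  obtain j where "a = (1, j) \<or> a = (\<i>, j)" using assms(1) by (cases a) auto
  then show "mix (insert a S) q w i = coord_line (fst a) (snd a) (mix S q w) (coord a w - coord a q) i"
  proof
    assume "a = (1, j)"
    then show ?thesis using assms(2) by (simp add: mix_def coord_line_def complex_eq_iff)
  next
    assume "a = (\<i>, j)"
    then show ?thesis using assms(2) by (simp add: mix_def coord_line_def complex_eq_iff)
  qed
qed

lemma mix_coord_box:
  assumes "q \<in> coord_box N p r" "w \<in> coord_box N p r" "S \<subseteq> coords N"
  shows "mix S q w \<in> coord_box N p r"
proof -
  have "mix S q w i = 0" if "i \<ge> N" for i
    using that assms by (auto simp: mix_def coord_box_def Cn_def complex_eq_iff coords_def)
  moreover have "\<bar>coord a (mix S q w) - coord a p\<bar> < r" if a: "a \<in> coords N" for a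
  proof -
    have "fst a \<in> {1, \<i>}" using a by (auto simp: coords_def)
    then show ?thesis using assms a by (simp add: coord_mix coord_box_def)
  qed
  ultimately show ?thesis by (simp add: coord_box_def Cn_def)
qed

text \<open>Mean value inequality for \<open>f\<close> minus the linear function of slope
  \<open>k\<close>, along a segment parallel to a real axis.\<close>

lemma C1_step:
  assumes a: "a \<in> coords N"
    and pd: "\<And>w. w \<in> coord_box N p r \<Longrightarrow> has_pd (fst a) (snd a) f (g w) w"
    and g: "\<And>w. w \<in> coord_box N p r \<Longrightarrow> \<bar>g w - k\<bar> \<le> e"
    and z: "z \<in> coord_box N p r" "coord_line (fst a) (snd a) z s \<in> coord_box N p r"
  shows "\<bar>f (coord_line (fst a) (snd a) z s) - f z - k * s\<bar> \<le> e * \<bar>s\<bar>"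
proof -
  have a': "fst a \<in> {1, \<i>}" "snd a < N" using a by (auto simp: coords_def)
  let ?L = "coord_line (fst a) (snd a) z"
  have L: "?L t \<in> coord_box N p r" if t: "t \<in> closed_segment 0 s" for t
  proof -
    have "\<bar>coord b (?L t) - coord b p\<bar> < r" if b: "b \<in> coords N" for b
    proof -
      have b': "fst b \<in> {1, \<i>}" using b by (auto simp: coords_def)
      have "\<bar>coord b z - coord b p\<bar> < r" "\<bar>coord b (?L s) - coord b p\<bar> < r"
        using z b by (auto simp: coord_box_def)
      moreover have "0 \<le> t \<and> t \<le> s \<or> s \<le> t \<and> t \<le> 0"
        using t by (auto simp: closed_segment_eq_real_ivl split: if_splits)
      ultimately show ?thesis by (auto simp: coord_coord_line[OF b' a'(1)] split: if_splits)
    qed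
    moreover have "?L t \<in> Cn N" using z a' by (intro coord_line_Cn) (auto simp: coord_box_def)
    ultimately show ?thesis by (simp add: coord_box_def)
  qed
  have "norm ((f (?L s) - k * s) - (f (?L 0) - k * 0)) \<le> e * norm (s - 0)"
  proof (rule field_differentiable_bound[of "closed_segment 0 s" "\<lambda>t. f (?L t) - k * t" "\<lambda>t. g (?L t) - k"])
    fix t assume t: "t \<in> closed_segment 0 s"
    have "((\<lambda>t. f (?L t)) has_real_derivative g (?L t)) (at t)"
      using pd[OF L[OF t]] by (simp add: has_pd_shift has_real_derivative_iff_has_vector_derivative)
    then show "((\<lambda>t. f (?L t) - k * t) has_real_derivative g (?L t) - k) (at t within closed_segment 0 s)"
      by (auto intro!: derivative_eq_intros intro: has_field_derivative_at_within)
    show "norm (g (?L t) - k) \<le> e" using g[OF L[OF t]] by simp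
  qed auto
  then show ?thesis by (simp add: algebra_simps)
qed

text \<open>The classical argument that continuous partial derivatives give differentiability: go
  from \<open>q\<close> to \<open>w\<close> one real coordinate at a time, with an error of at most
  \<open>e\<close> times the length of each step.\<close>

lemma C1_expansion:
  assumes U: "openin (Cspace N) U" and p: "p \<in> U" and e: "e > 0"
    and pd: "\<forall>a\<in>coords N. \<forall>w\<in>U. has_pd (fst a) (snd a) f (g a w) w"
    and g: "\<forall>a\<in>coords N. continuous_on U (g a)"
  shows "\<exists>r>0. coord_box N p r \<subseteq> U \<and> (\<forall>q\<in>coord_box N p r. \<forall>w\<in>coord_box N p r.
      \<bar>f w - f q - (\<Sum>a\<in>coords N. g a p * (coord a w - coord a q))\<bar>
        \<le> e * (\<Sum>a\<in>coords N. \<bar>coord a w - coord a q\<bar>))"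
proof -
  have "\<forall>a\<in>coords N. \<exists>r>0. \<forall>w\<in>coord_box N p r. dist (g a w) (g a p) < e"
    using continuous_coord_box[OF U g[rule_format] p e] by metis
  then obtain R where R: "\<And>a. a \<in> coords N \<Longrightarrow> R a > 0"
      "\<And>a w. a \<in> coords N \<Longrightarrow> w \<in> coord_box N p (R a) \<Longrightarrow> dist (g a w) (g a p) < e"
    by metis
  obtain r0 where r0: "r0 > 0" "coord_box N p r0 \<subseteq> U" using coord_box_subset_openin[OF U p] by blast
  define r where "r = Min (insert r0 (R ` coords N))"
  have r: "r > 0" "r \<le> r0" "\<And>a. a \<in> coords N \<Longrightarrow> r \<le> R a"
    using R r0 by (auto simp: r_def)
  have sub: "coord_box N p r \<subseteq> U" using coord_box_mono[OF r(2)] r0(2) by blast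
  have dg: "\<bar>g a w - g a p\<bar> \<le> e" if "a \<in> coords N" "w \<in> coord_box N p r" for a w
    using R(2)[OF that(1) subsetD[OF coord_box_mono[OF r(3)[OF that(1)]] that(2)]]
    by (simp add: dist_real_def)
  show ?thesis
  proof (intro exI[of _ r] conjI ballI r(1) sub)
    fix q w assume q: "q \<in> coord_box N p r" and w: "w \<in> coord_box N p r"
    \<comment> \<open>Induction on the set \<open>S\<close> of the coordinates that have already
      been moved.\<close>
    have "\<bar>f (mix S q w) - f q - (\<Sum>a\<in>S. g a p * (coord a w - coord a q))\<bar>
        \<le> e * (\<Sum>a\<in>S. \<bar>coord a w - coord a q\<bar>)" if "S \<subseteq> coords N" for S
      using finite_subset[OF that finite_coords] that
    proof (induction S rule: finite_induct)
      case empty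
      then show ?case by (simp add: mix_empty)
    next
      case (insert a S)
      then have a: "a \<in> coords N" and S: "S \<subseteq> coords N" by auto
      have fa: "fst a \<in> {1, \<i>}" using a by (auto simp: coords_def)
      let ?s = "coord a w - coord a q"
      have m: "mix (insert a S) q w = coord_line (fst a) (snd a) (mix S q w) ?s"
        by (rule mix_insert[OF fa insert.hyps(2)])
      have "\<bar>f (mix (insert a S) q w) - f (mix S q w) - g a p * ?s\<bar> \<le> e * \<bar>?s\<bar>"
        unfolding m
      proof (rule C1_step[OF a])
        show "has_pd (fst a) (snd a) f (g a w) w" if "w \<in> coord_box N p r" for w
          using pd a sub that by blast
        show "\<bar>g a w - g a p\<bar> \<le> e" if "w \<in> coord_box N p r" for w
          by (rule dg[OF a that])
        show "mix S q w \<in> coord_box N p r" by (rule mix_coord_box[OF q w S])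
        show "coord_line (fst a) (snd a) (mix S q w) ?s \<in> coord_box N p r"
          unfolding m[symmetric] by (rule mix_coord_box[OF q w insert.prems])
      qed
      moreover have "\<bar>f (mix S q w) - f q - (\<Sum>a\<in>S. g a p * (coord a w - coord a q))\<bar>
        \<le> e * (\<Sum>a\<in>S. \<bar>coord a w - coord a q\<bar>)" by (rule insert.IH[OF S])
      ultimately show ?case
        unfolding sum.insert[OF insert.hyps] distrib_left by linarith
    qed
    from this[OF order_refl] show "\<bar>f w - f q - (\<Sum>a\<in>coords N. g a p * (coord a w - coord a q))\<bar>
        \<le> e * (\<Sum>a\<in>coords N. \<bar>coord a w - coord a q\<bar>)"
      using mix_coords[of q N w] q w by (simp add: coord_box_def)
  qed
qed

section \<open>Expansion along segments\<close>

definition line_Cn :: "(nat \<Rightarrow> complex) \<Rightarrow> (nat \<Rightarrow> complex) \<Rightarrow> real \<Rightarrow> nat \<Rightarrow> complex" where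
  "line_Cn p w t i = p i + of_real t * (w i - p i)"

lemma coord_line_diff: "coord a (line_Cn p w t) = coord a p + t * (coord a w - coord a p)"
  by (simp add: coord_def line_Cn_def algebra_simps)

lemma line_Cn_Cn: "p \<in> Cn N \<Longrightarrow> w \<in> Cn N \<Longrightarrow> line_Cn p w t \<in> Cn N"
  by (simp add: Cn_def line_Cn_def)

lemma line_Cn_coord_box:
  assumes "p \<in> Cn N" "w \<in> coord_box N p r" "t \<in> {0..1}"
  shows "line_Cn p w t \<in> coord_box N p r"
proof -
  have "\<bar>t * (coord a w - coord a p)\<bar> < r" if "a \<in> coords N" for a
  proof -
    have "\<bar>t * (coord a w - coord a p)\<bar> \<le> 1 * \<bar>coord a w - coord a p\<bar>"
      using assms(3) by (simp only: abs_mult) (intro mult_right_mono, auto)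
    also have "\<dots> < r" using assms(2) that by (simp add: coord_box_def)
    finally show ?thesis .
  qed
  then show ?thesis using assms line_Cn_Cn by (simp add: coord_box_def coord_line_diff)
qed

lemma C1_line_derivative:
  assumes U: "openin (Cspace N) U"
    and pd: "\<forall>a\<in>coords N. \<forall>w\<in>U. has_pd (fst a) (snd a) f (g a w) w"
    and g: "\<forall>a\<in>coords N. continuous_on U (g a)"
    and p: "p \<in> Cn N" "w \<in> Cn N" "line_Cn p w s \<in> U"
  shows "((\<lambda>t. f (line_Cn p w t)) has_real_derivative
    (\<Sum>a\<in>coords N. g a (line_Cn p w s) * (coord a w - coord a p))) (at s)"
  unfolding has_field_derivative_def has_derivative_at_alt
proof (intro conjI allI impI)
  let ?v = "\<lambda>a. coord a w - coord a p"
  let ?D = "\<Sum>a\<in>coords N. g a (line_Cn p w s) * ?v a"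
  \<comment> \<open>The summand 1 keeps the divisor positive when \<open>w\<close> and
    \<open>p\<close> agree.\<close>
  let ?V = "1 + (\<Sum>a\<in>coords N. \<bar>?v a\<bar>)"
  have V: "?V \<ge> 1" by (simp add: sum_nonneg)
  then have V0: "?V > 0" by linarith
  show "bounded_linear ((*) ?D)" by (rule bounded_linear_mult_right)
  fix e :: real assume e: "e > 0"
  then have "e / ?V > 0" using V0 by (rule divide_pos_pos)
  from C1_expansion[OF U p(3) this pd g]
  obtain r where r: "r > 0"
    and E: "\<forall>q\<in>coord_box N (line_Cn p w s) r. \<forall>w'\<in>coord_box N (line_Cn p w s) r.
      \<bar>f w' - f q - (\<Sum>a\<in>coords N. g a (line_Cn p w s) * (coord a w' - coord a q))\<bar>
        \<le> e / ?V * (\<Sum>a\<in>coords N. \<bar>coord a w' - coord a q\<bar>)"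
    by (elim exE conjE)
  have df: "coord a (line_Cn p w t) - coord a (line_Cn p w s) = (t - s) * ?v a" for a t
    by (simp add: coord_line_diff algebra_simps)
  show "\<exists>d>0. \<forall>t. norm (t - s) < d \<longrightarrow>
      norm (f (line_Cn p w t) - f (line_Cn p w s) - ?D * (t - s)) \<le> e * norm (t - s)"
  proof (intro exI conjI allI impI)
    show "r / ?V > 0" using r V0 by (rule divide_pos_pos)
    fix t assume t: "norm (t - s) < r / ?V"
    have in_box: "line_Cn p w t \<in> coord_box N (line_Cn p w s) r" if "\<bar>t - s\<bar> < r / ?V" for t
    proof -
      have "\<bar>(t - s) * ?v a\<bar> < r" if a: "a \<in> coords N" for a
      proof -
        have "\<bar>?v a\<bar> \<le> ?V" using member_le_sum[OF a, of "\<lambda>a. \<bar>?v a\<bar>"] by simp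
        then have "\<bar>(t - s) * ?v a\<bar> \<le> \<bar>t - s\<bar> * ?V" by (simp only: abs_mult) (intro mult_left_mono, auto)
        also have "\<dots> < r" using \<open>\<bar>t - s\<bar> < r / ?V\<close> V by (simp add: pos_less_divide_eq)
        finally show ?thesis .
      qed
      then show ?thesis using line_Cn_Cn[OF p(1,2)] by (simp add: coord_box_def df)
    qed
    have "\<bar>f (line_Cn p w t) - f (line_Cn p w s) - (\<Sum>a\<in>coords N. g a (line_Cn p w s) * ((t - s) * ?v a))\<bar>
        \<le> e / ?V * (\<Sum>a\<in>coords N. \<bar>(t - s) * ?v a\<bar>)"
      unfolding df[symmetric] using t r V0 by (intro E[rule_format] in_box) auto
    also have "\<dots> = e / ?V * (\<bar>t - s\<bar> * (\<Sum>a\<in>coords N. \<bar>?v a\<bar>))"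
      by (simp add: abs_mult sum_distrib_left)
    also have "\<dots> \<le> e / ?V * (\<bar>t - s\<bar> * ?V)"
      using e V by (intro mult_left_mono) (auto intro: divide_nonneg_nonneg)
    also have "\<dots> = e * \<bar>t - s\<bar>" using V0 by (simp only: mult.left_commute[of _ _ "?V"] times_divide_eq_left) (simp add: field_simps)
    finally show "norm (f (line_Cn p w t) - f (line_Cn p w s) - ?D * (t - s)) \<le> e * norm (t - s)"
      by (simp add: sum_distrib_left mult_ac)
  qed
qed


text \<open>Along the segment from \<open>p\<close> to \<open>w\<close>, the derivative of the
  remainder pairs \<open>w - p\<close> with the remainder of the first order expansion of the
  gradient. With \<open>V\<close> the sum of the coordinate differences, each component of the
  latter is at most \<open>e * V\<close>, so the mean value inequality gives
  \<open>e * V^2\<close>.\<close>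

lemma Ck_2_expansion:
  assumes U: "openin (Cspace N) U" and f: "Ck_on N 2 U f" and p: "p \<in> U" and e: "e > 0"
  shows "\<exists>r>0. coord_box N p r \<subseteq> U \<and> (\<forall>w\<in>coord_box N p r.
    \<bar>f w - (f p + (\<Sum>a\<in>coords N. partial_deriv (fst a) (snd a) f p * (coord a w - coord a p))
      + 1/2 * (\<Sum>a\<in>coords N. \<Sum>b\<in>coords N.
          partial_deriv (fst b) (snd b) (partial_deriv (fst a) (snd a) f) p *
            ((coord a w - coord a p) * (coord b w - coord b p))))\<bar>
    \<le> e * (\<Sum>a\<in>coords N. \<bar>coord a w - coord a p\<bar>)\<^sup>2)"
proof -
  note f' = f[unfolded numeral_2_eq_2]
  define g where "g a = partial_deriv (fst a) (snd a) f" for a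
  define h where "h a b = partial_deriv (fst b) (snd b) (g a)" for a b
  have pC: "p \<in> Cn N" using p openin_Cspace_subset[OF U] by blast
  have C1: "Ck_on N (Suc 0) U (g a)" and pd_f: "\<And>w. w \<in> U \<Longrightarrow> has_pd (fst a) (snd a) f (g a w) w"
    if "a \<in> coords N" for a
    using that by (auto elim!: coordsE simp: g_def intro!: Ck_on_SucD[OF U f'])
  have g_cont: "\<forall>a\<in>coords N. continuous_on U (g a)"
    using C1 Ck_on_continuous[OF U] by blast
  have h_cont: "continuous_on U (h a b)" and pd_g: "\<And>w. w \<in> U \<Longrightarrow> has_pd (fst b) (snd b) (g a) (h a b w) w"
    if "a \<in> coords N" "b \<in> coords N" for a b
    using that(2) Ck_on_SucD[OF U C1[OF that(1)]]
    by (auto elim!: coordsE simp: h_def intro!: Ck_on_continuous[OF U, of 0])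
  define P where "P a r \<longleftrightarrow> r > 0 \<and> coord_box N p r \<subseteq> U \<and> (\<forall>q\<in>coord_box N p r. \<forall>w\<in>coord_box N p r.
      \<bar>g a w - g a q - (\<Sum>b\<in>coords N. h a b p * (coord b w - coord b q))\<bar>
        \<le> e * (\<Sum>b\<in>coords N. \<bar>coord b w - coord b q\<bar>))" for a r
  have "\<exists>r. P a r" if "a \<in> coords N" for a
    unfolding P_def by (rule C1_expansion[OF U p e]) (use pd_g h_cont that in blast)+
  then obtain R where PR: "\<And>a. a \<in> coords N \<Longrightarrow> P a (R a)" by metis
  then have R: "\<And>a. a \<in> coords N \<Longrightarrow> R a > 0"
    and E: "\<And>a q w. a \<in> coords N \<Longrightarrow> q \<in> coord_box N p (R a) \<Longrightarrow> w \<in> coord_box N p (R a) \<Longrightarrow>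
      \<bar>g a w - g a q - (\<Sum>b\<in>coords N. h a b p * (coord b w - coord b q))\<bar>
        \<le> e * (\<Sum>b\<in>coords N. \<bar>coord b w - coord b q\<bar>)" by (simp_all add: P_def)
  obtain r0 where r0: "r0 > 0" "coord_box N p r0 \<subseteq> U" using coord_box_subset_openin[OF U p] by blast
  define r where "r = Min (insert r0 (R ` coords N))"
  have r: "r > 0" "r \<le> r0" "\<And>a. a \<in> coords N \<Longrightarrow> r \<le> R a"
    using R r0 by (auto simp: r_def)
  have sub: "coord_box N p r \<subseteq> U" using coord_box_mono[OF r(2)] r0(2) by blast
  have pb: "p \<in> coord_box N p s" if "s > 0" for s using pC that by (simp add: coord_box_def)
  have "\<bar>f w - (f p + (\<Sum>a\<in>coords N. g a p * (coord a w - coord a p))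
      + 1/2 * (\<Sum>a\<in>coords N. \<Sum>b\<in>coords N. h a b p * ((coord a w - coord a p) * (coord b w - coord b p))))\<bar>
    \<le> e * (\<Sum>a\<in>coords N. \<bar>coord a w - coord a p\<bar>)\<^sup>2" if w: "w \<in> coord_box N p r" for w
  proof -
    define v where "v a = coord a w - coord a p" for a
    define l where "l = (\<Sum>a\<in>coords N. g a p * v a)"
    define Q where "Q = (\<Sum>a\<in>coords N. \<Sum>b\<in>coords N. h a b p * (v a * v b))"
    define V where "V = (\<Sum>a\<in>coords N. \<bar>v a\<bar>)"
    have V: "V \<ge> 0" by (simp add: V_def sum_nonneg)
    have wC: "w \<in> Cn N" using w by (simp add: coord_box_def)
    define F where "F t = f (line_Cn p w t) - (t * l + t\<^sup>2 / 2 * Q)" for t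
    define F' where "F' t = (\<Sum>a\<in>coords N. g a (line_Cn p w t) * v a) - (l + t * Q)" for t
    have lin: "line_Cn p w t \<in> coord_box N p r" if "t \<in> {0..1}" for t
      by (rule line_Cn_coord_box[OF pC w that])
    have bound: "norm (F 1 - F 0) \<le> e * V\<^sup>2 * norm (1 - 0 :: real)"
    proof (rule field_differentiable_bound[of "{0..1}" F F'])
      fix t :: real assume t: "t \<in> {0..1}"
      have "((\<lambda>t. f (line_Cn p w t)) has_real_derivative
          (\<Sum>a\<in>coords N. g a (line_Cn p w t) * (coord a w - coord a p))) (at t)"
        by (rule C1_line_derivative[OF U _ g_cont pC wC]) (use pd_f lin[OF t] sub in blast)+
      then have "((\<lambda>t. f (line_Cn p w t)) has_real_derivative
          (\<Sum>a\<in>coords N. g a (line_Cn p w t) * v a)) (at t within {0..1})"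
        unfolding v_def by (rule has_field_derivative_at_within)
      moreover have "((\<lambda>t. t * l + t\<^sup>2 / 2 * Q) has_real_derivative l + t * Q) (at t within {0..1})"
        by (auto intro!: derivative_eq_intros)
      ultimately show "(F has_real_derivative F' t) (at t within {0..1})"
        unfolding F_def[abs_def] F'_def by (rule DERIV_diff)
      have "\<bar>g a (line_Cn p w t) - g a p - t * (\<Sum>b\<in>coords N. h a b p * v b)\<bar> \<le> e * V"
        if a: "a \<in> coords N" for a
      proof -
        have "\<bar>g a (line_Cn p w t) - g a p - (\<Sum>b\<in>coords N. h a b p * (coord b (line_Cn p w t) - coord b p))\<bar>
          \<le> e * (\<Sum>b\<in>coords N. \<bar>coord b (line_Cn p w t) - coord b p\<bar>)"
          using lin[OF t] coord_box_mono[OF r(3)[OF a]] by (intro E a pb R) blast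
        also have "(\<Sum>b\<in>coords N. \<bar>coord b (line_Cn p w t) - coord b p\<bar>) = t * V"
          using t by (simp add: coord_line_diff V_def v_def abs_mult sum_distrib_left)
        also have "e * (t * V) \<le> e * (1 * V)"
          using t e V by (intro mult_left_mono mult_right_mono) auto
        also have "(\<Sum>b\<in>coords N. h a b p * (coord b (line_Cn p w t) - coord b p))
            = t * (\<Sum>b\<in>coords N. h a b p * v b)"
          by (simp add: coord_line_diff v_def sum_distrib_left mult_ac)
        finally show ?thesis by simp
      qed
      then have "\<bar>(g a (line_Cn p w t) - g a p - t * (\<Sum>b\<in>coords N. h a b p * v b)) * v a\<bar> \<le> e * V * \<bar>v a\<bar>"
        if "a \<in> coords N" for a
        using that by (simp only: abs_mult) (intro mult_right_mono, auto)
      then have "\<bar>\<Sum>a\<in>coords N. (g a (line_Cn p w t) - g a p - t * (\<Sum>b\<in>coords N. h a b p * v b)) * v a\<bar>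
          \<le> (\<Sum>a\<in>coords N. e * V * \<bar>v a\<bar>)"
        by (intro order_trans[OF sum_abs] sum_mono)
      also have "\<dots> = e * V\<^sup>2" by (simp add: sum_distrib_left[symmetric] V_def power2_eq_square)
      also have "(\<Sum>a\<in>coords N. (g a (line_Cn p w t) - g a p - t * (\<Sum>b\<in>coords N. h a b p * v b)) * v a) = F' t"
        by (simp add: F'_def l_def Q_def left_diff_distrib right_diff_distrib sum_subtractf sum_distrib_left sum_distrib_right mult_ac)
      finally show "norm (F' t) \<le> e * V\<^sup>2" by simp
    qed auto
    have "line_Cn p w 0 = p" "line_Cn p w 1 = w" by (simp_all add: line_Cn_def fun_eq_iff)
    then have "F 1 - F 0 = f w - (f p + l + 1/2 * Q)" by (simp add: F_def)
    then show ?thesis using bound by (simp add: l_def Q_def V_def v_def)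
  qed
  then show ?thesis using r(1) sub unfolding g_def h_def by blast
qed

text \<open>Cauchy-Schwarz over the \<open>2 * N\<close> real coordinates.\<close>

lemma sum_abs_coord_sq:
  "(\<Sum>a\<in>coords N. \<bar>coord a w - coord a p\<bar>)\<^sup>2 \<le> 2 * real N * dist_sq N p w"
proof -
  have "(\<Sum>a\<in>coords N. \<bar>coord a w - coord a p\<bar>)\<^sup>2
      \<le> real (card (coords N)) * (\<Sum>a\<in>coords N. \<bar>coord a w - coord a p\<bar>\<^sup>2)"
    using sum_squared_le_sum_of_squares[of "\<lambda>a. \<bar>coord a w - coord a p\<bar>" "coords N"] by (simp add: mult.commute)
  also have "(\<Sum>a\<in>coords N. \<bar>coord a w - coord a p\<bar>\<^sup>2) = dist_sq N p w"
    by (simp add: sum_coords dist_sq_def cmod_power2)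
  also have "card (coords N) = 2 * N"
    by (simp add: coords_def card_cartesian_product)
  finally show ?thesis by simp
qed


section \<open>Test functions\<close>

definition form :: "nat \<Rightarrow> (nat \<Rightarrow> nat \<Rightarrow> complex) \<Rightarrow> (nat \<Rightarrow> complex) \<Rightarrow> real" where
  "form N M v = Re (\<Sum>i<N. \<Sum>j<N. M i j * v i * cnj (v j))"

lemma form_cong: "(\<And>i j. i < N \<Longrightarrow> j < N \<Longrightarrow> M i j = M' i j) \<Longrightarrow> form N M v = form N M' v"
  unfolding form_def by (intro arg_cong[where f = Re] sum.cong refl) simp

lemma form_add: "form N (\<lambda>i j. M i j + M' i j) v = form N M v + form N M' v"
  by (simp add: form_def distrib_right sum.distrib)

lemma form_cmult: "form N (\<lambda>i j. of_real a * M i j) v = a * form N M v"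
proof -
  have "(\<Sum>i<N. \<Sum>j<N. of_real a * M i j * v i * cnj (v j))
      = of_real a * (\<Sum>i<N. \<Sum>j<N. M i j * v i * cnj (v j))"
    by (simp add: sum_distrib_left mult_ac)
  then show ?thesis unfolding form_def by (simp only: Re_complex_of_real Im_complex_of_real times_complex.sel)
qed

lemma form_id: "form N (\<lambda>i j. if i = j then 1 else 0) v = (\<Sum>i<N. (cmod (v i))\<^sup>2)"
proof -
  have "(\<Sum>j<N. (if i = j then 1 else 0) * v i * cnj (v j)) = of_real ((cmod (v i))\<^sup>2)" if "i < N" for i
  proof -
    have "(\<Sum>j<N. (if i = j then 1 else 0) * v i * cnj (v j)) = (\<Sum>j<N. if i = j then v i * cnj (v j) else 0)"
      by (intro sum.cong refl) simp
    also have "\<dots> = v i * cnj (v i)" using that by (simp add: sum.delta')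
    finally show ?thesis by (simp only: complex_norm_square)
  qed
  then have "(\<Sum>i<N. \<Sum>j<N. (if i = j then 1 else 0) * v i * cnj (v j)) = (\<Sum>i<N. of_real ((cmod (v i))\<^sup>2))"
    by (intro sum.cong refl) simp
  then show ?thesis unfolding form_def by simp
qed

text \<open>The real part of the form sees only the Hermitian part of \<open>M\<close>. Hence
  symmetrising a real Hessian does not affect the positivity of the Levi form.\<close>

lemma form_cnj_transpose: "form N (\<lambda>i j. cnj (M j i)) v = form N M v"
proof -
  have "(\<Sum>i<N. \<Sum>j<N. cnj (M j i) * v i * cnj (v j)) = (\<Sum>j<N. \<Sum>i<N. cnj (M j i) * v i * cnj (v j))"
    by (rule sum.swap)
  also have "\<dots> = cnj (\<Sum>j<N. \<Sum>i<N. M j i * v j * cnj (v i))"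
    unfolding cnj_sum by (intro sum.cong refl) simp
  finally show ?thesis by (simp only: form_def cnj.simps)
qed

text \<open>Minimum over the unit sphere, extended by homogeneity of degree 2. Intersecting with
  \<open>box_Cn\<close> sets the coordinates from \<open>N\<close> on to 0; left free, they would
  destroy compactness.\<close>

lemma positive_form_bound:
  assumes pos: "\<And>v. \<exists>j<N. v j \<noteq> 0 \<Longrightarrow> form N M v > 0"
  shows "\<exists>c>0. \<forall>v. c * (\<Sum>i<N. (cmod (v i))\<^sup>2) \<le> form N M v"
proof -
  let ?n = "\<lambda>v :: nat \<Rightarrow> complex. \<Sum>i<N. (cmod (v i))\<^sup>2"
  define S where "S = box_Cn N (\<lambda>_. 0) 1 \<inter> {v. ?n v = 1}"
  have cont: "continuous_on UNIV (form N M)" "continuous_on UNIV ?n"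
    unfolding form_def by (intro continuous_intros continuous_on_product_coordinates)+
  have "closed {v. ?n v = 1}"
    by (rule closed_Collect_eq[OF cont(2) continuous_on_const])
  moreover have "compact (box_Cn N (\<lambda>_. 0) 1)" by (rule compact_box_Cn) (simp add: Cn_def)
  ultimately have S: "compact S" unfolding S_def by (rule compact_Int_closed[rotated])
  have "\<exists>c>0. \<forall>v\<in>S. c \<le> form N M v"
  proof (cases "S = {}")
    \<comment> \<open>This occurs for \<open>N = 0\<close>.\<close>
    case True
    then show ?thesis by (intro exI[of _ 1]) simp
  next
    case False
    obtain v0 where v0: "v0 \<in> S" "\<forall>v\<in>S. form N M v0 \<le> form N M v"
      using continuous_attains_inf[OF S False continuous_on_subset[OF cont(1)]] by auto
    have "\<exists>j<N. v0 j \<noteq> 0"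
    proof (rule ccontr)
      assume "\<not> (\<exists>j<N. v0 j \<noteq> 0)"
      then have "?n v0 = 0" by simp
      then show False using v0(1) by (simp add: S_def)
    qed
    then show ?thesis using pos v0(2) by blast
  qed
  then obtain c where c: "c > 0" "\<And>v. v \<in> S \<Longrightarrow> c \<le> form N M v" by blast
  have "c * ?n v \<le> form N M v" for v
  proof (cases "?n v = 0")
    case True
    then have "v i = 0" if "i < N" for i
      using that by (subst (asm) sum_nonneg_eq_0_iff) auto
    then have "form N M v = 0" by (simp add: form_def)
    then show ?thesis using True by simp
  next
    case False
    then have n0: "?n v > 0" by (simp add: sum_nonneg less_le)
    define s where "s = sqrt (?n v)"
    have s: "s > 0" "s\<^sup>2 = ?n v" using n0 by (simp_all add: s_def)
    define u where "u i = (if i < N then v i / of_real s else 0)" for i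
    have nu: "?n u = 1"
    proof -
      have "?n u = (\<Sum>i<N. (cmod (v i))\<^sup>2 / s\<^sup>2)"
        using s(1) by (intro sum.cong refl) (simp add: u_def norm_divide power_divide)
      also have "\<dots> = ?n v / s\<^sup>2" by (simp add: sum_divide_distrib)
      finally show ?thesis using s n0 by simp
    qed
    have "cmod (u i) \<le> 1" if "i < N" for i
    proof -
      have "(cmod (u i))\<^sup>2 \<le> ?n u" using that by (intro member_le_sum) auto
      then show ?thesis unfolding nu by (simp add: power2_le_iff_abs_le abs_square_le_1)
    qed
    then have "u \<in> S" using nu by (simp add: S_def box_Cn_def Cn_def u_def)
    have "form N M v = s\<^sup>2 * form N M u"
    proof -
      have "(\<Sum>i<N. \<Sum>j<N. M i j * v i * cnj (v j)) = of_real (s\<^sup>2) * (\<Sum>i<N. \<Sum>j<N. M i j * u i * cnj (u j))"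
        unfolding sum_distrib_left using s(1) by (intro sum.cong refl) (simp add: u_def power2_eq_square field_simps)
      then show ?thesis unfolding form_def by (simp only: Re_complex_of_real Im_complex_of_real times_complex.sel)
    qed
    then show ?thesis using c(2)[OF \<open>u \<in> S\<close>] s(2) n0 by (simp add: mult.commute mult_left_mono)
  qed
  then show ?thesis using c(1) by blast
qed

text \<open>The uniform bound makes the class stable under
  subtraction of small multiples of \<open>dist_sq\<close>; the Hermitian condition is automatic by Schwarz'
  theorem, of which it spares us a proof.\<close>

definition test_function :: "nat \<Rightarrow> ((nat \<Rightarrow> complex) \<Rightarrow> real) \<Rightarrow> bool" where
  "test_function N \<phi> \<longleftrightarrow> (\<forall>k. Ck_on N k (Cn N) \<phi>) \<and>
     (\<forall>z\<in>Cn N. \<forall>i<N. \<forall>j<N. levi_coeff \<phi> z j i = cnj (levi_coeff \<phi> z i j)) \<and>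
     (\<exists>c>0. \<forall>z\<in>Cn N. \<forall>v. c * (\<Sum>i<N. (cmod (v i))\<^sup>2) \<le> form N (levi_coeff \<phi> z) v)"

lemma test_functionI:
  assumes "\<And>k. Ck_on N k (Cn N) \<phi>"
    and "\<And>z i j. z \<in> Cn N \<Longrightarrow> i < N \<Longrightarrow> j < N \<Longrightarrow> levi_coeff \<phi> z j i = cnj (levi_coeff \<phi> z i j)"
    and "c > 0" "\<And>z v. z \<in> Cn N \<Longrightarrow> c * (\<Sum>i<N. (cmod (v i))\<^sup>2) \<le> form N (levi_coeff \<phi> z) v"
  shows "test_function N \<phi>"
  unfolding test_function_def
proof (intro conjI ballI allI impI exI)
  show "c > 0" by fact
qed (rule assms(1,2,4); assumption)+

lemma test_functionD:
  assumes "test_function N \<phi>"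
  shows "Ck_on N k (Cn N) \<phi>"
    and "z \<in> Cn N \<Longrightarrow> i < N \<Longrightarrow> j < N \<Longrightarrow> levi_coeff \<phi> z j i = cnj (levi_coeff \<phi> z i j)"
  using assms unfolding test_function_def by blast+

lemma test_function_cmult:
  assumes "test_function N \<phi>" "a > 0"
  shows "test_function N (\<lambda>w. a * \<phi> w)"
proof -
  obtain c where c: "c > 0" "\<And>z v. z \<in> Cn N \<Longrightarrow> c * (\<Sum>i<N. (cmod (v i))\<^sup>2) \<le> form N (levi_coeff \<phi> z) v"
    using assms(1) unfolding test_function_def by blast
  have Ck: "Ck_on N k (Cn N) \<phi>" for k by (rule test_functionD(1)[OF assms(1)])
  have L: "levi_coeff (\<lambda>w. a * \<phi> w) z i j = of_real a * levi_coeff \<phi> z i j"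
    if "z \<in> Cn N" "i < N" "j < N" for z i j
    by (rule levi_coeff_cmult[OF openin_Cspace_Cn Ck that])
  have "a * c * (\<Sum>i<N. (cmod (v i))\<^sup>2) \<le> form N (levi_coeff (\<lambda>w. a * \<phi> w) z) v" if z: "z \<in> Cn N" for z v
  proof -
    have "form N (levi_coeff (\<lambda>w. a * \<phi> w) z) v = a * form N (levi_coeff \<phi> z) v"
      unfolding form_cmult[symmetric] by (rule form_cong) (rule L[OF z])
    then show ?thesis using c(2)[OF z, of v] assms(2) by (simp add: mult.assoc)
  qed
  moreover have "levi_coeff (\<lambda>w. a * \<phi> w) z j i = cnj (levi_coeff (\<lambda>w. a * \<phi> w) z i j)"
    if "z \<in> Cn N" "i < N" "j < N" for z i j
    unfolding L[OF that] L[OF that(1,3,2)] test_functionD(2)[OF assms(1) that] by simp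
  moreover have "a * c > 0" using assms(2) c(1) by simp
  ultimately show ?thesis
    using Ck_on_cmult[OF openin_Cspace_Cn Ck] by (intro test_functionI)
qed

lemma test_function_perturb:
  assumes "test_function N \<phi>"
  shows "\<exists>e>0. test_function N (\<lambda>w. \<phi> w + - e * dist_sq N p w)"
proof -
  obtain c where c: "c > 0" "\<And>z v. z \<in> Cn N \<Longrightarrow> c * (\<Sum>i<N. (cmod (v i))\<^sup>2) \<le> form N (levi_coeff \<phi> z) v"
    using assms unfolding test_function_def by blast
  have Ck: "Ck_on N k (Cn N) \<phi>" for k by (rule test_functionD(1)[OF assms])
  have Ckd: "Ck_on N k (Cn N) (\<lambda>w. a * dist_sq N p w)" for k a
    by (intro Ck_on_cmult Ck_on_dist_sq openin_Cspace_Cn)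
  \<comment> \<open>The complex Hessian of \<open>dist_sq\<close> is the identity, so half of the
    lower bound \<open>c\<close> survives.\<close>
  let ?e = "c / 2" and ?I = "\<lambda>i j :: nat. if i = j then 1 else 0 :: complex"
  have L: "levi_coeff (\<lambda>w. \<phi> w + - ?e * dist_sq N p w) z i j
      = levi_coeff \<phi> z i j + of_real (- ?e) * ?I i j"
    if "z \<in> Cn N" "i < N" "j < N" for z i j
    unfolding levi_coeff_add[OF openin_Cspace_Cn Ck Ckd that]
      levi_coeff_cmult[OF openin_Cspace_Cn Ck_on_dist_sq[OF openin_Cspace_Cn] that] levi_coeff_dist_sq[OF that] ..
  have "c / 2 * (\<Sum>i<N. (cmod (v i))\<^sup>2) \<le> form N (levi_coeff (\<lambda>w. \<phi> w + - ?e * dist_sq N p w) z) v"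
    if z: "z \<in> Cn N" for z v
  proof -
    have "form N (levi_coeff (\<lambda>w. \<phi> w + - ?e * dist_sq N p w) z) v
        = form N (\<lambda>i j. levi_coeff \<phi> z i j + of_real (- ?e) * ?I i j) v"
      by (rule form_cong) (rule L[OF z])
    also have "\<dots> = form N (levi_coeff \<phi> z) v + - ?e * (\<Sum>i<N. (cmod (v i))\<^sup>2)"
      unfolding form_add form_cmult form_id ..
    finally show ?thesis using c(2)[OF z, of v] by simp
  qed
  moreover have "levi_coeff (\<lambda>w. \<phi> w + - ?e * dist_sq N p w) z j i
      = cnj (levi_coeff (\<lambda>w. \<phi> w + - ?e * dist_sq N p w) z i j)" if "z \<in> Cn N" "i < N" "j < N" for z i j
    unfolding L[OF that] L[OF that(1,3,2)] test_functionD(2)[OF assms that] by simp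
  moreover have "?e > 0" using c(1) by simp
  ultimately have "test_function N (\<lambda>w. \<phi> w + - ?e * dist_sq N p w)"
    using Ck_on_add[OF openin_Cspace_Cn Ck Ckd] by (intro test_functionI)
  then show ?thesis using c(1) by (intro exI[of _ ?e]) simp
qed

text \<open>The Levi coefficients are constant in the point, so positivity at \<open>p\<close>, made
  uniform in \<open>v\<close> by compactness, spreads to all of \<open>Cn N\<close>.\<close>

lemma test_function_quad:
  assumes sym: "\<And>a b. h a b = h b a"
    and pos: "\<And>v. \<exists>j<N. v j \<noteq> 0 \<Longrightarrow> form N (levi_coeff (quad N p k l h) p) v > 0" and p: "p \<in> Cn N"
  shows "test_function N (quad N p k l h)"
proof -
  note L = levi_coeff_quad[OF sym]
  obtain c where c: "c > 0" "\<And>v. c * (\<Sum>i<N. (cmod (v i))\<^sup>2) \<le> form N (levi_coeff (quad N p k l h) p) v"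
    using positive_form_bound[OF pos] by blast
  have eq: "form N (levi_coeff (quad N p k l h) z) v = form N (levi_coeff (quad N p k l h) p) v"
    if "z \<in> Cn N" for z v
    by (rule form_cong) (simp add: L that p)
  show ?thesis
  proof (rule test_functionI[OF Ck_on_quad[OF openin_Cspace_Cn] _ c(1)])
    show "levi_coeff (quad N p k l h) z j i = cnj (levi_coeff (quad N p k l h) z i j)"
      if "z \<in> Cn N" "i < N" "j < N" for z i j
      using that by (simp add: L sym[of "(_, j)" "(_, i)"] algebra_simps)
    show "c * (\<Sum>i<N. (cmod (v i))\<^sup>2) \<le> form N (levi_coeff (quad N p k l h) z) v" if "z \<in> Cn N" for z v
      unfolding eq[OF that] by (rule c(2))
  qed
qed

text \<open>Taylor's formula turns a \<open>C\<^sup>2\<close> function into a smooth one that touches it from below.\<close>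

lemma strictly_psh_minorant:
  assumes U: "openin (Cspace N) U" and f: "strictly_psh_Cn N U f" and p: "p \<in> U"
  shows "\<exists>\<phi> r. test_function N \<phi> \<and> r > 0 \<and> \<phi> p = f p \<and> coord_box N p r \<subseteq> U \<and>
    (\<forall>w\<in>coord_box N p r. \<phi> w \<le> f w)"
proof -
  have C2: "Ck_on N 2 U f" using f by (simp add: strictly_psh_Cn_def)
  have pC: "p \<in> Cn N" using p openin_Cspace_subset[OF U] by blast
  define l where "l a = partial_deriv (fst a) (snd a) f p" for a
  define H where "H a b = partial_deriv (fst b) (snd b) (partial_deriv (fst a) (snd a) f) p" for a b
  \<comment> \<open>Symmetrising changes neither the quadratic polynomial nor, as its Levi matrix
    becomes the Hermitian part of that of \<open>f\<close>, the real part of the Levi form.\<close>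
  define h where "h a b = (H a b + H b a) / 2" for a b
  let ?q = "quad N p (f p) l h"
  have sym: "h a b = h b a" for a b by (simp add: h_def add.commute)
  have levi_q: "levi_coeff ?q p i j = of_real (1/2) * (levi_coeff f p i j + cnj (levi_coeff f p j i))"
    if "i < N" "j < N" for i j
    unfolding levi_coeff_quad[OF sym pC that] levi_coeff_Ck[OF U C2 p that] levi_coeff_Ck[OF U C2 p that(2,1)]
    by (simp add: h_def H_def field_simps)
  have form_q: "form N (levi_coeff ?q p) v = form N (levi_coeff f p) v" for v
  proof -
    have "form N (levi_coeff ?q p) v
        = form N (\<lambda>i j. of_real (1/2) * (levi_coeff f p i j + cnj (levi_coeff f p j i))) v"
      by (rule form_cong) (rule levi_q)
    also have "\<dots> = 1/2 * (form N (levi_coeff f p) v + form N (levi_coeff f p) v)"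
      unfolding form_cmult form_add form_cnj_transpose ..
    finally show ?thesis by simp
  qed
  have "test_function N ?q"
  proof (rule test_function_quad[OF sym _ pC])
    show "form N (levi_coeff ?q p) v > 0" if "\<exists>j<N. v j \<noteq> 0" for v
      using f p that unfolding form_q by (simp add: strictly_psh_Cn_def form_def)
  qed
  then obtain e where e: "e > 0" "test_function N (\<lambda>w. ?q w + - e * dist_sq N p w)"
    using test_function_perturb by blast
  \<comment> \<open>The Taylor error is at most \<open>d * (2 * N) * dist_sq\<close>, which the
    subtracted \<open>e * dist_sq\<close> absorbs; the summand 1 covers
    \<open>N = 0\<close>.\<close>
  define d where "d = e / (2 * real N + 1)"
  have d: "d > 0" using e by (simp add: d_def)
  from Ck_2_expansion[OF U C2 p d]
  obtain r where r: "r > 0" "coord_box N p r \<subseteq> U" and E: "\<forall>w\<in>coord_box N p r.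
    \<bar>f w - (f p + (\<Sum>a\<in>coords N. l a * (coord a w - coord a p))
      + 1/2 * (\<Sum>a\<in>coords N. \<Sum>b\<in>coords N. H a b * ((coord a w - coord a p) * (coord b w - coord b p))))\<bar>
    \<le> d * (\<Sum>a\<in>coords N. \<bar>coord a w - coord a p\<bar>)\<^sup>2"
    unfolding l_def H_def by (elim exE conjE)
  have q: "?q w = f p + (\<Sum>a\<in>coords N. l a * (coord a w - coord a p))
      + 1/2 * (\<Sum>a\<in>coords N. \<Sum>b\<in>coords N. H a b * ((coord a w - coord a p) * (coord b w - coord b p)))" for w
  proof -
    let ?v = "\<lambda>a. coord a w - coord a p"
    have "(\<Sum>a\<in>coords N. \<Sum>b\<in>coords N. H b a * (?v a * ?v b)) = (\<Sum>b\<in>coords N. \<Sum>a\<in>coords N. H b a * (?v a * ?v b))"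
      by (rule sum.swap)
    also have "\<dots> = (\<Sum>a\<in>coords N. \<Sum>b\<in>coords N. H a b * (?v a * ?v b))"
      by (intro sum.cong refl) (simp add: mult.commute)
    finally have "(\<Sum>a\<in>coords N. \<Sum>b\<in>coords N. H b a * (?v a * ?v b))
        = (\<Sum>a\<in>coords N. \<Sum>b\<in>coords N. H a b * (?v a * ?v b))" .
    moreover have "(\<Sum>a\<in>coords N. \<Sum>b\<in>coords N. h a b * (?v a * ?v b))
      = ((\<Sum>a\<in>coords N. \<Sum>b\<in>coords N. H a b * (?v a * ?v b)) + (\<Sum>a\<in>coords N. \<Sum>b\<in>coords N. H b a * (?v a * ?v b))) / 2"
      by (simp only: h_def sum.distrib[symmetric] distrib_right[symmetric] sum_divide_distrib times_divide_eq_left)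
    ultimately show ?thesis by (simp add: quad_def)
  qed
  have "?q w + - e * dist_sq N p w \<le> f w" if w: "w \<in> coord_box N p r" for w
  proof -
    have "\<bar>f w - ?q w\<bar> \<le> d * (\<Sum>a\<in>coords N. \<bar>coord a w - coord a p\<bar>)\<^sup>2"
      unfolding q using E w by blast
    also have "\<dots> \<le> d * (2 * real N * dist_sq N p w)"
      using d by (intro mult_left_mono sum_abs_coord_sq) auto
    also have "\<dots> \<le> d * ((2 * real N + 1) * dist_sq N p w)"
      using d by (intro mult_left_mono mult_right_mono) (auto simp: dist_sq_def intro: sum_nonneg)
    also have "\<dots> = e * dist_sq N p w" by (simp add: d_def)
    finally show ?thesis by simp
  qed
  moreover have "?q p + - e * dist_sq N p p = f p" by (simp add: quad_def dist_sq_def)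
  ultimately show ?thesis using e(2) r by blast
qed

section \<open>Charts\<close>

lemma compactin_attains_max:
  assumes "compactin X K" "K \<noteq> {}" "continuous_map (subtopology X K) euclideanreal g"
  shows "\<exists>y\<in>K. \<forall>w\<in>K. g w \<le> g y"
proof -
  have "compactin (subtopology X K) K" using assms(1) by (simp add: compactin_subtopology)
  then have "compact (g ` K)"
    using image_compactin[OF _ assms(3)] by simp
  then obtain m where "m \<in> g ` K" "\<forall>t\<in>g ` K. t \<le> m"
    using compact_attains_sup[of "g ` K"] assms(2) by blast
  then show ?thesis by blast
qed

lemma continuous_map_norm_sq:
  assumes "continuous_map X euclidean f"
  shows "continuous_map X euclideanreal (\<lambda>y. (cmod (f y))\<^sup>2)"
proof -
  have "continuous_on UNIV (\<lambda>w. (cmod w)\<^sup>2)" by (intro continuous_intros)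
  then have "continuous_map X euclideanreal ((\<lambda>w. (cmod w)\<^sup>2) \<circ> f)"
    using assms by (intro continuous_map_compose[of _ euclidean]) simp_all
  then show ?thesis by (simp add: o_def)
qed

lemma continuous_map_restrict:
  "continuous_map (subtopology X S) Y f \<Longrightarrow> T \<subseteq> S \<Longrightarrow> continuous_map (subtopology X T) Y f"
  by (metis continuous_map_from_subtopology inf.absorb2 subtopology_subtopology)

lemma holomorphic_Cn_subset:
  assumes "holomorphic_Cn N U f" "V \<subseteq> U"
  shows "holomorphic_Cn N V f"
  using assms continuous_map_restrict[OF _ assms(2), of "Cspace N" euclidean f]
  unfolding holomorphic_Cn_def by blast

lemma local_model_isoD:
  assumes "local_model_iso X \<O> \<omega> N U Z z"
  shows "openin X \<omega>" "openin (Cspace N) U" "Z \<subseteq> U" "z ` \<omega> = Z" "inj_on z \<omega>"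
    "continuous_map (subtopology X \<omega>) (Cspace N) z"
    "homeomorphic_map (subtopology X \<omega>) (subtopology (Cspace N) Z) z" "analytic_subvariety N U Z"
    "openin X W \<Longrightarrow> W \<subseteq> \<omega> \<Longrightarrow> local_holomorphic N (z ` W) g \<longleftrightarrow> g \<circ> z \<in> \<O> W"
proof -
  show 1: "openin X \<omega>" "openin (Cspace N) U"
    and h: "homeomorphic_map (subtopology X \<omega>) (subtopology (Cspace N) Z) z" and a: "analytic_subvariety N U Z"
    and "openin X W \<Longrightarrow> W \<subseteq> \<omega> \<Longrightarrow> local_holomorphic N (z ` W) g \<longleftrightarrow> g \<circ> z \<in> \<O> W"
    using assms unfolding local_model_iso_def by blast+
  show 2: "Z \<subseteq> U" using a by (simp add: analytic_subvariety_def)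
  have ts: "topspace (subtopology X \<omega>) = \<omega>" "topspace (subtopology (Cspace N) Z) = Z"
    using openin_subset[OF 1(1)] openin_subset[OF 1(2)] 2 by auto
  show "z ` \<omega> = Z" using homeomorphic_imp_surjective_map[OF h] ts by simp
  show "inj_on z \<omega>" using homeomorphic_imp_injective_map[OF h] ts by simp
  show "continuous_map (subtopology X \<omega>) (Cspace N) z"
    using homeomorphic_imp_continuous_map[OF h] continuous_map_into_fulltopology by blast
qed

lemma openin_chart_preimage:
  assumes c: "local_model_iso X \<O> \<omega> N U Z z" and W: "openin (Cspace N) W"
  shows "openin X {x \<in> \<omega>. z x \<in> W}"
proof -
  note D = local_model_isoD[OF c]
  have "openin (subtopology X \<omega>) {x \<in> topspace (subtopology X \<omega>). z x \<in> W}"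
    by (rule openin_continuous_map_preimage[OF D(6) W])
  moreover have "topspace (subtopology X \<omega>) = \<omega>" using openin_subset[OF D(1)] by auto
  ultimately show ?thesis using openin_trans_full[OF _ D(1)] by (simp only:)
qed

lemma continuous_map_chart:
  assumes c: "local_model_iso X \<O> \<omega> N U Z z" and g: "continuous_on U g"
  shows "continuous_map (subtopology X \<omega>) euclidean (\<lambda>x. g (z x))"
proof -
  note D = local_model_isoD[OF c]
  have "continuous_map (subtopology X \<omega>) (subtopology (Cspace N) U) z"
    using D(3,4,6) by (auto simp: continuous_map_in_subtopology)
  moreover have "continuous_map (subtopology (Cspace N) U) euclidean g"
    using g by (simp add: continuous_map_Cspace_iff[OF D(2)])
  ultimately show ?thesis using continuous_map_compose[of _ _ z _ g] by (simp add: o_def)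
qed

text \<open>The definition of pseudoconvexity wants a function smooth on the entire ambient set of
  the chart. A local holomorphic extension exists only on a smaller set, so the chart is shrunk to
  it.\<close>

lemma local_model_iso_restrict:
  assumes c: "local_model_iso X \<O> \<omega> N U Z z" and W: "openin (Cspace N) W" "W \<subseteq> U"
  shows "local_model_iso X \<O> {x \<in> \<omega>. z x \<in> W} N W (Z \<inter> W) z"
  unfolding local_model_iso_def
proof (intro conjI allI impI)
  note D = local_model_isoD[OF c]
  let ?w = "{x \<in> \<omega>. z x \<in> W}"
  show "openin X ?w" by (rule openin_chart_preimage[OF c W(1)])
  show "openin (Cspace N) W" by fact
  show "analytic_subvariety N W (Z \<inter> W)"
    unfolding analytic_subvariety_def
  proof (intro conjI ballI)
    fix p assume p: "p \<in> W"
    from bspec[OF D(8)[unfolded analytic_subvariety_def, THEN conjunct2] subsetD[OF W(2) p]]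
    obtain W' F where F: "openin (Cspace N) W'" "p \<in> W'" "finite F" "\<forall>f\<in>F. holomorphic_Cn N W' f"
      "Z \<inter> W' = {z \<in> W'. \<forall>f\<in>F. f z = 0}"
      by (elim exE conjE)
    show "\<exists>W' F. openin (Cspace N) W' \<and> p \<in> W' \<and> W' \<subseteq> W \<and> finite F \<and>
        (\<forall>f\<in>F. holomorphic_Cn N W' f) \<and> Z \<inter> W \<inter> W' = {z \<in> W'. \<forall>f\<in>F. f z = 0}"
    proof (intro exI[of _ "W' \<inter> W"] exI[of _ F] conjI)
      show "openin (Cspace N) (W' \<inter> W)" using F(1) W(1) by (rule openin_Int)
      show "\<forall>f\<in>F. holomorphic_Cn N (W' \<inter> W) f" using F(4) holomorphic_Cn_subset by blast
      show "Z \<inter> W \<inter> (W' \<inter> W) = {z \<in> W' \<inter> W. \<forall>f\<in>F. f z = 0}" using F(5) by blast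
    qed (use F p in auto)
  qed auto
  have "topspace (subtopology X \<omega>) = \<omega>" using openin_subset[OF D(1)] by auto
  moreover have "topspace (subtopology (Cspace N) Z) = Z"
    using openin_subset[OF D(2)] D(3) by auto
  moreover have "z ` (\<omega> \<inter> ?w) = Z \<inter> (Z \<inter> W)" using D(4) by blast
  ultimately have "homeomorphic_map (subtopology (subtopology X \<omega>) ?w)
      (subtopology (subtopology (Cspace N) Z) (Z \<inter> W)) z"
    using homeomorphic_map_subtopologies[OF D(7), of ?w "Z \<inter> W"] by simp
  moreover have "\<omega> \<inter> ?w = ?w" "Z \<inter> (Z \<inter> W) = Z \<inter> W" by auto
  ultimately show "homeomorphic_map (subtopology X ?w) (subtopology (Cspace N) (Z \<inter> W)) z"
    by (simp only: subtopology_subtopology)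
  show "local_holomorphic N (z ` W') g \<longleftrightarrow> g \<circ> z \<in> \<O> W'" if "openin X W' \<and> W' \<subseteq> ?w" for W' g
    using D(9)[of W' g] that by blast
qed

text \<open>For \<open>q = 1\<close> the required number of positive eigenvalues is
  \<open>N - 1 + 1 = N\<close>, and a positive definite Hermitian matrix has all of them
  positive.\<close>

lemma set_pseudoconvex_atI:
  assumes c: "local_model_iso X \<O> \<omega> N U Z z" and x: "x \<in> \<omega>"
    and W: "openin (Cspace N) W" "W \<subseteq> U" "z x \<in> W"
    and smooth: "\<And>k. Ck_on N k W \<psi>"
    and herm: "\<And>i j. i < N \<Longrightarrow> j < N \<Longrightarrow> levi_coeff \<psi> (z x) j i = cnj (levi_coeff \<psi> (z x) i j)"
    and pos: "\<And>v. \<exists>j<N. v j \<noteq> 0 \<Longrightarrow> form N (levi_coeff \<psi> (z x)) v > 0"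
    and T: "openin X T" "x \<in> T" "\<And>y. y \<in> A \<inter> T \<Longrightarrow> y \<in> \<omega> \<Longrightarrow> z y \<in> W \<Longrightarrow> \<psi> (z y) \<le> \<psi> (z x)"
  shows "set_pseudoconvex_at X \<O> 1 A x"
  unfolding set_pseudoconvex_at_def
proof (intro exI conjI)
  let ?w = "{y \<in> \<omega>. z y \<in> W}"
  show "local_model_iso X \<O> ?w N W (Z \<inter> W) z" by (rule local_model_iso_restrict[OF c W(1,2)])
  show "x \<in> ?w" using x W(3) by simp
  show "smooth_on_Cn N W \<psi>" using smooth by (simp add: smooth_on_Cn_def)
  show "openin X (?w \<inter> T)" by (intro openin_Int openin_chart_preimage[OF c W(1)] T(1))
  show "x \<in> ?w \<inter> T" using x W(3) T(2) by simp
  show "?w \<inter> T \<subseteq> ?w" by simp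
  show "z ` (A \<inter> (?w \<inter> T)) \<subseteq> {w. \<psi> w \<le> \<psi> (z x)}" using T(3) by auto
  have "num_positive_eigenvalues (complex_hessian N \<psi> (z x)) = N"
  proof (rule num_positive_eigenvalues_positive_definite)
    show "complex_hessian N \<psi> (z x) \<in> carrier_mat N N" by (simp add: complex_hessian_def)
    show "complex_hessian N \<psi> (z x) $$ (j, i) = cnj (complex_hessian N \<psi> (z x) $$ (i, j))"
      if "i < N" "j < N" for i j
    proof -
      have "complex_hessian N \<psi> (z x) $$ (j, i) = levi_coeff \<psi> (z x) j i"
        "complex_hessian N \<psi> (z x) $$ (i, j) = levi_coeff \<psi> (z x) i j"
        using that by (simp_all add: complex_hessian_def)
      then show ?thesis by (simp only: herm[OF that])
    qed
    show "0 < Re (\<Sum>i<N. \<Sum>j<N. complex_hessian N \<psi> (z x) $$ (i, j) * v i * cnj (v j))"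
      if "\<exists>j<N. v j \<noteq> 0" for v
      using pos[OF that] by (simp add: form_def complex_hessian_def)
  qed
  then show "int N - 1 + 1 \<le> int (num_positive_eigenvalues (complex_hessian N \<psi> (z x)))" by simp
qed

section \<open>Touched functions\<close>

text \<open>Only values of \<open>f\<close> enter, so the notion applies to limits that are merely
  continuous.\<close>

definition touched ::
    "'a topology \<Rightarrow> ('a set \<Rightarrow> ('a \<Rightarrow> complex) set) \<Rightarrow> 'a set \<Rightarrow> ('a \<Rightarrow> complex) \<Rightarrow> 'a \<Rightarrow> bool" where
  "touched X \<O> A f x \<longleftrightarrow> (\<exists>\<omega> N U Z z \<phi> V. local_model_iso X \<O> \<omega> N U Z z \<and> test_function N \<phi> \<and>
     openin (subtopology X A) V \<and> x \<in> V \<and> V \<subseteq> \<omega> \<and>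
     (\<forall>y\<in>V. (cmod (f y))\<^sup>2 + \<phi> (z y) \<le> (cmod (f x))\<^sup>2 + \<phi> (z x)))"

text \<open>Makes being touched a property of germs.\<close>

lemma touched_cong:
  assumes V: "openin (subtopology X A) V" "x \<in> V" "\<And>y. y \<in> V \<Longrightarrow> f y = g y" and t: "touched X \<O> A f x"
  shows "touched X \<O> A g x"
proof -
  obtain \<omega> N U Z z \<phi> V' where *: "local_model_iso X \<O> \<omega> N U Z z" "test_function N \<phi>"
    "openin (subtopology X A) V'" "x \<in> V'" "V' \<subseteq> \<omega>"
    "\<forall>y\<in>V'. (cmod (f y))\<^sup>2 + \<phi> (z y) \<le> (cmod (f x))\<^sup>2 + \<phi> (z x)"
    using t unfolding touched_def by blast
  show ?thesis unfolding touched_def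
  proof (intro exI conjI)
    show "openin (subtopology X A) (V \<inter> V')" using V(1) *(3) by (rule openin_Int)
    show "\<forall>y\<in>V \<inter> V'. (cmod (g y))\<^sup>2 + \<phi> (z y) \<le> (cmod (g x))\<^sup>2 + \<phi> (z x)"
      using *(6) V(3)[OF V(2)] V(3) by (metis IntD1 IntD2)
  qed (use * V in auto)
qed

lemma section_in_chart:
  assumes sh: "function_sheaf X \<O>" and c: "local_model_iso X \<O> \<omega> N U Z z" and x: "x \<in> \<omega>"
    and W0: "openin X W0" "x \<in> W0" "h \<in> \<O> W0"
  obtains W F V where "openin (Cspace N) W" "W \<subseteq> U" "z x \<in> W" "holomorphic_Cn N W F"
    "openin X V" "x \<in> V" "V \<subseteq> \<omega>" "z ` V \<subseteq> W" "\<forall>y\<in>V. h y = F (z y)"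
proof -
  note D = local_model_isoD[OF c]
  define W1 where "W1 = W0 \<inter> \<omega>"
  have W1: "openin X W1" "x \<in> W1" "W1 \<subseteq> \<omega>" using W0 D(1) x by (auto simp: W1_def)
  define g where "g = h \<circ> inv_into \<omega> z"
  have gz: "g (z y) = h y" if "y \<in> \<omega>" for y
    using that D(5) by (simp add: g_def)
  have hW1: "h \<in> \<O> W1"
    using sh W0 W1(1) unfolding function_sheaf_def by (metis Int_lower1 W1_def subsetD)
  \<comment> \<open>\<open>g \<circ> z\<close> agrees with \<open>h\<close> on the chart only; the
    gluing axiom makes it a section nevertheless.\<close>
  have "g \<circ> z \<in> \<O> W1"
  proof -
    have "\<forall>y\<in>W1. \<exists>V k. openin X V \<and> y \<in> V \<and> V \<subseteq> W1 \<and> k \<in> \<O> V \<and> (\<forall>y\<in>V. (g \<circ> z) y = k y)"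
      using W1 hW1 gz by (intro ballI exI[of _ W1] exI[of _ h]) auto
    then show ?thesis using sh W1(1) unfolding function_sheaf_def by blast
  qed
  then have "local_holomorphic N (z ` W1) g" using D(9)[OF W1(1,3)] by simp
  then obtain W F where F: "openin (Cspace N) W" "z x \<in> W" "holomorphic_Cn N W F"
      "\<forall>w\<in>z ` W1 \<inter> W. g w = F w"
    unfolding local_holomorphic_def using W1(2) by blast
  have W2: "openin (Cspace N) (W \<inter> U)" using F(1) D(2) by (rule openin_Int)
  have zU: "z y \<in> U" if "y \<in> \<omega>" for y using D(3,4) that by blast
  show thesis
  proof (rule that[OF W2])
    show "holomorphic_Cn N (W \<inter> U) F" using F(3) by (rule holomorphic_Cn_subset) simp
    show "openin X (W1 \<inter> {y \<in> \<omega>. z y \<in> W})" by (intro openin_Int W1 openin_chart_preimage[OF c F(1)])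
    show "\<forall>y\<in>W1 \<inter> {y \<in> \<omega>. z y \<in> W}. h y = F (z y)"
    proof
      fix y assume "y \<in> W1 \<inter> {y \<in> \<omega>. z y \<in> W}"
      then show "h y = F (z y)" using F(4) gz[of y] by auto
    qed
  qed (use F(2) zU x W1 in auto)
qed

lemma section_continuous:
  assumes X: "reduced_complex_space X \<O>" and x: "x \<in> topspace X" and W0: "openin X W0" "x \<in> W0" "h \<in> \<O> W0"
  obtains V where "openin X V" "x \<in> V" "continuous_map (subtopology X V) euclidean h"
proof -
  obtain \<omega> N U Z z where x\<omega>: "x \<in> \<omega>" and c: "local_model_iso X \<O> \<omega> N U Z z"
    using X x unfolding reduced_complex_space_def by blast
  have "function_sheaf X \<O>" using X by (simp add: reduced_complex_space_def)
  from section_in_chart[OF this c x\<omega> W0] obtain W F V where W: "openin (Cspace N) W" "W \<subseteq> U" "z x \<in> W"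
    "holomorphic_Cn N W F" and V: "openin X V" "x \<in> V" "V \<subseteq> \<omega>" "z ` V \<subseteq> W" "\<forall>y\<in>V. h y = F (z y)" .
  have "continuous_map (subtopology X {y \<in> \<omega>. z y \<in> W}) euclidean (\<lambda>y. F (z y))"
    by (rule continuous_map_chart[OF local_model_iso_restrict[OF c W(1,2)] holomorphic_Cn_continuous[OF W(1,4)]])
  then have "continuous_map (subtopology X V) euclidean (\<lambda>y. F (z y))"
    by (rule continuous_map_restrict) (use V in auto)
  then have "continuous_map (subtopology X V) euclidean h"
    by (rule continuous_map_eq) (simp add: V(5))
  then show thesis using that V by blast
qed

text \<open>\<open>|h|\<^sup>2\<close> lies above its pluriharmonic tangent \<open>2 Re (cnj (h x) h) - |h x|\<^sup>2\<close>, with equality at \<open>x\<close>.\<close>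

lemma touched_holomorphic:
  assumes sh: "function_sheaf X \<O>" and t: "touched X \<O> A h x" and W0: "openin X W0" "x \<in> W0" "h \<in> \<O> W0"
  shows "set_pseudoconvex_at X \<O> 1 A x"
proof -
  obtain \<omega> N U Z z \<phi> V where c: "local_model_iso X \<O> \<omega> N U Z z" and \<phi>: "test_function N \<phi>"
    and V: "openin (subtopology X A) V" "x \<in> V" "V \<subseteq> \<omega>"
    and le: "\<And>y. y \<in> V \<Longrightarrow> (cmod (h y))\<^sup>2 + \<phi> (z y) \<le> (cmod (h x))\<^sup>2 + \<phi> (z x)"
    using t unfolding touched_def by blast
  have x: "x \<in> \<omega>" using V by blast
  from section_in_chart[OF sh c x W0] obtain W2 F W1 where W2: "openin (Cspace N) W2" "W2 \<subseteq> U" "z x \<in> W2"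
    and F2: "holomorphic_Cn N W2 F" and W1: "openin X W1" "x \<in> W1" "W1 \<subseteq> \<omega>" "z ` W1 \<subseteq> W2"
    and hF: "\<forall>y\<in>W1. h y = F (z y)" .
  define a where "a = 2 * cnj (h x)"
  let ?\<psi> = "\<lambda>w. Re (a * F w) + \<phi> w"
  have CkF: "Ck_on N k W2 (\<lambda>w. Re (a * F w))" for k by (rule Ck_on_Re_holomorphic[OF W2(1) F2])
  have W2C: "W2 \<subseteq> Cn N" by (rule openin_Cspace_subset[OF W2(1)])
  have Ck\<phi>: "Ck_on N k W2 \<phi>" for k
    by (rule Ck_on_subset[OF openin_Cspace_Cn W2(1) W2C test_functionD(1)[OF \<phi>]])
  have levi: "levi_coeff ?\<psi> (z x) i j = levi_coeff \<phi> (z x) i j" if "i < N" "j < N" for i j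
    unfolding levi_coeff_add[OF W2(1) CkF Ck\<phi> W2(3) that] levi_coeff_Re_holomorphic[OF W2(1) F2 W2(3) that]
    by simp
  obtain T where T: "openin X T" "V = A \<inter> T" using V(1) by (auto simp: openin_subtopology Int_commute)
  show ?thesis
  proof (rule set_pseudoconvex_atI[OF c x W2])
    show "Ck_on N k W2 ?\<psi>" for k by (rule Ck_on_add[OF W2(1) CkF Ck\<phi>])
    show "levi_coeff ?\<psi> (z x) j i = cnj (levi_coeff ?\<psi> (z x) i j)" if "i < N" "j < N" for i j
      unfolding levi[OF that] levi[OF that(2,1)] using test_functionD(2)[OF \<phi> _ that] W2(3) W2C by blast
    show "form N (levi_coeff ?\<psi> (z x)) v > 0" if v: "\<exists>j<N. v j \<noteq> 0" for v
    proof -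
      obtain k where k: "k > 0" "k * (\<Sum>i<N. (cmod (v i))\<^sup>2) \<le> form N (levi_coeff \<phi> (z x)) v"
        using \<phi> W2(3) W2C unfolding test_function_def by blast
      obtain j where j: "j < N" "v j \<noteq> 0" using v by blast
      have "(\<Sum>i<N. (cmod (v i))\<^sup>2) > 0"
        by (rule sum_pos2[of _ j]) (use j in auto)
      then have "form N (levi_coeff \<phi> (z x)) v > 0" using k by (smt (verit) mult_pos_pos)
      moreover have "form N (levi_coeff ?\<psi> (z x)) v = form N (levi_coeff \<phi> (z x)) v"
        by (rule form_cong) (rule levi)
      ultimately show ?thesis by simp
    qed
    show "openin X (T \<inter> W1)" using T(1) W1(1) by (rule openin_Int)
    show "x \<in> T \<inter> W1" using T(2) V(2) W1(2) by blast
    fix y assume y: "y \<in> A \<inter> (T \<inter> W1)" "y \<in> \<omega>" "z y \<in> W2"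
    have Fy: "F (z y) = h y" "F (z x) = h x" using hF y W1(2) by auto
    have "(cmod (h y - h x))\<^sup>2 = (cmod (h y))\<^sup>2 + (cmod (h x))\<^sup>2 - Re (a * h y)"
      unfolding cmod_power2 by (simp add: a_def power2_eq_square algebra_simps)
    then have "Re (a * h y) \<le> (cmod (h y))\<^sup>2 + (cmod (h x))\<^sup>2" by (smt (verit) zero_le_power2)
    moreover have "Re (a * h x) = 2 * (cmod (h x))\<^sup>2"
      unfolding cmod_power2 by (simp add: a_def power2_eq_square)
    moreover have "(cmod (h y))\<^sup>2 + \<phi> (z y) \<le> (cmod (h x))\<^sup>2 + \<phi> (z x)" using y T(2) by (intro le) blast
    ultimately show "?\<psi> (z y) \<le> ?\<psi> (z x)" unfolding Fy by linarith
  qed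
qed

text \<open>Near \<open>p\<close>, \<open>\<rho>\<close> is replaced by a test function below it
  that has the same value at \<open>p\<close>; this can only lower the competitors, so the maximum
  at \<open>p\<close> remains.\<close>

lemma touched_max:
  assumes psh: "strictly_psh_on_space X \<O> \<rho>" and A: "A \<subseteq> topspace X" and p: "p \<in> A" and e: "e > 0"
    and max: "\<And>y. y \<in> A \<Longrightarrow> (cmod (f y))\<^sup>2 + e * \<rho> y \<le> (cmod (f p))\<^sup>2 + e * \<rho> p"
  shows "touched X \<O> A f p"
proof -
  obtain \<omega> N U Z z \<sigma> where pw: "p \<in> \<omega>" and c: "local_model_iso X \<O> \<omega> N U Z z"
    and \<sigma>: "strictly_psh_Cn N U \<sigma>" "\<forall>x\<in>\<omega>. \<rho> x = \<sigma> (z x)"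
    using psh p A unfolding strictly_psh_on_space_def by (metis subsetD)
  note D = local_model_isoD[OF c]
  have zp: "z p \<in> U" using D(3,4) pw by blast
  obtain \<phi> r where \<phi>: "test_function N \<phi>" "r > 0" "\<phi> (z p) = \<sigma> (z p)" "coord_box N (z p) r \<subseteq> U"
    "\<forall>w\<in>coord_box N (z p) r. \<phi> w \<le> \<sigma> w"
    using strictly_psh_minorant[OF D(2) \<sigma>(1) zp] by blast
  have "openin (Cspace N) (coord_box N (z p) r)"
  proof -
    have "open {w. \<bar>coord a w - coord a (z p)\<bar> < r}" for a
      by (intro open_Collect_less continuous_intros continuous_on_coord)
    then have "open (\<Inter>a\<in>coords N. {w. \<bar>coord a w - coord a (z p)\<bar> < r})" by (intro open_INT) auto
    moreover have "coord_box N (z p) r = Cn N \<inter> (\<Inter>a\<in>coords N. {w. \<bar>coord a w - coord a (z p)\<bar> < r})"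
      unfolding coord_box_def by blast
    ultimately show ?thesis by (simp add: Cspace_Cn openin_open_Int)
  qed
  note O = openin_chart_preimage[OF c this]
  let ?V = "A \<inter> {x \<in> \<omega>. z x \<in> coord_box N (z p) r}"
  show ?thesis unfolding touched_def
  proof (intro exI conjI ballI)
    show "local_model_iso X \<O> \<omega> N U Z z" by fact
    show "test_function N (\<lambda>w. e * \<phi> w)" by (rule test_function_cmult[OF \<phi>(1) e])
    show "openin (subtopology X A) ?V" using O by (rule openin_subtopology_Int2)
    have "z p \<in> coord_box N (z p) r"
      using zp openin_Cspace_subset[OF D(2)] \<phi>(2) by (auto simp: coord_box_def)
    then show "p \<in> ?V" using p pw by simp
    show "?V \<subseteq> \<omega>" by blast
    fix y assume y: "y \<in> ?V"
    then have "e * \<phi> (z y) \<le> e * \<rho> y" using \<phi>(5) \<sigma>(2) e by simp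
    moreover have "\<rho> p = \<phi> (z p)" using \<phi>(3) \<sigma>(2) pw by simp
    ultimately show "(cmod (f y))\<^sup>2 + e * \<phi> (z y) \<le> (cmod (f p))\<^sup>2 + e * \<phi> (z p)"
      using max[of y] y by simp
  qed
qed


text \<open>\<open>A\<close> is compact Hausdorff, hence regular. The set \<open>K - V0\<close>
  plays the role of the boundary of the neighbourhood.\<close>

lemma compact_neighbourhood:
  assumes X: "Hausdorff_space X" and A: "compactin X A" and V: "openin (subtopology X A) V" "x \<in> V"
  obtains V0 K where "openin (subtopology X A) V0" "x \<in> V0" "V0 \<subseteq> K" "K \<subseteq> V" "compactin X K" "compactin X (K - V0)"
proof -
  let ?A = "subtopology X A"
  have cA: "compact_space ?A" using A by (simp add: compact_space_subtopology)
  then have "regular_space ?A"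
    using Hausdorff_space_subtopology[OF X] compact_Hausdorff_imp_regular_space by blast
  then have "neighbourhood_base_of (closedin ?A) ?A" by (simp add: neighbourhood_base_of_closedin)
  then obtain V0 K where K: "openin ?A V0" "closedin ?A K" "x \<in> V0" "V0 \<subseteq> K" "K \<subseteq> V"
    using V unfolding neighbourhood_base_of by metis
  have comp: "compactin X C" if "closedin ?A C" for C
    using closedin_compact_space[OF cA that] by (simp add: compactin_subtopology)
  show thesis
    by (rule that[OF K(1,3,4,5) comp[OF K(2)] comp[OF closedin_diff[OF K(2,1)]]])
qed

text \<open>Replacing \<open>\<phi>\<close> by \<open>\<phi> - e dist_sq\<close> makes the local maximum strict, hence stable.\<close>

lemma touched_limit:
  assumes X: "Hausdorff_space X" and A: "compactin X A"
    and U: "openin (subtopology X A) U" "x \<in> U"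
    and f: "continuous_map (subtopology X U) euclidean f"
    and F: "\<And>n. continuous_map (subtopology X U) euclidean (F n)"
    and lim: "\<And>K. compactin X K \<Longrightarrow> K \<subseteq> U \<Longrightarrow> uniform_limit K F f sequentially"
    and t: "touched X \<O> A f x"
  shows "\<exists>n. \<exists>y\<in>U. touched X \<O> A (F n) y"
proof -
  obtain \<omega> N U' Z z \<phi> V where c: "local_model_iso X \<O> \<omega> N U' Z z" and \<phi>: "test_function N \<phi>"
    and V: "openin (subtopology X A) V" "x \<in> V" "V \<subseteq> \<omega>"
    and le: "\<And>y. y \<in> V \<Longrightarrow> (cmod (f y))\<^sup>2 + \<phi> (z y) \<le> (cmod (f x))\<^sup>2 + \<phi> (z x)"
    using t unfolding touched_def by blast
  note D = local_model_isoD[OF c]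
  obtain e where e: "e > 0" and \<phi>': "test_function N (\<lambda>w. \<phi> w + - e * dist_sq N (z x) w)"
    using test_function_perturb[OF \<phi>] by blast
  define \<psi> where "\<psi> y = \<phi> (z y) + - e * dist_sq N (z x) (z y)" for y
  have "x \<in> U \<inter> V" using U(2) V(2) by blast
  from compact_neighbourhood[OF X A openin_Int[OF U(1) V(1)] this]
  obtain V0 K where K: "openin (subtopology X A) V0" "x \<in> V0" "V0 \<subseteq> K" "K \<subseteq> U \<inter> V" "compactin X K"
      "compactin X (K - V0)" .
  have KU: "K \<subseteq> U" and K\<omega>: "K \<subseteq> \<omega>" and xK: "x \<in> K" using K V(3) by auto
  have UC: "U' \<subseteq> Cn N" by (rule openin_Cspace_subset[OF D(2)])
  have cont\<phi>: "continuous_on U' \<phi>"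
    using Ck_on_continuous[OF openin_Cspace_Cn test_functionD(1)[OF \<phi>]] UC continuous_on_subset by blast
  have d_cont: "continuous_map (subtopology X \<omega>) euclidean (\<lambda>y. dist_sq N (z x) (z y))"
    by (rule continuous_map_chart[OF c continuous_on_dist_sq])
  have \<psi>_cont: "continuous_map (subtopology X K) euclidean \<psi>"
    unfolding \<psi>_def[abs_def]
    by (rule continuous_map_restrict[OF continuous_map_chart[OF c] K\<omega>])
       (intro continuous_on_add continuous_on_mult continuous_on_const continuous_on_dist_sq cont\<phi>)
  \<comment> \<open>\<open>z\<close> is injective and \<open>x\<close> lies in \<open>V0\<close>, so
    the distance to \<open>z x\<close> has no zero on the compact set \<open>K - V0\<close>.\<close>
  have "\<exists>d>0. \<forall>y\<in>K - V0. d \<le> dist_sq N (z x) (z y)"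
  proof (cases "K - V0 = {}")
    case True
    show ?thesis unfolding True by (intro exI[of _ 1]) simp
  next
    case False
    have "K - V0 \<subseteq> \<omega>" using K\<omega> by blast
    then have "continuous_map (subtopology X (K - V0)) euclideanreal (\<lambda>y. - dist_sq N (z x) (z y))"
      using continuous_map_restrict[OF d_cont] by (simp add: continuous_map_minus)
    from compactin_attains_max[OF K(6) False this]
    obtain y where y: "y \<in> K - V0" "\<forall>w\<in>K - V0. - dist_sq N (z x) (z w) \<le> - dist_sq N (z x) (z y)" by blast
    have "dist_sq N (z x) (z y) \<noteq> 0"
    proof
      assume "dist_sq N (z x) (z y) = 0"
      then have "\<forall>i<N. z y i = z x i"
        unfolding dist_sq_def by (subst (asm) sum_nonneg_eq_0_iff) auto
      moreover have "z y \<in> Cn N" "z x \<in> Cn N" using D(3,4) UC y(1) xK K\<omega> by blast+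
      ultimately have "z y i = z x i" for i by (cases "i < N") (auto simp: Cn_def)
      then have "z y = z x" by (rule ext)
      then have "y = x" using inj_onD[OF D(5)] y(1) xK K\<omega> by blast
      then show False using y(1) K(2) by blast
    qed
    moreover have "dist_sq N (z x) (z y) \<ge> 0" by (simp add: dist_sq_def sum_nonneg)
    ultimately have "dist_sq N (z x) (z y) > 0" by linarith
    then show ?thesis using y(2) by (intro exI[of _ "dist_sq N (z x) (z y)"]) auto
  qed
  then obtain d where d: "d > 0" "\<And>y. y \<in> K - V0 \<Longrightarrow> d \<le> dist_sq N (z x) (z y)" by blast
  have \<psi>x: "\<psi> x = \<phi> (z x)" by (simp add: \<psi>_def dist_sq_def)
  have strict: "(cmod (f y))\<^sup>2 + \<psi> y \<le> (cmod (f x))\<^sup>2 + \<psi> x - e * d" if y: "y \<in> K - V0" for y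
  proof -
    have "e * d \<le> e * dist_sq N (z x) (z y)" using d(2)[OF y] e by simp
    moreover have "y \<in> V" using y K(4) by blast
    ultimately show ?thesis using le[of y] unfolding \<psi>x by (simp add: \<psi>_def)
  qed
  obtain b where b: "\<And>y. y \<in> K \<Longrightarrow> (cmod (f y))\<^sup>2 \<le> b"
    using compactin_attains_max[OF K(5) _ continuous_map_norm_sq[OF continuous_map_restrict[OF f KU]]] xK by blast
  \<comment> \<open>\<open>b\<close> bounds the squared modulus; since \<open>1 \<le> B\<close>,
    also \<open>b \<le> B \<le> B^2\<close>, so \<open>B\<close> bounds the modulus itself.\<close>
  define B where "B = max 1 b"
  have B: "B \<ge> 1" "cmod (f y) \<le> B" if "y \<in> K" for y
  proof -
    show "B \<ge> 1" by (simp add: B_def)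
    have "(cmod (f y))\<^sup>2 \<le> B\<^sup>2"
    proof -
      have "b \<le> B" "B \<le> B\<^sup>2" using \<open>B \<ge> 1\<close> by (simp_all add: B_def[symmetric] self_le_power) (simp add: B_def)
      then show ?thesis using b[OF that] by linarith
    qed
    then show "cmod (f y) \<le> B" by (rule power2_le_imp_le) (simp add: B_def)
  qed
  \<comment> \<open>An error \<open>\<eta> \<le> 1\<close> in \<open>f\<close> changes its squared
    modulus by at most \<open>\<eta> * (2 * B + 1) \<le> e * d / 4\<close>. Two such errors, at
    \<open>x\<close> and at the new maximum point, stay below the margin
    \<open>e * d\<close>.\<close>
  define \<eta> where "\<eta> = min 1 (e * d / (4 * (2 * B + 1)))"
  have B1: "B \<ge> 1" by (simp add: B_def)
  have \<eta>: "\<eta> > 0" "\<eta> \<le> 1" "\<eta> * (2 * B + 1) \<le> e * d / 4"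
  proof -
    show "\<eta> > 0" "\<eta> \<le> 1" using e d B1 by (simp_all add: \<eta>_def)
    have "\<eta> * (2 * B + 1) \<le> e * d / (4 * (2 * B + 1)) * (2 * B + 1)"
      using B1 by (intro mult_right_mono) (auto simp: \<eta>_def)
    also have "\<dots> = e * d / 4" using B1 by (simp add: field_simps)
    finally show "\<eta> * (2 * B + 1) \<le> e * d / 4" .
  qed
  from uniform_limitD[OF lim[OF K(5) KU] \<eta>(1)] obtain n where n: "\<And>y. y \<in> K \<Longrightarrow> dist (F n y) (f y) < \<eta>"
    unfolding eventually_sequentially by blast
  have close: "\<bar>(cmod (F n y))\<^sup>2 - (cmod (f y))\<^sup>2\<bar> \<le> e * d / 4" if y: "y \<in> K" for y
  proof -
    have 1: "\<bar>cmod (F n y) - cmod (f y)\<bar> \<le> \<eta>"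
      using n[OF y] norm_triangle_ineq3[of "F n y" "f y"] by (simp add: dist_norm)
    then have 2: "\<bar>cmod (F n y) + cmod (f y)\<bar> \<le> 2 * B + 1" using B(2)[OF y] \<eta>(2) by auto
    have "(cmod (F n y))\<^sup>2 - (cmod (f y))\<^sup>2 = (cmod (F n y) - cmod (f y)) * (cmod (F n y) + cmod (f y))"
      by (simp add: power2_eq_square algebra_simps)
    then have "\<bar>(cmod (F n y))\<^sup>2 - (cmod (f y))\<^sup>2\<bar> \<le> \<eta> * (2 * B + 1)"
      using mult_mono[OF 1 2] \<eta>(1) by (simp add: abs_mult)
    then show ?thesis using \<eta>(3) by linarith
  qed
  have "continuous_map (subtopology X K) euclideanreal (\<lambda>y. (cmod (F n y))\<^sup>2 + \<psi> y)"
    by (intro continuous_map_add \<psi>_cont continuous_map_norm_sq continuous_map_restrict[OF F KU])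
  from compactin_attains_max[OF K(5) _ this] xK
  obtain y where y: "y \<in> K" "\<forall>w\<in>K. (cmod (F n w))\<^sup>2 + \<psi> w \<le> (cmod (F n y))\<^sup>2 + \<psi> y" by blast
  \<comment> \<open>A maximum over \<open>K\<close> is a local maximum on \<open>A\<close> once it
    lies in the open set \<open>V0\<close>.\<close>
  have "y \<in> V0"
  proof (rule ccontr)
    assume "y \<notin> V0"
    then have "(cmod (f y))\<^sup>2 + \<psi> y \<le> (cmod (f x))\<^sup>2 + \<psi> x - e * d" using y(1) by (intro strict) blast
    moreover have "(cmod (F n x))\<^sup>2 + \<psi> x \<le> (cmod (F n y))\<^sup>2 + \<psi> y" using y(2) xK by blast
    moreover have "e * d > 0" using e d by simp
    ultimately show False using close[OF y(1)] close[OF xK] by linarith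
  qed
  have "touched X \<O> A (F n) y"
    unfolding touched_def
  proof (intro exI conjI ballI)
    show "local_model_iso X \<O> \<omega> N U' Z z" by fact
    show "test_function N (\<lambda>w. \<phi> w + - e * dist_sq N (z x) w)" by fact
    show "openin (subtopology X A) V0" "y \<in> V0" "V0 \<subseteq> \<omega>" using K K\<omega> \<open>y \<in> V0\<close> by auto
    fix w assume "w \<in> V0"
    then show "(cmod (F n w))\<^sup>2 + (\<phi> (z w) + - e * dist_sq N (z x) (z w))
        \<le> (cmod (F n y))\<^sup>2 + (\<phi> (z y) + - e * dist_sq N (z x) (z y))"
      using y(2) K(3) unfolding \<psi>_def by blast
  qed
  then show ?thesis using y(1) KU by blast
qed

section \<open>Germs\<close>

lemma germ_at_eqD:
  assumes "germ_at X A x f = germ_at X A y g" "A \<subseteq> topspace X" "y \<in> A"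
  shows "x = y" "\<exists>V. openin (subtopology X A) V \<and> y \<in> V \<and> (\<forall>w\<in>V. f w = g w)"
proof -
  show xy: "x = y" using assms(1) by (simp add: germ_at_def)
  have "openin (subtopology X A) A" using assms(2)
    by (metis inf.absorb2 openin_topspace topspace_subtopology)
  then have "g \<in> snd (germ_at X A y g)" using assms(3) unfolding germ_at_def by auto
  then have "g \<in> snd (germ_at X A x f)" using assms(1) by simp
  then obtain V where "openin (subtopology X A) V" "x \<in> V" "\<forall>w\<in>V. g w = f w"
    unfolding germ_at_def by auto
  then show "\<exists>V. openin (subtopology X A) V \<and> y \<in> V \<and> (\<forall>w\<in>V. f w = g w)" using xy by metis
qed

text \<open>One representative is enough, by \<open>touched_cong\<close>. Continuity is included
  because \<open>iterated_germ_closure\<close> intersects sets of continuous germs only.\<close>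

definition untouched_germs ::
    "'a topology \<Rightarrow> ('a set \<Rightarrow> ('a \<Rightarrow> complex) set) \<Rightarrow> 'a set \<Rightarrow> 'a set \<Rightarrow> 'a germ set" where
  "untouched_germs X \<O> A P = {germ_at X A x f | x f. x \<in> A \<and> (x \<notin> P \<longrightarrow> \<not> touched X \<O> A f x) \<and>
     (\<exists>V. openin (subtopology X A) V \<and> x \<in> V \<and> continuous_map (subtopology X V) euclidean f)}"

lemma untouched_germsD:
  assumes g: "germ_at X A x f \<in> untouched_germs X \<O> A P" and A: "A \<subseteq> topspace X" and x: "x \<notin> P"
  shows "\<not> touched X \<O> A f x"
proof
  assume t: "touched X \<O> A f x"
  obtain y g where y: "germ_at X A x f = germ_at X A y g" "y \<in> A" "y \<notin> P \<longrightarrow> \<not> touched X \<O> A g y"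
    using g unfolding untouched_germs_def by auto
  have xy: "x = y" by (rule germ_at_eqD(1)[OF y(1) A y(2)])
  obtain V where V: "openin (subtopology X A) V" "y \<in> V" "\<forall>w\<in>V. f w = g w"
    using germ_at_eqD(2)[OF y(1) A y(2)] by blast
  have "touched X \<O> A g y"
    by (rule touched_cong[OF V(1,2)]) (use V(3) t xy in auto)
  then show False using y(3) x xy by simp
qed

text \<open>LACR germs form the smallest closed set above the holomorphic germs, so it suffices that
  the untouched germs contain the latter and are stable under one limit step.\<close>

lemma LACR_germs_subset_untouched:
  assumes X: "reduced_complex_space X \<O>" and A: "compactin X A"
  shows "LACR_germs X \<O> A \<subseteq> untouched_germs X \<O> A (X closure_of pseudoconvex_points X \<O> 1 A)"
proof -
  define P where "P = X closure_of pseudoconvex_points X \<O> 1 A"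
  let ?K = "untouched_germs X \<O> A P"
  have Haus: "Hausdorff_space X" and sh: "function_sheaf X \<O>"
    using X by (simp_all add: reduced_complex_space_def)
  have AX: "A \<subseteq> topspace X" by (rule compactin_subset_topspace[OF A])
  have "?K \<subseteq> continuous_germs X A"
    unfolding untouched_germs_def continuous_germs_def by blast
  moreover have "holomorphic_germs X \<O> A \<subseteq> ?K"
  proof
    fix G assume "G \<in> holomorphic_germs X \<O> A"
    then obtain x h W where x: "G = germ_at X A x h" "x \<in> A" and W: "openin X W" "x \<in> W" "h \<in> \<O> W"
      unfolding holomorphic_germs_def by blast
    have "x \<in> topspace X" using x AX by blast
    from section_continuous[OF X this W]
    obtain V where V: "openin X V" "x \<in> V" "continuous_map (subtopology X V) euclidean h" .
    have "continuous_map (subtopology X (A \<inter> V)) euclidean h"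
      using V(3) by (rule continuous_map_restrict) simp
    moreover have "openin (subtopology X A) (A \<inter> V)" using V(1) by (rule openin_subtopology_Int2)
    moreover have "x \<in> P" if "touched X \<O> A h x"
    proof -
      have "set_pseudoconvex_at X \<O> 1 A x" by (rule touched_holomorphic[OF sh that W])
      then have "x \<in> pseudoconvex_points X \<O> 1 A" using x(2) by (simp add: pseudoconvex_points_def)
      moreover have "pseudoconvex_points X \<O> 1 A \<subseteq> topspace X" using AX by (auto simp: pseudoconvex_points_def)
      ultimately show ?thesis unfolding P_def using closure_of_subset by blast
    qed
    ultimately show "G \<in> ?K" unfolding untouched_germs_def using x V(2) by blast
  qed
  moreover have "germ_closure X A ?K \<subseteq> ?K"
  proof
    fix G assume "G \<in> germ_closure X A ?K"
    then obtain x f U F where G: "G = germ_at X A x f" and U: "openin (subtopology X A) U" "x \<in> U"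
      and f: "continuous_map (subtopology X U) euclidean f" and F: "\<forall>n. F n \<in> sections X A ?K U"
      and lim: "\<forall>K. compactin X K \<and> K \<subseteq> U \<longrightarrow> uniform_limit K F f sequentially"
      unfolding germ_closure_def by blast
    have UA: "U \<subseteq> A" by (rule openin_imp_subset[OF U(1)])
    have "x \<in> P" if t: "touched X \<O> A f x"
    proof (rule ccontr)
      assume xP: "x \<notin> P"
      have "openin X (topspace X - P)" unfolding P_def by (intro openin_diff closedin_closure_of) simp
      then have U': "openin (subtopology X A) (U \<inter> (A \<inter> (topspace X - P)))"
        by (intro openin_Int U(1) openin_subtopology_Int2)
      \<comment> \<open>Removing the closed set \<open>P\<close> keeps the domain open in
        \<open>A\<close> and forces the nearby touched point to lie outside
        \<open>P\<close>.\<close>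
      let ?U = "U \<inter> (A \<inter> (topspace X - P))"
      have sub: "?U \<subseteq> U" by blast
      have "\<exists>n. \<exists>y\<in>?U. touched X \<O> A (F n) y"
      proof (rule touched_limit[OF Haus A U' _ continuous_map_restrict[OF f sub] _ _ t])
        show "x \<in> ?U" using U(2) UA AX xP by blast
        show "continuous_map (subtopology X ?U) euclidean (F n)" for n
          by (rule continuous_map_restrict[OF _ sub]) (use F in \<open>simp add: sections_def\<close>)
        show "uniform_limit K F f sequentially" if "compactin X K" "K \<subseteq> ?U" for K
          using lim that by blast
      qed
      then obtain n y where y: "y \<in> ?U" "touched X \<O> A (F n) y" by blast
      then have "germ_at X A y (F n) \<in> ?K" using F by (simp add: sections_def)
      from untouched_germsD[OF this AX] y show False by blast
    qed
    then show "G \<in> ?K" unfolding untouched_germs_def G using U UA f by blast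
  qed
  ultimately show ?thesis
    unfolding LACR_germs_def iterated_germ_closure_def P_def[symmetric] by (intro Inter_lower) simp
qed

section \<open>Maxima over \<open>A\<close>\<close>

lemma strictly_psh_on_space_continuous:
  assumes "strictly_psh_on_space X \<O> \<rho>"
  shows "continuous_map X euclideanreal \<rho>"
  unfolding continuous_map_eq_topcontinuous_at
proof
  fix p assume p: "p \<in> topspace X"
  obtain \<omega> N U Z z \<sigma> where pw: "p \<in> \<omega>" and c: "local_model_iso X \<O> \<omega> N U Z z"
    and \<sigma>: "strictly_psh_Cn N U \<sigma>" "\<forall>x\<in>\<omega>. \<rho> x = \<sigma> (z x)"
    using assms p unfolding strictly_psh_on_space_def by metis
  note D = local_model_isoD[OF c]
  have ts: "topspace (subtopology X \<omega>) = \<omega>" using openin_subset[OF D(1)] by auto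
  have "continuous_on U \<sigma>" using \<sigma>(1) Ck_on_continuous[OF D(2)] unfolding strictly_psh_Cn_def by blast
  from continuous_map_chart[OF c this] have "continuous_map (subtopology X \<omega>) euclideanreal \<rho>"
    by (rule continuous_map_eq) (use \<sigma>(2) ts in auto)
  then have pre: "openin X {x \<in> \<omega>. \<rho> x \<in> V}" if "open V" for V
    using openin_continuous_map_preimage[of "subtopology X \<omega>" euclideanreal \<rho> V] that
      openin_trans_full[OF _ D(1)] unfolding ts by simp
  show "topcontinuous_at X euclideanreal \<rho> p"
    unfolding topcontinuous_at_def
  proof (intro conjI allI impI)
    fix V assume "openin euclideanreal V \<and> \<rho> p \<in> V"
    then show "\<exists>U. openin X U \<and> p \<in> U \<and> (\<forall>y\<in>U. \<rho> y \<in> V)"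
      using pre[of V] pw by (intro exI[of _ "{x \<in> \<omega>. \<rho> x \<in> V}"]) simp
  qed (use p in auto)
qed

lemma exists_touched_max:
  assumes psh: "strictly_psh_on_space X \<O> \<rho>" and A: "compactin X A" "A \<noteq> {}" and e: "e > 0"
    and f: "continuous_map (subtopology X A) euclidean f"
  shows "\<exists>p\<in>A. touched X \<O> A f p \<and> (\<forall>y\<in>A. (cmod (f y))\<^sup>2 + e * \<rho> y \<le> (cmod (f p))\<^sup>2 + e * \<rho> p)"
proof -
  have "continuous_map (subtopology X A) euclideanreal (\<lambda>y. (cmod (f y))\<^sup>2 + e * \<rho> y)"
    by (intro continuous_map_add continuous_map_norm_sq f continuous_map_real_mult_left
        continuous_map_from_subtopology strictly_psh_on_space_continuous[OF psh])
  from compactin_attains_max[OF A this]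
  obtain p where p: "p \<in> A" "\<forall>y\<in>A. (cmod (f y))\<^sup>2 + e * \<rho> y \<le> (cmod (f p))\<^sup>2 + e * \<rho> p" by blast
  have "touched X \<O> A f p"
    using p by (intro touched_max[OF psh compactin_subset_topspace[OF A(1)] _ e]) auto
  then show ?thesis using p by blast
qed

lemma pseudoconvex_points_nonempty:
  assumes X: "reduced_complex_space X \<O>" and psh: "strictly_psh_on_space X \<O> \<rho>"
    and A: "compactin X A" "A \<noteq> {}"
  shows "pseudoconvex_points X \<O> 1 A \<noteq> {}"
proof -
  obtain p where p: "p \<in> A" "touched X \<O> A (\<lambda>_. 0) p"
    using exists_touched_max[OF psh A, of 1 "\<lambda>_. 0"] by auto
  obtain \<omega> N U Z z where pw: "p \<in> \<omega>" and c: "local_model_iso X \<O> \<omega> N U Z z"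
    using X p(1) compactin_subset_topspace[OF A(1)] unfolding reduced_complex_space_def by blast
  note D = local_model_isoD[OF c]
  have "holomorphic_Cn N U (\<lambda>_. 0)" by (simp add: holomorphic_Cn_def)
  then have "local_holomorphic N (z ` \<omega>) (\<lambda>_. 0)"
    unfolding local_holomorphic_def using D(2,3,4) by blast
  then have "(\<lambda>_. 0) \<in> \<O> \<omega>" using D(9)[OF D(1) order_refl, of "\<lambda>_. 0"] by (simp add: o_def)
  moreover have "function_sheaf X \<O>" using X by (simp add: reduced_complex_space_def)
  ultimately have "set_pseudoconvex_at X \<O> 1 A p"
    using touched_holomorphic[OF _ p(2) D(1) pw] by blast
  then show ?thesis using p(1) by (auto simp: pseudoconvex_points_def)
qed

text \<open>\<open>A\<close> is closed in \<open>X\<close>, so the closure of \<open>S\<close> stays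
  where \<open>u\<close> is continuous. Read contrapositively, a point of \<open>A\<close> at which
  the modulus of \<open>u\<close> exceeds \<open>m\<close> lies outside the closure.\<close>

lemma norm_le_on_closure:
  assumes X: "Hausdorff_space X" and A: "compactin X A" and u: "continuous_map (subtopology X A) euclidean u"
    and S: "S \<subseteq> A" "\<And>p. p \<in> S \<Longrightarrow> cmod (u p) \<le> m" and p: "p \<in> X closure_of S"
  shows "cmod (u p) \<le> m"
proof -
  have AX: "A \<subseteq> topspace X" by (rule compactin_subset_topspace[OF A])
  have "continuous_map (subtopology X A) euclideanreal (\<lambda>y. cmod (u y))" using u by (rule continuous_map_norm)
  then have "closedin (subtopology X A) {y \<in> topspace (subtopology X A). cmod (u y) \<in> {..m}}"
    by (rule closedin_continuous_map_preimage) simp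
  then have "closedin X {y \<in> topspace (subtopology X A). cmod (u y) \<in> {..m}}"
    by (rule closedin_trans_full) (rule compactin_imp_closedin[OF X A])
  moreover have "S \<subseteq> {y \<in> topspace (subtopology X A). cmod (u y) \<in> {..m}}" using S AX by auto
  ultimately show ?thesis using closure_of_minimal[of S _ X] p by blast
qed

theorem theorem3p8:
  fixes X :: "'a topology" and \<O> :: "'a set \<Rightarrow> ('a \<Rightarrow> complex) set"
    and \<rho> :: "'a \<Rightarrow> real" and A :: "'a set"
  assumes "reduced_complex_space X \<O>"
    and "pure_dimensional X \<O>"
    and "strictly_psh_on_space X \<O> \<rho>"
    and "compactin X A"
    and "A \<noteq> {}"
  shows "pseudoconvex_points X \<O> 1 A \<noteq> {} \<and>
    (\<forall>u. continuous_map (subtopology X A) euclidean u \<and>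
         u \<in> sections X A (LACR_germs X \<O> A) (A - X closure_of pseudoconvex_points X \<O> 1 A)
       \<longrightarrow> (\<exists>a\<in>A. (\<forall>p\<in>A. cmod (u p) \<le> cmod (u a)) \<and>
              cmod (u a) = (SUP p\<in>pseudoconvex_points X \<O> 1 A. cmod (u p))))"
proof (intro conjI allI impI)
  let ?S = "pseudoconvex_points X \<O> 1 A"
  show ne: "?S \<noteq> {}" by (rule pseudoconvex_points_nonempty[OF assms(1,3,4,5)])
  have SA: "?S \<subseteq> A" by (auto simp: pseudoconvex_points_def)
  have AX: "A \<subseteq> topspace X" by (rule compactin_subset_topspace[OF assms(4)])
  fix u assume "continuous_map (subtopology X A) euclidean u \<and>
      u \<in> sections X A (LACR_germs X \<O> A) (A - X closure_of ?S)"
  then have u: "continuous_map (subtopology X A) euclidean u"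
    and us: "u \<in> sections X A (LACR_germs X \<O> A) (A - X closure_of ?S)" by auto
  obtain a where a: "a \<in> A" "\<forall>p\<in>A. cmod (u p) \<le> cmod (u a)"
    using compactin_attains_max[OF assms(4,5) continuous_map_norm[OF u]] by blast
  define m where "m = (SUP p\<in>?S. cmod (u p))"
  have bdd: "bdd_above ((\<lambda>p. cmod (u p)) ` ?S)" using a(2) SA by (intro bdd_aboveI2[of _ _ "cmod (u a)"]) blast
  have le_m: "cmod (u p) \<le> m" if "p \<in> ?S" for p unfolding m_def by (rule cSUP_upper[OF that bdd])
  have m0: "m \<ge> 0" using ne le_m norm_ge_zero order_trans by blast
  have "m \<le> cmod (u a)" unfolding m_def using a(2) SA by (intro cSUP_least ne) blast
  moreover have "\<not> m < cmod (u a)"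
  proof
    assume lt: "m < cmod (u a)"
    have rho: "continuous_map (subtopology X A) euclideanreal \<rho>"
      by (rule continuous_map_from_subtopology[OF strictly_psh_on_space_continuous[OF assms(3)]])
    obtain y1 y2 where y: "\<forall>y\<in>A. \<rho> y \<le> \<rho> y1" "\<forall>y\<in>A. - \<rho> y \<le> - \<rho> y2"
      using compactin_attains_max[OF assms(4,5) rho]
        compactin_attains_max[OF assms(4,5) continuous_map_minus[OF rho]] by blast
    \<comment> \<open>A strict bound for the oscillation of \<open>\<rho>\<close> on
      \<open>A\<close>, positive also when \<open>\<rho>\<close> is constant there.\<close>
    define R where "R = \<bar>\<rho> y1\<bar> + \<bar>\<rho> y2\<bar> + 1"
    have R: "R > 0" "\<And>y y'. y \<in> A \<Longrightarrow> y' \<in> A \<Longrightarrow> \<rho> y - \<rho> y' < R"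
      using y unfolding R_def by (smt (verit))+
    \<comment> \<open>With this choice the perturbation \<open>e * (\<rho> p - \<rho> a)\<close> is
      smaller than the gap \<open>|u a|^2 - m^2\<close>, so \<open>|u p| > m\<close> at the
      perturbed maximum point.\<close>
    define e where "e = ((cmod (u a))\<^sup>2 - m\<^sup>2) / R"
    have gap: "(cmod (u a))\<^sup>2 - m\<^sup>2 > 0" using lt m0 by (simp add: power_strict_mono)
    then have e: "e > 0" "e * R = (cmod (u a))\<^sup>2 - m\<^sup>2" using R(1) by (simp_all add: e_def)
    obtain p where p: "p \<in> A" "touched X \<O> A u p" "(cmod (u a))\<^sup>2 + e * \<rho> a \<le> (cmod (u p))\<^sup>2 + e * \<rho> p"
      using exists_touched_max[OF assms(3-5) e(1) u] a(1) by blast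
    have "e * (\<rho> p - \<rho> a) < e * R" using R(2)[OF p(1) a(1)] e(1) by simp
    then have "m\<^sup>2 < (cmod (u p))\<^sup>2" using p(3) e(2) by (simp add: algebra_simps)
    then have "m < cmod (u p)" by (rule power_less_imp_less_base) simp
    moreover have "Hausdorff_space X" using assms(1) by (simp add: reduced_complex_space_def)
    ultimately have pc: "p \<notin> X closure_of ?S"
      using norm_le_on_closure[OF _ assms(4) u SA le_m] by fastforce
    then have "germ_at X A p u \<in> LACR_germs X \<O> A" using us p(1) by (simp add: sections_def)
    then have "germ_at X A p u \<in> untouched_germs X \<O> A (X closure_of ?S)"
      using LACR_germs_subset_untouched[OF assms(1,4)] by blast
    from untouched_germsD[OF this AX pc] p(2) show False by blast
  qed
  ultimately have "cmod (u a) = m" by linarith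
  then show "\<exists>a\<in>A. (\<forall>p\<in>A. cmod (u p) \<le> cmod (u a)) \<and> cmod (u a) = (SUP p\<in>?S. cmod (u p))"
    using a unfolding m_def by blast
qed

end
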